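(* Let $O\in\mathbb P$, let $u$ be a coordinate on $\mathbb P$ vanishing at $O$, and for $n\in\mathbb Z$ let $L_n={}_O\mathbf L^{X_n}:{}_O\mathbf W\to{}_O\mathbf W$, where $X_n=-u^{n+1}\,d/du$. Then for all $l,m\in\mathbb Z$ $$[L_l,L_m]=(l-m)L_{l+m}+\frac{l^3-l}{12}\,\delta_{l+m,0}.$$
   Context: $\mathbb P$ is a complex projective line and $O\in\mathbb P$; a coordinate is a meromorphic function with exactly one pole, which is simple. A meromorphic 1-form is of the second kind if all its residues vanish. ${}_O\mathbf K$ is the space of meromorphic 1-forms on $\mathbb P$ regular outside $O$ (these are automatically of the second kind), and ${}_O\mathbf W=S^*({}_O\mathbf K)$ is its symmetric algebra, with product $\otimes^s$ and vacuum $\mathbf 1=1\in\mathbb C$. Elements of $S^2$ are regarded as symmetric bidifferentials in two points $u_1,u_2$ (products being symmetrised by averaging). Hats mark omitted factors; $\mathcal L_X$ is the Lie derivative and $i_X$ is contraction. For a meromorphic vector field $X$ on $\mathbb P$, the operator ${}_O\mathbf L^X=\mathcal X^-+\mathcal X^0+\mathcal X^+:{}_O\mathbf W\to{}_O\mathbf W$, linear in $X$, is defined by $$\mathcal X^-(\alpha_1\otimes^s\cdots\otimes^s\alpha_p)=-\sum_{i<j}(\alpha_1\otimes^s\cdots\widehat{\alpha_i}\cdots\widehat{\alpha_j}\cdots\otimes^s\alpha_p)\,\mathrm{Res}_O\bigl((i_X\alpha_i)\alpha_j\bigr),$$ $$\mathcal X^0(\alpha_1\otimes^s\cdots\otimes^s\alpha_p)=\sum_i\alpha_1\otimes^s\cdots\otimes^s{}_O[\mathcal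 L_X\alpha_i]\otimes^s\cdots\otimes^s\alpha_p,$$ $$\mathcal X^+(\alpha_1\otimes^s\cdots\otimes^s\alpha_p)=\mathcal X^+(\mathbf 1)\otimes^s\alpha_1\otimes^s\cdots\otimes^s\alpha_p .$$ Here ${}_O[\cdot]$ is the linear projection on meromorphic forms of the second kind with ${}_O[\eta]=\eta$ if $\eta$ is regular away from $O$ and ${}_O[\eta]=0$ if $\eta$ is regular at $O$. Further, $\mathcal X^+(\mathbf 1)=0$ if $X$ is regular at $O$, and $\mathcal X^+(\mathbf 1)=\omega_X$ if $X=\xi(u)\,d/du$ is regular away from $O$, where $$\omega_X=\left\{\frac{2(\xi(u_1)-\xi(u_2))-(\xi'(u_1)+\xi'(u_2))(u_1-u_2)}{2(u_1-u_2)}\right\}\frac{du_1\otimes^s du_2}{(u_1-u_2)^2}\in S^2({}_O\mathbf K).$$ The form $\omega_X$ vanishes for vector fields regular on all of $\mathbb P$, so the two cases are consistent and extend linearly to all meromorphic $X$.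
   Formalization: The contraction term 𝒳^- is taken with a plus sign before the sum of residues instead of the stated minus sign, because with the stated sign and ω_X one gets [L_2,L_{-2}]1 = -1/2 rather than 1/2. *)

theory Defs
  imports
    "HOL-Complex_Analysis.Complex_Analysis"
    "HOL-Library.Multiset"
    "HOL-Library.Poly_Mapping"
begin

section \<open>The complex projective line and its field of meromorphic functions\<close>

text \<open>
  The complex projective line is the Riemann sphere \<open>\<complex> \<union> {\<infinity>}\<close> with its two standard charts
  \<open>z\<close> and \<open>1/z\<close>. Every complex projective line is isomorphic to it, and neither the base point
  nor the coordinate used in the theorem is tied to the standard chart.
\<close>

datatype cpline = Pt complex | Infty

text \<open>
  A meromorphic function on the line is given by its expression \<open>f\<close> in the chart \<open>z\<close>. It is
  normalised so as to have no removable singularities and the dummy value 0 at its poles, so that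
  equality in the type is equality of meromorphic functions. The second condition is
  meromorphy at \<open>\<infinity>\<close>.
\<close>

definition pre_mero :: "(complex \<Rightarrow> complex) \<Rightarrow> bool" where
  "pre_mero f \<longleftrightarrow> f meromorphic_on UNIV \<and> (\<lambda>w. f (inverse w)) meromorphic_on {0}"

typedef mero = "{f. pre_mero f \<and> f nicely_meromorphic_on UNIV}"
  morphisms ev Abs_mero
  by (rule exI[of _ "\<lambda>_. 0"]) (auto simp: pre_mero_def intro!: meromorphic_intros)

definition mk_mero :: "(complex \<Rightarrow> complex) \<Rightarrow> mero" where
  "mk_mero f = Abs_mero (remove_sings f)"

lemma pre_mero_ev: "pre_mero (ev f)"
  using ev[of f] by auto

lemma nicely_ev: "ev f nicely_meromorphic_on UNIV"
  using ev[of f] by auto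

lemma eventually_at_infinity_analytic:
  assumes "pre_mero f"
  shows "eventually (\<lambda>z. f analytic_on {z}) at_infinity"
proof -
  define g where "g = (\<lambda>w. f (inverse w))"
  have "g meromorphic_on {0}" using assms by (simp add: g_def pre_mero_def)
  then have "isolated_singularity_at g 0" by (simp add: meromorphic_at_iff)
  then obtain r where r: "r > 0" "g analytic_on ball 0 r - {0}"
    by (auto simp: isolated_singularity_at_def)
  have "f analytic_on {z}" if z: "norm z \<ge> 2 / r" for z
  proof -
    have z0: "z \<noteq> 0" using z r by (auto simp: field_simps)
    have "2 \<le> r * norm z" using z r by (simp add: field_simps)
    moreover have "0 < norm z" using z0 by simp
    ultimately have "norm (inverse z) < r"
      by (simp add: norm_inverse inverse_eq_divide pos_divide_less_eq norm_divide)
    then have mem: "inverse z \<in> ball 0 r - {0}" using z0 by auto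
    have "g analytic_on {inverse z}" using analytic_on_subset[OF r(2)] mem by auto
    moreover have "inverse analytic_on {z}" using z0 by (intro analytic_intros) auto
    ultimately have "(g \<circ> inverse) analytic_on {z}"
      by (intro analytic_on_compose) auto
    then show ?thesis by (simp add: g_def o_def)
  qed
  then show ?thesis unfolding eventually_at_infinity by blast
qed

lemma pre_mero_remove_sings:
  assumes "pre_mero f"
  shows "pre_mero (remove_sings f)"
proof -
  have "eventually (\<lambda>z. remove_sings f z = f z) at_infinity"
    using eventually_at_infinity_analytic[OF assms] by eventually_elim auto
  then have "eventually (\<lambda>w. remove_sings f (inverse w) = f (inverse w)) (at 0)"
    using filterlim_inverse_at_infinity[where ?'a = complex] by (rule eventually_compose_filterlim)
  then have "(\<lambda>w. remove_sings f (inverse w)) meromorphic_on {0}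
      \<longleftrightarrow> (\<lambda>w. f (inverse w)) meromorphic_on {0}"
    by (intro meromorphic_on_cong) auto
  then show ?thesis
    using assms remove_sings_meromorphic unfolding pre_mero_def by blast
qed

lemma ev_mk_mero: "pre_mero f \<Longrightarrow> ev (mk_mero f) = remove_sings f"
  unfolding mk_mero_def
  by (subst Abs_mero_inverse)
    (use pre_mero_remove_sings remove_sings_nicely_meromorphic pre_mero_def in blast, rule refl)

lemma ev_mk_mero_eventually:
  "pre_mero f \<Longrightarrow> eventually (\<lambda>z. ev (mk_mero f) z = f z) (cosparse UNIV)"
  by (simp add: ev_mk_mero eventually_remove_sings_eq pre_mero_def)

lemma remove_sings_ev [simp]: "remove_sings (ev f) = ev f"
proof
  fix z show "remove_sings (ev f) z = ev f z"
    using nicely_ev[of f] remove_sings_at_pole[of "ev f" z] remove_sings_eqI[of "ev f" "ev f z" z]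
    unfolding nicely_meromorphic_on_def by (metis UNIV_I)
qed

lemma mk_mero_ev [simp]: "mk_mero (ev f) = f"
  by (simp add: mk_mero_def ev_inverse)

lemma mero_eqI:
  assumes "eventually (\<lambda>z. ev f z = ev g z) (cosparse UNIV)"
  shows "f = g"
proof -
  have "remove_sings (ev f) z = remove_sings (ev g) z" for z
    by (rule remove_sings_cong)
      (use assms in \<open>auto intro: eventually_cosparse_imp_eventually_at\<close>)
  then have "ev f = ev g" by (simp add: fun_eq_iff)
  then show ?thesis by (simp add: ev_inject)
qed

lemma pre_mero_const: "pre_mero (\<lambda>_. c)"
  by (auto simp: pre_mero_def intro!: meromorphic_intros)

lemma pre_mero_add: "pre_mero f \<Longrightarrow> pre_mero g \<Longrightarrow> pre_mero (\<lambda>z. f z + g z)"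
  by (auto simp: pre_mero_def intro!: meromorphic_intros)

lemma pre_mero_uminus: "pre_mero f \<Longrightarrow> pre_mero (\<lambda>z. - f z)"
  by (auto simp: pre_mero_def intro!: meromorphic_intros)

lemma pre_mero_mult: "pre_mero f \<Longrightarrow> pre_mero g \<Longrightarrow> pre_mero (\<lambda>z. f z * g z)"
  by (auto simp: pre_mero_def intro!: meromorphic_intros)

lemma pre_mero_inverse: "pre_mero f \<Longrightarrow> pre_mero (\<lambda>z. inverse (f z))"
  by (auto simp: pre_mero_def intro!: meromorphic_intros)

lemma pre_mero_deriv:
  assumes "pre_mero f"
  shows "pre_mero (deriv f)"
proof -
  define h where "h = (\<lambda>w. f (inverse w))"
  have h: "h meromorphic_on {0}" using assms by (simp add: h_def pre_mero_def)
  have "eventually (\<lambda>w. f analytic_on {inverse w}) (at 0)"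
    using eventually_at_infinity_analytic[OF assms] filterlim_inverse_at_infinity[where ?'a = complex]
    by (rule eventually_compose_filterlim)
  moreover have "eventually (\<lambda>w::complex. w \<noteq> 0) (at 0)"
    by (simp add: eventually_at_filter)
  ultimately have "eventually (\<lambda>w. deriv f (inverse w) = - (w\<^sup>2 * deriv h w)) (at 0)"
  proof eventually_elim
    case (elim w)
    have "f field_differentiable at (inverse w)"
      using elim analytic_on_imp_differentiable_at by blast
    then have "(f has_field_derivative deriv f (inverse w)) (at (inverse w))"
      by (simp add: DERIV_deriv_iff_field_differentiable)
    moreover have "(inverse has_field_derivative - (inverse w * inverse w)) (at w)"
      using elim by (auto intro!: derivative_eq_intros simp: power2_eq_square)
    ultimately have "((\<lambda>w. f (inverse w)) has_field_derivative
        deriv f (inverse w) * - (inverse w * inverse w)) (at w)"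
      by (rule DERIV_chain2)
    then have "deriv h w = deriv f (inverse w) * - (inverse w * inverse w)"
      unfolding h_def by (rule DERIV_imp_deriv)
    then show ?case using elim by (simp add: field_simps power2_eq_square)
  qed
  then have "(\<lambda>w. deriv f (inverse w)) meromorphic_on {0}
      \<longleftrightarrow> (\<lambda>w. - (w\<^sup>2 * deriv h w)) meromorphic_on {0}"
    by (intro meromorphic_on_cong) auto
  moreover have "(\<lambda>w. - (w\<^sup>2 * deriv h w)) meromorphic_on {0}"
    using h by (intro meromorphic_intros)
  ultimately show ?thesis
    using assms by (auto simp: pre_mero_def intro: meromorphic_on_deriv)
qed

lemmas pre_mero_intros =
  pre_mero_const pre_mero_add pre_mero_uminus pre_mero_mult pre_mero_inverse pre_mero_deriv pre_mero_ev

instantiation mero :: field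
begin

definition "0 = mk_mero (\<lambda>_. 0)"
definition "1 = mk_mero (\<lambda>_. 1)"
definition "f + g = mk_mero (\<lambda>z. ev f z + ev g z)"
definition "- f = mk_mero (\<lambda>z. - ev f z)"
definition "f - g = f + (- g :: mero)"
definition "f * g = mk_mero (\<lambda>z. ev f z * ev g z)"
definition "inverse f = mk_mero (\<lambda>z. inverse (ev f z))"
definition "f div g = f * inverse (g :: mero)"

lemma ev_0: "eventually (\<lambda>z. ev 0 z = 0) (cosparse UNIV)"
  unfolding zero_mero_def by (intro ev_mk_mero_eventually pre_mero_intros)

lemma ev_1: "eventually (\<lambda>z. ev 1 z = 1) (cosparse UNIV)"
  unfolding one_mero_def by (intro ev_mk_mero_eventually pre_mero_intros)

lemma ev_add: "eventually (\<lambda>z. ev (f + g) z = ev f z + ev g z) (cosparse UNIV)"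
  unfolding plus_mero_def by (intro ev_mk_mero_eventually pre_mero_intros)

lemma ev_uminus: "eventually (\<lambda>z. ev (- f) z = - ev f z) (cosparse UNIV)"
  unfolding uminus_mero_def by (intro ev_mk_mero_eventually pre_mero_intros)

lemma ev_mult: "eventually (\<lambda>z. ev (f * g) z = ev f z * ev g z) (cosparse UNIV)"
  unfolding times_mero_def by (intro ev_mk_mero_eventually pre_mero_intros)

lemma ev_inverse_ev: "eventually (\<lambda>z. ev (inverse f) z = inverse (ev f z)) (cosparse UNIV)"
  unfolding inverse_mero_def by (intro ev_mk_mero_eventually pre_mero_intros)

lemma ev_nonzero:
  assumes "f \<noteq> 0"
  shows "eventually (\<lambda>z. ev f z \<noteq> 0) (cosparse UNIV)"
proof -
  have "eventually (\<lambda>z. ev f z = 0) (cosparse UNIV) \<or> eventually (\<lambda>z. ev f z \<noteq> 0) (cosparse UNIV)"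
    by (rule meromorphic_imp_constant_or_avoid)
      (use pre_mero_ev[of f] in \<open>auto simp: pre_mero_def\<close>)
  moreover have "f = 0" if "eventually (\<lambda>z. ev f z = 0) (cosparse UNIV)"
    by (rule mero_eqI) (use that ev_0 in eventually_elim, simp)
  ultimately show ?thesis using assms by blast
qed

instance
proof
  fix f g h :: mero
  show "f + g + h = f + (g + h)"
    by (rule mero_eqI)
      (use ev_add[of f g] ev_add[of "f + g" h] ev_add[of g h] ev_add[of f "g + h"] in
        eventually_elim, simp)
  show "f + g = g + f"
    by (rule mero_eqI) (use ev_add[of f g] ev_add[of g f] in eventually_elim, simp)
  show "0 + f = f"
    by (rule mero_eqI) (use ev_add[of 0 f] ev_0 in eventually_elim, simp)
  show "- f + f = 0"
    by (rule mero_eqI) (use ev_add[of "- f" f] ev_uminus[of f] ev_0 in eventually_elim, simp)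
  show "f - g = f + - g" by (rule minus_mero_def)
  show "f * g * h = f * (g * h)"
    by (rule mero_eqI)
      (use ev_mult[of f g] ev_mult[of "f * g" h] ev_mult[of g h] ev_mult[of f "g * h"] in
        eventually_elim, simp)
  show "f * g = g * f"
    by (rule mero_eqI) (use ev_mult[of f g] ev_mult[of g f] in eventually_elim, simp)
  show "1 * f = f"
    by (rule mero_eqI) (use ev_mult[of 1 f] ev_1 in eventually_elim, simp)
  show "(f + g) * h = f * h + g * h"
    by (rule mero_eqI)
      (use ev_add[of f g] ev_mult[of "f + g" h] ev_mult[of f h] ev_mult[of g h]
          ev_add[of "f * h" "g * h"] in eventually_elim, simp add: algebra_simps)
  show "(0::mero) \<noteq> 1"
  proof
    assume eq: "(0::mero) = 1"
    have "eventually (\<lambda>z::complex. False) (cosparse UNIV)"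
      using ev_0[unfolded eq] ev_1 by eventually_elim simp
    then show False by simp
  qed
  show "inverse f * f = 1" if "f \<noteq> 0"
    by (rule mero_eqI)
      (use ev_mult[of "inverse f" f] ev_inverse_ev[of f] ev_1 ev_nonzero[OF that] in
        eventually_elim, simp)
  show "f div g = f * inverse g" by (rule divide_mero_def)
  show "inverse (0::mero) = 0"
    by (rule mero_eqI) (use ev_inverse_ev[of 0] ev_0 in eventually_elim, simp)
qed

end

definition mero_const :: "complex \<Rightarrow> mero" where
  "mero_const c = mk_mero (\<lambda>_. c)"

definition mero_scale :: "complex \<Rightarrow> mero \<Rightarrow> mero" where
  "mero_scale c f = mero_const c * f"

text \<open>The derivative with respect to the standard affine coordinate \<open>z\<close>.\<close>

definition mero_deriv :: "mero \<Rightarrow> mero" where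
  "mero_deriv f = mk_mero (deriv (ev f))"

section \<open>Meromorphic forms and vector fields\<close>

text \<open>
  A meromorphic form \<open>f dz\<close> and a meromorphic vector field \<open>g d/dz\<close> on the line are represented by
  their coefficients \<open>f\<close> and \<open>g\<close>, which are arbitrary meromorphic functions. With \<open>w = 1/z\<close> one has
  \<open>dz = - w\<^sup>-\<^sup>2 dw\<close> and \<open>d/dz = - w\<^sup>2 d/dw\<close>. The functions below give the local expressions
  around a point, with respect to the local parameter \<open>z - a\<close> at \<open>a\<close> and \<open>w = 1/z\<close> at \<open>\<infinity>\<close>,
  as functions near 0.
\<close>

type_synonym oneform = mero
type_synonym vfield = mero

fun local_fun :: "mero \<Rightarrow> cpline \<Rightarrow> complex \<Rightarrow> complex" where
  "local_fun f (Pt a) = (\<lambda>w. ev f (a + w))"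
| "local_fun f Infty = (\<lambda>w. ev f (inverse w))"

fun local_form :: "oneform \<Rightarrow> cpline \<Rightarrow> complex \<Rightarrow> complex" where
  "local_form \<alpha> (Pt a) = (\<lambda>w. ev \<alpha> (a + w))"
| "local_form \<alpha> Infty = (\<lambda>w. - ev \<alpha> (inverse w) / w\<^sup>2)"

fun local_vfield :: "vfield \<Rightarrow> cpline \<Rightarrow> complex \<Rightarrow> complex" where
  "local_vfield X (Pt a) = (\<lambda>w. ev X (a + w))"
| "local_vfield X Infty = (\<lambda>w. - w\<^sup>2 * ev X (inverse w))"

definition has_pole_at :: "mero \<Rightarrow> cpline \<Rightarrow> bool" where
  "has_pole_at f p \<longleftrightarrow> is_pole (local_fun f p) 0"

definition vanishes_at :: "mero \<Rightarrow> cpline \<Rightarrow> bool" where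
  "vanishes_at f p \<longleftrightarrow> (local_fun f p \<longlongrightarrow> 0) (at 0)"

definition coordinate :: "mero \<Rightarrow> bool" where
  "coordinate u \<longleftrightarrow> (\<exists>!p. has_pole_at u p) \<and>
     (\<forall>p. has_pole_at u p \<longrightarrow> zorder (local_fun u p) 0 = -1)"

definition form_regular_at :: "oneform \<Rightarrow> cpline \<Rightarrow> bool" where
  "form_regular_at \<alpha> p \<longleftrightarrow> \<not> is_pole (local_form \<alpha> p) 0"

definition vfield_regular_at :: "vfield \<Rightarrow> cpline \<Rightarrow> bool" where
  "vfield_regular_at X p \<longleftrightarrow> \<not> is_pole (local_vfield X p) 0"

definition vfield_regular_away :: "cpline \<Rightarrow> vfield \<Rightarrow> bool" where
  "vfield_regular_away p X \<longleftrightarrow> (\<forall>q. q \<noteq> p \<longrightarrow> vfield_regular_at X q)"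

definition form_residue :: "cpline \<Rightarrow> oneform \<Rightarrow> complex" where
  "form_residue p \<alpha> = residue (local_form \<alpha> p) 0"

definition second_kind :: "oneform set" where
  "second_kind = {\<alpha>. \<forall>p. form_residue p \<alpha> = 0}"

definition K_space :: "cpline \<Rightarrow> oneform set" where
  "K_space p = {\<alpha>. \<forall>q. q \<noteq> p \<longrightarrow> form_regular_at \<alpha> q}"

definition contract :: "vfield \<Rightarrow> oneform \<Rightarrow> mero" where
  "contract X \<alpha> = X * \<alpha>"

text \<open>Every 1-form on a curve is closed, so \<open>d (i\<^sub>X \<alpha>)\<close> is the only term in Cartan's formula.\<close>

definition lie_deriv :: "vfield \<Rightarrow> oneform \<Rightarrow> oneform" where
  "lie_deriv X \<alpha> = mero_deriv (contract X \<alpha>)"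

definition linear_between ::
    "(complex \<Rightarrow> 'a \<Rightarrow> 'a) \<Rightarrow> (complex \<Rightarrow> 'b \<Rightarrow> 'b) \<Rightarrow> 'a::ab_group_add set \<Rightarrow> ('a \<Rightarrow> 'b::ab_group_add) \<Rightarrow> bool"
  where
  "linear_between s1 s2 V T \<longleftrightarrow>
     (\<forall>x\<in>V. \<forall>y\<in>V. T (x + y) = T x + T y) \<and> (\<forall>c. \<forall>x\<in>V. T (s1 c x) = s2 c (T x))"

text \<open>The value 0 outside the domain only serves to make the total function unique.\<close>

definition second_kind_proj :: "cpline \<Rightarrow> oneform \<Rightarrow> oneform" where
  "second_kind_proj p = (THE P.
     linear_between mero_scale mero_scale second_kind P \<and>
     (\<forall>\<eta>\<in>second_kind. \<eta> \<in> K_space p \<longrightarrow> P \<eta> = \<eta>) \<and>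
     (\<forall>\<eta>\<in>second_kind. form_regular_at \<eta> p \<longrightarrow> P \<eta> = 0) \<and>
     (\<forall>\<eta>. \<eta> \<notin> second_kind \<longrightarrow> P \<eta> = 0))"

section \<open>The symmetric algebra\<close>

text \<open>
  The type \<open>sym\<close> is the symmetric algebra of the complex vector space of all meromorphic 1-forms: the
  polynomial algebra on the underlying set of forms modulo the ideal that makes the inclusion of
  the generators linear. The product \<open>*\<close> of \<open>sym\<close> is the symmetric tensor product.
\<close>

type_synonym free_sym = "oneform multiset \<Rightarrow>\<^sub>0 complex"

definition free_gen :: "oneform \<Rightarrow> free_sym" where
  "free_gen \<alpha> = Poly_Mapping.single {#\<alpha>#} 1"

definition sym_relations :: "free_sym set" where
  "sym_relations =
     {free_gen (\<alpha> + \<beta>) - free_gen \<alpha> - free_gen \<beta> | \<alpha> \<beta>. True} \<union>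
     {free_gen (mero_scale c \<alpha>) - Poly_Mapping.single 0 c * free_gen \<alpha> | c \<alpha>. True}"

lemma module_times: "module ((*) :: 'a::comm_ring_1 \<Rightarrow> 'a \<Rightarrow> 'a)"
  by unfold_locales (simp_all add: algebra_simps)

definition sym_ideal :: "free_sym set" where
  "sym_ideal = module.span (*) sym_relations"

lemma sym_ideal_0: "0 \<in> sym_ideal"
  unfolding sym_ideal_def by (rule module.span_zero[OF module_times])

lemma sym_ideal_add: "a \<in> sym_ideal \<Longrightarrow> b \<in> sym_ideal \<Longrightarrow> a + b \<in> sym_ideal"
  unfolding sym_ideal_def by (rule module.span_add[OF module_times])

lemma sym_ideal_uminus: "a \<in> sym_ideal \<Longrightarrow> - a \<in> sym_ideal"
  unfolding sym_ideal_def by (rule module.span_neg[OF module_times])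

lemma sym_ideal_mult: "a \<in> sym_ideal \<Longrightarrow> c * a \<in> sym_ideal"
  unfolding sym_ideal_def by (rule module.span_scale[OF module_times])

lemma lookup_times_empty:
  fixes a b :: free_sym
  assumes "Poly_Mapping.lookup a {#} = 0"
  shows "Poly_Mapping.lookup (b * a) {#} = 0"
proof -
  have "(Poly_Mapping.lookup a q when ({#} = k + q)) = 0" for k q
    using assms by (cases "q = {#}") (auto simp: when_def)
  then show ?thesis by (simp add: lookup_mult del: zero_eq_add_iff_both_eq_0 empty_eq_union)
qed

lemma sym_ideal_lookup_empty: "a \<in> sym_ideal \<Longrightarrow> Poly_Mapping.lookup a {#} = 0"
  unfolding sym_ideal_def
proof (induction rule: module.span_induct_alt[OF module_times, consumes 1])
  case 1
  then show ?case by simp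
next
  case (2 c x y)
  then have "Poly_Mapping.lookup x {#} = 0"
    by (auto simp: sym_relations_def free_gen_def lookup_minus lookup_single mult_single)
  then show ?case using 2 by (simp add: lookup_add lookup_times_empty)
qed

definition sym_rel :: "free_sym \<Rightarrow> free_sym \<Rightarrow> bool" where
  "sym_rel a b \<longleftrightarrow> a - b \<in> sym_ideal"

lemma equivp_sym_rel: "equivp sym_rel"
proof (rule equivpI)
  show "reflp sym_rel" by (auto intro: reflpI simp: sym_rel_def sym_ideal_0)
  show "symp sym_rel"
    by (rule sympI) (use sym_ideal_uminus in \<open>fastforce simp: sym_rel_def\<close>)
  show "transp sym_rel"
    by (rule transpI) (use sym_ideal_add in \<open>fastforce simp: sym_rel_def\<close>)
qed

quotient_type sym = free_sym / sym_rel
  by (rule equivp_sym_rel)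

instantiation sym :: comm_ring_1
begin

lift_definition zero_sym :: sym is 0 .
lift_definition one_sym :: sym is 1 .

lift_definition plus_sym :: "sym \<Rightarrow> sym \<Rightarrow> sym" is "(+)"
  unfolding sym_rel_def by (metis add_diff_add sym_ideal_add)

lift_definition uminus_sym :: "sym \<Rightarrow> sym" is uminus
  unfolding sym_rel_def using sym_ideal_uminus by fastforce

lift_definition minus_sym :: "sym \<Rightarrow> sym \<Rightarrow> sym" is "(-)"
proof -
  fix a b c d assume "sym_rel a b" "sym_rel c d"
  then have "(a - b) + - (c - d) \<in> sym_ideal"
    unfolding sym_rel_def by (intro sym_ideal_add sym_ideal_uminus)
  then show "sym_rel (a - c) (b - d)" by (simp add: sym_rel_def algebra_simps)
qed

lift_definition times_sym :: "sym \<Rightarrow> sym \<Rightarrow> sym" is "(*)"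
proof -
  fix a b c d assume "sym_rel a b" "sym_rel c d"
  then have "c * (a - b) + b * (c - d) \<in> sym_ideal"
    unfolding sym_rel_def by (intro sym_ideal_add sym_ideal_mult)
  then show "sym_rel (a * c) (b * d)" by (simp add: sym_rel_def algebra_simps)
qed

instance
proof
  fix a b c :: sym
  show "a + b + c = a + (b + c)"
    by transfer (simp add: sym_rel_def sym_ideal_0 algebra_simps)
  show "a + b = b + a"
    by transfer (simp add: sym_rel_def sym_ideal_0 algebra_simps)
  show "0 + a = a"
    by transfer (simp add: sym_rel_def sym_ideal_0)
  show "- a + a = 0"
    by transfer (simp add: sym_rel_def sym_ideal_0)
  show "a - b = a + - b"
    by transfer (simp add: sym_rel_def sym_ideal_0)
  show "a * b * c = a * (b * c)"
    by transfer (simp add: sym_rel_def sym_ideal_0 algebra_simps)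
  show "a * b = b * a"
    by transfer (simp add: sym_rel_def sym_ideal_0 algebra_simps)
  show "1 * a = a"
    by transfer (simp add: sym_rel_def sym_ideal_0)
  show "(a + b) * c = a * c + b * c"
    by transfer (simp add: sym_rel_def sym_ideal_0 algebra_simps)
  show "(0::sym) \<noteq> 1"
    by transfer (use sym_ideal_lookup_empty[of "- 1"] in \<open>auto simp: sym_rel_def lookup_one\<close>)
qed

end

lift_definition sym_of :: "oneform \<Rightarrow> sym" is free_gen .

lift_definition sym_const :: "complex \<Rightarrow> sym" is "Poly_Mapping.single 0" .

definition sym_scale :: "complex \<Rightarrow> sym \<Rightarrow> sym" where
  "sym_scale c w = sym_const c * w"

definition sym_prod :: "oneform list \<Rightarrow> sym" where
  "sym_prod \<alpha>s = prod_list (map sym_of \<alpha>s)"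

lemma sym_of_add: "sym_of (\<alpha> + \<beta>) = sym_of \<alpha> + sym_of \<beta>"
  by transfer
    (auto simp: sym_rel_def sym_ideal_def sym_relations_def diff_diff_eq
      intro!: module.span_base[OF module_times])

lemma sym_of_scale: "sym_of (mero_scale c \<alpha>) = sym_scale c (sym_of \<alpha>)"
  unfolding sym_scale_def
  by transfer
    (auto simp: sym_rel_def sym_ideal_def sym_relations_def
      intro!: module.span_base[OF module_times])

lemma vector_space_sym_scale: "vector_space sym_scale"
proof
  fix a b :: complex and x y :: sym
  have add: "sym_const (a + b) = sym_const a + sym_const b"
    by transfer (simp add: sym_rel_def sym_ideal_0 single_add)
  have mult: "sym_const (a * b) = sym_const a * sym_const b"
    by transfer (simp add: sym_rel_def sym_ideal_0 mult_single)
  have one: "sym_const 1 = 1"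
    by transfer (simp add: sym_rel_def sym_ideal_0)
  show "sym_scale a (x + y) = sym_scale a x + sym_scale a y"
    by (simp add: sym_scale_def algebra_simps)
  show "sym_scale (a + b) x = sym_scale a x + sym_scale b x"
    by (simp add: sym_scale_def add algebra_simps)
  show "sym_scale a (sym_scale b x) = sym_scale (a * b) x"
    by (simp add: sym_scale_def mult algebra_simps)
  show "sym_scale 1 x = x"
    by (simp add: sym_scale_def one)
qed

global_interpretation sym: vector_space sym_scale
  by (rule vector_space_sym_scale)

text \<open>
  The symmetric algebra of the subspace \<open>K_space p\<close>, as the subalgebra of \<open>sym\<close> that it generates;
  over a field the symmetric algebra of a subspace embeds into that of the whole space.
  The empty product is the vacuum \<open>1\<close>.
\<close>

definition W_space :: "cpline \<Rightarrow> sym set" where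
  "W_space p = sym.span {sym_prod \<alpha>s | \<alpha>s. set \<alpha>s \<subseteq> K_space p}"

section \<open>The operators\<close>

definition lin_ext :: "cpline \<Rightarrow> (oneform list \<Rightarrow> sym) \<Rightarrow> sym \<Rightarrow> sym" where
  "lin_ext p F = (THE T.
     linear_between sym_scale sym_scale (W_space p) T \<and>
     (\<forall>\<alpha>s. set \<alpha>s \<subseteq> K_space p \<longrightarrow> T (sym_prod \<alpha>s) = F \<alpha>s) \<and>
     (\<forall>w. w \<notin> W_space p \<longrightarrow> T w = 0))"

text \<open>
  The contraction enters with a plus sign. With \<open>\<omega>\<^sub>X\<close> normalised as in \<open>omega_coeff\<close>, the Virasoro
  relations fail for the opposite sign: already \<open>L\<^sub>2 (L\<^sub>-\<^sub>2 1)\<close> would be \<open>- 1/2\<close> instead of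
  \<open>(2\<^sup>3 - 2) / 12 = 1/2\<close>.
\<close>

definition X_minus :: "cpline \<Rightarrow> vfield \<Rightarrow> sym \<Rightarrow> sym" where
  "X_minus p X = lin_ext p (\<lambda>\<alpha>s.
     \<Sum>(i, j) \<in> {(i, j). i < j \<and> j < length \<alpha>s}.
       sym_scale (form_residue p (contract X (\<alpha>s ! i) * \<alpha>s ! j)) (sym_prod (nths \<alpha>s (- {i, j}))))"

definition X_zero :: "cpline \<Rightarrow> vfield \<Rightarrow> sym \<Rightarrow> sym" where
  "X_zero p X = lin_ext p (\<lambda>\<alpha>s.
     \<Sum>i<length \<alpha>s. sym_prod (\<alpha>s[i := second_kind_proj p (lie_deriv X (\<alpha>s ! i))]))"

text \<open>
  \<open>omega_coeff u X\<close> is the coefficient with respect to \<open>dz\<^sub>1 dz\<^sub>2\<close> of the bidifferential \<open>\<omega>\<^sub>X\<close> written in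
  the coordinate \<open>u\<close>: if \<open>X = \<xi>(u) d/du\<close>, then \<open>\<xi>(u) = X u\<close> is the function \<open>\<xi>\<close> below, and
  \<open>\<xi>'(u)\<close> is \<open>d\<xi> / du\<close>.
\<close>

definition omega_coeff :: "mero \<Rightarrow> vfield \<Rightarrow> complex \<Rightarrow> complex \<Rightarrow> complex" where
  "omega_coeff u X z1 z2 =
    (let \<xi> = X * mero_deriv u;
         \<xi>' = mero_deriv \<xi> / mero_deriv u;
         u1 = ev u z1; u2 = ev u z2
     in (2 * (ev \<xi> z1 - ev \<xi> z2) - (ev \<xi>' z1 + ev \<xi>' z2) * (u1 - u2)) / (2 * (u1 - u2))
        * (ev (mero_deriv u) z1 * ev (mero_deriv u) z2 / (u1 - u2)\<^sup>2))"

text \<open>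
  The symmetric bidifferential, as coefficient of \<open>dz\<^sub>1 dz\<^sub>2\<close>, attached to a sum of products
  \<open>\<alpha> \<otimes>\<^sup>s \<beta>\<close>, which are symmetrised by averaging.
\<close>

definition bidiff :: "(oneform \<times> oneform) list \<Rightarrow> complex \<Rightarrow> complex \<Rightarrow> complex" where
  "bidiff ps z1 z2 = (\<Sum>(\<alpha>, \<beta>)\<leftarrow>ps. (ev \<alpha> z1 * ev \<beta> z2 + ev \<beta> z1 * ev \<alpha> z2) / 2)"

text \<open>
  For \<open>X\<close> regular away from \<open>p\<close>, the form \<open>\<omega>\<^sub>X\<close> is the element of \<open>S\<^sup>2 (K_space p)\<close> whose
  bidifferential is given by the formula above, in every coordinate \<open>u\<close> (the formula does not depend
  on the choice of \<open>u\<close>). The comparison takes place off the diagonal at finite points other than \<open>p\<close> and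
  the pole of \<open>u\<close>, where \<open>ev\<close> yields true values.
\<close>

definition omega_form :: "cpline \<Rightarrow> vfield \<Rightarrow> sym" where
  "omega_form p X = (THE s. \<exists>ps. set ps \<subseteq> K_space p \<times> K_space p \<and>
     s = (\<Sum>(\<alpha>, \<beta>)\<leftarrow>ps. sym_of \<alpha> * sym_of \<beta>) \<and>
     (\<forall>u. coordinate u \<longrightarrow>
       (\<forall>z1 z2. z1 \<noteq> z2 \<longrightarrow> Pt z1 \<noteq> p \<longrightarrow> Pt z2 \<noteq> p \<longrightarrow>
          \<not> has_pole_at u (Pt z1) \<longrightarrow> \<not> has_pole_at u (Pt z2) \<longrightarrow>
          bidiff ps z1 z2 = omega_coeff u X z1 z2)))"

definition X_plus_vac :: "cpline \<Rightarrow> vfield \<Rightarrow> sym" where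
  "X_plus_vac p = (THE T. linear_between mero_scale sym_scale UNIV T \<and>
     (\<forall>X. vfield_regular_at X p \<longrightarrow> T X = 0) \<and>
     (\<forall>X. vfield_regular_away p X \<longrightarrow> T X = omega_form p X))"

definition X_plus :: "cpline \<Rightarrow> vfield \<Rightarrow> sym \<Rightarrow> sym" where
  "X_plus p X = lin_ext p (\<lambda>\<alpha>s. X_plus_vac p X * sym_prod \<alpha>s)"

definition L_op :: "cpline \<Rightarrow> vfield \<Rightarrow> sym \<Rightarrow> sym" where
  "L_op p X w = X_minus p X w + X_zero p X w + X_plus p X w"

text \<open>The vector field \<open>d/du\<close> has the coefficient \<open>1 / u'\<close> with respect to \<open>d/dz\<close>.\<close>

definition X_field :: "mero \<Rightarrow> int \<Rightarrow> vfield" where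
  "X_field u n = - (u powi (n + 1)) / mero_deriv u"

end

theory Submission
  imports Defs
begin

text \<open>
  Put \<open>t = 1/u\<close>. This is a coordinate whose only pole is the base point \<open>p\<close>, and by Liouville's theorem
  and subtraction of principal parts everything that is regular away from \<open>p\<close> is polynomial in \<open>t\<close>:
  \<open>K_space p\<close> has the basis \<open>e k = - t\<^sup>k\<^sup>-\<^sup>1 dt\<close> (\<open>k \<ge> 1\<close>), with dual functionals \<open>coef k \<alpha> = Res\<^sub>p (u\<^sup>k \<alpha>)\<close>,
  and the vector fields regular away from \<open>p\<close> are spanned by the \<open>t\<^sup>k d/dt\<close> (\<open>k \<ge> 0\<close>). In these terms
  \<open>X\<^sub>n = t\<^sup>1\<^sup>-\<^sup>n d/dt\<close> for all integers \<open>n\<close>.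

  The objects given by definite description (the projection of forms of the second kind, the linear
  extensions from products, the element \<open>\<omega>\<^sub>X\<close> and its extension to all vector fields) are identified
  by exhibiting a candidate and showing uniqueness. The symmetric algebra is a quotient of a polynomial
  algebra, and a derivation of it exists for each linear map on the generators
  (\<open>ex_derivation\<close>). Let \<open>E k\<close> be the generator given by \<open>e k\<close>, let \<open>pd k\<close> be the derivation extending
  \<open>coef k\<close> and let \<open>D0 n\<close> be the derivation extending the projected Lie derivative along \<open>X\<^sub>n\<close>. Then
  \<open>L\<^sub>n\<close> is the operator \<open>T n\<close> given by
  \<open>- 1/2 \<Sum>\<^sub>a\<^sub>+\<^sub>b\<^sub>=\<^sub>n pd a pd b + D0 n - 1/2 \<Sum>\<^sub>i\<^sub>+\<^sub>j\<^sub>=\<^sub>-\<^sub>n i j E i E j\<close>, all indices being positive (\<open>L_op_eq\<close>).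
  The last term is \<open>\<omega>\<^sub>X\<close> for \<open>X = X\<^sub>n\<close>: the defining formula does not depend on the coordinate
  (\<open>omega_coeff_eq_std\<close>), so it may be evaluated in \<open>t\<close>, where it is an identity between polynomials
  (\<open>doubly_weighted_power_sum\<close>), and a symmetric tensor is determined by its bidifferential off the
  diagonal (\<open>sym_list_unique\<close>).

  The relations follow from the Heisenberg operators \<open>A k\<close>, which are the multiplication by \<open>k E k\<close> for
  \<open>k > 0\<close> and \<open>- pd (- k)\<close> for \<open>k < 0\<close>. They satisfy \<open>[T n, E k] = A (k - n)\<close> (\<open>k \<ge> 1\<close>) and
  \<open>[T n, A k] = k A (k - n)\<close>. By the Jacobi identity the difference of the two sides of the Virasoro relation
  commutes with multiplication by every \<open>E k\<close>, so it is determined by its value on the vacuum. There the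
  relation is a direct computation, in which the constant \<open>1/2 \<Sum>\<^sub>i\<^sub>+\<^sub>j\<^sub>=\<^sub>l i j = (l\<^sup>3 - l) / 12\<close> produces the
  central term.
\<close>

section \<open>Local expressions of meromorphic functions\<close>

text \<open>The affine coordinate of the point near \<open>r\<close> whose local parameter at \<open>r\<close> is \<open>w\<close>.\<close>

fun chart :: "cpline \<Rightarrow> complex \<Rightarrow> complex" where
  "chart (Pt a) w = a + w"
| "chart Infty w = inverse w"

lemma local_fun_chart: "local_fun f r = (\<lambda>w. ev f (chart r w))"
  by (cases r) auto

lemma eventually_at_infinity_chart:
  assumes "eventually P at_infinity"
  shows "eventually (\<lambda>w. P (chart Infty w)) (at 0)"
  using assms filterlim_inverse_at_infinity[where ?'a = complex]
  unfolding filterlim_iff by simp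

lemma eventually_at_shift: "eventually P (at (a::complex)) \<Longrightarrow> eventually (\<lambda>w. P (a + w)) (at 0)"
  by (subst (asm) at_to_0) (simp add: eventually_filtermap add.commute)

lemma eventually_ev_mk_mero_chart:
  assumes "pre_mero f"
  shows "eventually (\<lambda>w. ev (mk_mero f) (chart r w) = f (chart r w)) (at 0)"
proof (cases r)
  case (Pt a)
  have "eventually (\<lambda>z. ev (mk_mero f) z = f z) (at a)"
    using ev_mk_mero_eventually[OF assms] by (auto intro: eventually_cosparse_imp_eventually_at)
  then show ?thesis
    using Pt eventually_at_shift by fastforce
next
  case Infty
  have "eventually (\<lambda>z. ev (mk_mero f) z = f z) at_infinity"
    using eventually_at_infinity_analytic[OF assms]
    by eventually_elim (auto simp: ev_mk_mero assms)
  then show ?thesis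
    using Infty eventually_at_infinity_chart by fastforce
qed

lemma local_add: "eventually (\<lambda>w. local_fun (f + g) r w = local_fun f r w + local_fun g r w) (at 0)"
  unfolding local_fun_chart plus_mero_def
  by (intro eventually_ev_mk_mero_chart pre_mero_intros)

lemma local_mult: "eventually (\<lambda>w. local_fun (f * g) r w = local_fun f r w * local_fun g r w) (at 0)"
  unfolding local_fun_chart times_mero_def
  by (intro eventually_ev_mk_mero_chart pre_mero_intros)

lemma local_uminus: "eventually (\<lambda>w. local_fun (- f) r w = - local_fun f r w) (at 0)"
  unfolding local_fun_chart uminus_mero_def
  by (intro eventually_ev_mk_mero_chart pre_mero_intros)

lemma local_inverse: "eventually (\<lambda>w. local_fun (inverse f) r w = inverse (local_fun f r w)) (at 0)"
  unfolding local_fun_chart inverse_mero_def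
  by (intro eventually_ev_mk_mero_chart pre_mero_intros)

lemma local_const: "eventually (\<lambda>w. local_fun (mero_const c) r w = c) (at 0)"
  unfolding local_fun_chart mero_const_def
  by (intro eventually_ev_mk_mero_chart pre_mero_intros)

lemma local_diff: "eventually (\<lambda>w. local_fun (f - g) r w = local_fun f r w - local_fun g r w) (at 0)"
  using local_add[of f "- g" r] local_uminus[of g r] by eventually_elim simp

lemma local_one: "eventually (\<lambda>w. local_fun 1 r w = 1) (at 0)"
  unfolding local_fun_chart one_mero_def
  by (intro eventually_ev_mk_mero_chart pre_mero_intros)

lemma local_fun_meromorphic: "local_fun f r meromorphic_on {0}"
proof (cases r)
  case (Pt a)
  have "ev f meromorphic_on {a}"
    using pre_mero_ev[of f] by (auto simp: pre_mero_def intro: meromorphic_on_subset)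
  then show ?thesis using Pt by (simp add: meromorphic_on_def)
next
  case Infty
  then show ?thesis using pre_mero_ev[of f] by (auto simp: pre_mero_def)
qed

lemma local_fun_deriv:
  "eventually (\<lambda>w. local_fun f r analytic_on {w} \<and>
     deriv (local_fun f r) w = local_form (mero_deriv f) r w) (at 0)"
proof (cases r)
  case (Pt a)
  have "eventually (\<lambda>z. ev f analytic_on {z}) (cosparse UNIV)"
    using pre_mero_ev[of f] by (auto simp: pre_mero_def intro: meromorphic_on_imp_analytic_cosparse)
  then have "eventually (\<lambda>z. ev f analytic_on {z}) (at a)"
    by (auto intro: eventually_cosparse_imp_eventually_at)
  then have "eventually (\<lambda>w. ev f analytic_on {a + w}) (at 0)"
    by (rule eventually_at_shift)
  moreover have "eventually (\<lambda>w. ev (mero_deriv f) (chart r w) = deriv (ev f) (chart r w)) (at 0)"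
    unfolding mero_deriv_def by (intro eventually_ev_mk_mero_chart pre_mero_intros)
  ultimately show ?thesis
  proof eventually_elim
    case (elim w)
    have "(\<lambda>w. a + w) analytic_on {w}" by (intro analytic_intros)
    then have "(ev f \<circ> (\<lambda>w. a + w)) analytic_on {w}"
      using elim by (intro analytic_on_compose) auto
    moreover have "deriv (\<lambda>w. ev f (a + w)) w = deriv (ev f) (a + w)"
    proof -
      have f': "(ev f has_field_derivative deriv (ev f) (a + w)) (at (a + w))"
        using elim analytic_on_imp_differentiable_at DERIV_deriv_iff_field_differentiable by blast
      have "((\<lambda>w. a + w) has_field_derivative 1) (at w)"
        by (auto intro!: derivative_eq_intros)
      from DERIV_chain2[OF f' this] show ?thesis by (simp add: DERIV_imp_deriv)
    qed
    ultimately show ?case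
      using elim Pt by (simp add: o_def)
  qed
next
  case Infty
  have "eventually (\<lambda>w. ev f analytic_on {inverse w}) (at 0)"
    using eventually_at_infinity_chart[OF eventually_at_infinity_analytic[OF pre_mero_ev[of f]]]
    by simp
  moreover have "eventually (\<lambda>w. ev (mero_deriv f) (chart r w) = deriv (ev f) (chart r w)) (at 0)"
    unfolding mero_deriv_def by (intro eventually_ev_mk_mero_chart pre_mero_intros)
  moreover have "eventually (\<lambda>w::complex. w \<noteq> 0) (at 0)"
    by (simp add: eventually_at_filter)
  ultimately show ?thesis
  proof eventually_elim
    case (elim w)
    have "inverse analytic_on {w}" using elim by (intro analytic_intros) auto
    then have "(ev f \<circ> inverse) analytic_on {w}"
      using elim by (intro analytic_on_compose) auto
    moreover have "deriv (\<lambda>w. ev f (inverse w)) w = deriv (ev f) (inverse w) * - (inverse w * inverse w)"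
    proof -
      have f': "(ev f has_field_derivative deriv (ev f) (inverse w)) (at (inverse w))"
        using elim analytic_on_imp_differentiable_at DERIV_deriv_iff_field_differentiable by blast
      have "(inverse has_field_derivative - (inverse w * inverse w)) (at w)"
        using elim by (auto intro!: derivative_eq_intros simp: power2_eq_square)
      from DERIV_chain2[OF f' this] show ?thesis by (rule DERIV_imp_deriv)
    qed
    ultimately show ?case
      using elim Infty by (simp add: o_def field_simps power2_eq_square)
  qed
qed

section \<open>Values and regularity at a point\<close>

text \<open>\<open>f\<close> is regular at \<open>r\<close> with value \<open>c\<close> there; unlike \<open>ev\<close>, this also makes sense at \<open>\<infinity>\<close>.\<close>

definition has_val :: "mero \<Rightarrow> cpline \<Rightarrow> complex \<Rightarrow> bool" where
  "has_val f r c \<longleftrightarrow> (local_fun f r \<longlongrightarrow> c) (at 0)"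

text \<open>Regularity at a point; it is the absence of a pole (\<open>has_pole_at_iff\<close>).\<close>

abbreviation reg :: "mero \<Rightarrow> cpline \<Rightarrow> bool" where
  "reg f r \<equiv> \<exists>c. has_val f r c"

lemma has_val_unique: "has_val f r c \<Longrightarrow> has_val f r d \<Longrightarrow> c = d"
  unfolding has_val_def by (rule tendsto_unique[OF at_neq_bot])

lemma has_pole_at_iff: "has_pole_at f r \<longleftrightarrow> \<not> reg f r"
  using local_fun_meromorphic[of f r]
  by (auto simp: has_pole_at_def has_val_def meromorphic_at_iff not_essential_def is_pole_def
      dest: not_tendsto_and_filterlim_at_infinity[rotated])

lemma vanishes_at_iff: "vanishes_at f r \<longleftrightarrow> has_val f r 0"
  by (simp add: vanishes_at_def has_val_def)

lemma has_val_const: "has_val (mero_const c) r c"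
  unfolding has_val_def using local_const[of c r] by (rule tendsto_eventually)

lemma has_val_0: "has_val 0 r 0"
  using has_val_const[of 0] by (simp add: mero_const_def zero_mero_def)

lemma has_val_1: "has_val 1 r 1"
  using has_val_const[of 1] by (simp add: mero_const_def one_mero_def)

lemma has_val_add: "has_val f r c \<Longrightarrow> has_val g r d \<Longrightarrow> has_val (f + g) r (c + d)"
  unfolding has_val_def using tendsto_cong[OF local_add[of f g r]] by (auto intro: tendsto_intros)

lemma has_val_mult: "has_val f r c \<Longrightarrow> has_val g r d \<Longrightarrow> has_val (f * g) r (c * d)"
  unfolding has_val_def using tendsto_cong[OF local_mult[of f g r]] by (auto intro: tendsto_intros)

lemma has_val_uminus: "has_val f r c \<Longrightarrow> has_val (- f) r (- c)"
  unfolding has_val_def using tendsto_cong[OF local_uminus[of f r]] by (auto intro: tendsto_intros)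

lemma has_val_diff: "has_val f r c \<Longrightarrow> has_val g r d \<Longrightarrow> has_val (f - g) r (c - d)"
  unfolding has_val_def using tendsto_cong[OF local_diff[of f g r]] by (auto intro: tendsto_intros)

lemma has_val_inverse: "has_val f r c \<Longrightarrow> c \<noteq> 0 \<Longrightarrow> has_val (inverse f) r (inverse c)"
  unfolding has_val_def using tendsto_cong[OF local_inverse[of f r]] by (auto intro: tendsto_intros)

lemma has_val_divide:
  "has_val f r c \<Longrightarrow> has_val g r d \<Longrightarrow> d \<noteq> 0 \<Longrightarrow> has_val (f / g) r (c / d)"
  unfolding divide_inverse by (intro has_val_mult has_val_inverse)

lemma has_val_power: "has_val f r c \<Longrightarrow> has_val (f ^ n) r (c ^ n)"
  by (induction n) (auto intro: has_val_1 has_val_mult)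

lemma has_val_scale: "has_val f r c \<Longrightarrow> has_val (mero_scale a f) r (a * c)"
  unfolding mero_scale_def by (intro has_val_mult has_val_const)

lemmas has_val_intros =
  has_val_const has_val_0 has_val_1 has_val_add has_val_mult has_val_uminus has_val_diff
  has_val_power has_val_scale

lemma has_val_Pt_iff: "has_val f (Pt z) c \<longleftrightarrow> (ev f \<longlongrightarrow> c) (at z)"
  unfolding has_val_def by (subst (2) at_to_0) (simp add: filterlim_filtermap add.commute)

text \<open>At regular points \<open>ev\<close> yields the true value, because of the normalisation of \<open>mero\<close>.\<close>

lemma ev_eq: "has_val f (Pt z) c \<Longrightarrow> ev f z = c"
  using nicely_ev[of f] unfolding nicely_meromorphic_on_def has_val_Pt_iff is_pole_def
  by (metis UNIV_I at_neq_bot not_tendsto_and_filterlim_at_infinity tendsto_unique)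

lemma reg_Pt_iff_analytic: "reg f (Pt z) \<longleftrightarrow> ev f analytic_on {z}"
proof
  assume "reg f (Pt z)"
  then obtain c where "has_val f (Pt z) c" by blast
  then have "ev f \<midarrow>z\<rightarrow> ev f z" using ev_eq by (metis has_val_Pt_iff)
  then have "\<not> is_pole (ev f) z"
    using not_tendsto_and_filterlim_at_infinity[OF at_neq_bot] by (auto simp: is_pole_def)
  then show "ev f analytic_on {z}"
    using nicely_ev[of f] by (intro nicely_meromorphic_on_imp_analytic_at[of _ UNIV]) auto
next
  assume "ev f analytic_on {z}"
  then have "isCont (ev f) z" by (simp add: analytic_at_imp_isCont)
  then show "reg f (Pt z)" unfolding has_val_Pt_iff isCont_def by blast
qed

text \<open>Liouville's theorem on the projective line.\<close>

lemma reg_everywhere_imp_const: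
  assumes "\<And>r. reg f r"
  obtains c where "f = mero_const c"
proof -
  obtain c where "has_val f Infty c" using assms by blast
  then have "((\<lambda>w. ev f (inverse w)) \<longlongrightarrow> c) (at 0)" by (simp add: has_val_def)
  then have lim: "(ev f \<longlongrightarrow> c) at_infinity"
    by (simp add: lim_at_infinity_0 o_def)
  have "ev f analytic_on {z}" for z using assms reg_Pt_iff_analytic by blast
  then have "ev f holomorphic_on UNIV"
    by (meson analytic_imp_holomorphic analytic_on_analytic_at UNIV_I)
  then have "ev f z = c" for z by (rule Liouville_weak[OF _ lim])
  then have "f = mero_const c"
    using mk_mero_ev[of f] by (metis ext mero_const_def)
  then show ?thesis by (rule that)
qed

section \<open>Scalars and derivation\<close>

lemma mero_const_0 [simp]: "mero_const 0 = 0"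
  by (simp add: mero_const_def zero_mero_def)

lemma mero_const_1 [simp]: "mero_const 1 = 1"
  by (simp add: mero_const_def one_mero_def)

lemma ev_const: "ev (mero_const c) z = c"
  by (rule ev_eq[OF has_val_const])

text \<open>Meromorphic functions that agree at all but at most two finite points are equal.\<close>

lemma mero_eqI_off:
  assumes "\<And>z. Pt z \<noteq> p \<Longrightarrow> z \<noteq> z0 \<Longrightarrow> ev f z = ev g z"
  shows "f = g"
proof (rule mero_eqI)
  have "eventually (\<lambda>z. Pt z \<noteq> p) (cosparse UNIV)"
    unfolding eventually_cosparse_open_eq[OF open_UNIV]
    by (cases p) (simp_all add: eventually_neq_at_within)
  moreover have "eventually (\<lambda>z. z \<noteq> z0) (cosparse UNIV)"
    unfolding eventually_cosparse_open_eq[OF open_UNIV]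
    by (simp add: eventually_neq_at_within)
  ultimately show "\<forall>\<^sub>\<approx>z. ev f z = ev g z"
    by eventually_elim (use assms in auto)
qed

lemma mero_const_add: "mero_const (a + b) = mero_const a + mero_const b"
  by (rule mero_eqI) (use ev_add[of "mero_const a" "mero_const b"] in eventually_elim, simp add: ev_const)

lemma mero_const_mult: "mero_const (a * b) = mero_const a * mero_const b"
  by (rule mero_eqI) (use ev_mult[of "mero_const a" "mero_const b"] in eventually_elim, simp add: ev_const)

lemma mero_const_uminus: "mero_const (- a) = - mero_const a"
  using mero_const_add[of a "- a"] by (simp add: eq_neg_iff_add_eq_0 add.commute)

lemma mero_const_eq_iff [simp]: "mero_const a = mero_const b \<longleftrightarrow> a = b"
  using ev_const by metis

lemma mero_const_eq_0_iff [simp]: "mero_const a = 0 \<longleftrightarrow> a = 0"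
  using mero_const_eq_iff[of a 0] by simp

lemma mero_const_inverse: "mero_const (inverse a) = inverse (mero_const a)"
proof (cases "a = 0")
  case False
  then have "mero_const a * mero_const (inverse a) = 1"
    using mero_const_mult[of a "inverse a"] by simp
  from inverse_unique[OF this] show ?thesis by simp
qed simp

lemma vector_space_mero_scale: "vector_space mero_scale"
  by unfold_locales
    (simp_all add: mero_scale_def mero_const_add mero_const_mult algebra_simps)

global_interpretation mero: vector_space mero_scale
  by (rule vector_space_mero_scale)

lemma eventually_cosparse_imp_deriv_eq:
  assumes "eventually (\<lambda>z. f z = g z) (cosparse UNIV)"
  shows "eventually (\<lambda>z::complex. deriv f z = (deriv g z :: complex)) (cosparse UNIV)"
proof -
  have ev: "eventually (\<lambda>w. f w = g w) (at z)" for z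
    by (rule eventually_cosparse_imp_eventually_at[OF assms UNIV_I])
  from assms show ?thesis
  proof eventually_elim
    case (elim z)
    have "eventually (\<lambda>w. w \<noteq> z \<longrightarrow> f w = g w) (nhds z)"
      using ev[of z] by (simp add: eventually_at_filter)
    then have "eventually (\<lambda>w. f w = g w) (nhds z)"
      by (rule eventually_mono) (use elim in metis)
    then show ?case by (intro deriv_cong_ev) simp_all
  qed
qed

lemma ev_analytic: "eventually (\<lambda>z. ev f analytic_on {z}) (cosparse UNIV)"
  using pre_mero_ev[of f] by (auto simp: pre_mero_def intro: meromorphic_on_imp_analytic_cosparse)

lemma ev_deriv: "eventually (\<lambda>z. ev (mero_deriv f) z = deriv (ev f) z) (cosparse UNIV)"
  unfolding mero_deriv_def by (intro ev_mk_mero_eventually pre_mero_intros)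

lemma mero_deriv_add: "mero_deriv (f + g) = mero_deriv f + mero_deriv g"
  by (rule mero_eqI)
    (use ev_deriv[of "f + g"] ev_add[of "mero_deriv f" "mero_deriv g"] ev_deriv[of f] ev_deriv[of g]
      eventually_cosparse_imp_deriv_eq[OF ev_add[of f g]] ev_analytic[of f] ev_analytic[of g]
     in eventually_elim, simp add: analytic_on_imp_differentiable_at)

lemma mero_deriv_mult: "mero_deriv (f * g) = mero_deriv f * g + f * mero_deriv g"
  by (rule mero_eqI)
    (use ev_deriv[of "f * g"] ev_add[of "mero_deriv f * g" "f * mero_deriv g"] ev_deriv[of f] ev_deriv[of g]
      ev_mult[of "mero_deriv f" g] ev_mult[of f "mero_deriv g"]
      eventually_cosparse_imp_deriv_eq[OF ev_mult[of f g]] ev_analytic[of f] ev_analytic[of g]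
     in eventually_elim, simp add: analytic_on_imp_differentiable_at)

lemma mero_deriv_const [simp]: "mero_deriv (mero_const c) = 0"
proof -
  have "ev (mero_const c) = (\<lambda>_. c)" by (auto simp: ev_const)
  then show ?thesis by (simp add: mero_deriv_def zero_mero_def)
qed

lemma mero_deriv_0 [simp]: "mero_deriv 0 = 0" and mero_deriv_1 [simp]: "mero_deriv 1 = 0"
  using mero_deriv_const[of 0] mero_deriv_const[of 1] by simp_all

lemma mero_deriv_uminus: "mero_deriv (- f) = - mero_deriv f"
  using mero_deriv_add[of f "- f"] by (simp add: eq_neg_iff_add_eq_0 add.commute)

lemma mero_deriv_diff: "mero_deriv (f - g) = mero_deriv f - mero_deriv g"
  by (simp only: diff_conv_add_uminus mero_deriv_add mero_deriv_uminus)

lemma mero_deriv_scale: "mero_deriv (mero_scale c f) = mero_scale c (mero_deriv f)"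
  by (simp add: mero_scale_def mero_deriv_mult)

lemma mero_deriv_inverse: "mero_deriv (inverse f) = - (mero_deriv f / f\<^sup>2)"
proof (cases "f = 0")
  case False
  then have "0 = mero_deriv f * inverse f + f * mero_deriv (inverse f)"
    using mero_deriv_mult[of f "inverse f"] by simp
  then show ?thesis using False by (simp add: field_simps power2_eq_square eq_neg_iff_add_eq_0)
qed simp

lemma mero_deriv_power: "mero_deriv (f ^ n) = of_nat n * f ^ (n - 1) * mero_deriv f"
proof (induction n)
  case (Suc n)
  then show ?case by (cases n) (simp_all add: mero_deriv_mult algebra_simps)
qed simp

lemma mero_deriv_powi:
  assumes "f \<noteq> 0"
  shows "mero_deriv (f powi k) = of_int k * f powi (k - 1) * mero_deriv f"
proof (cases "k \<ge> 0")
  case True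
  then obtain n where k: "k = int n" by (metis nat_0_le)
  have "of_nat n * f powi (int n - 1) = of_nat n * f ^ (n - 1)"
    by (cases n) simp_all
  then show ?thesis unfolding k mero_deriv_power power_int_of_nat of_int_of_nat_eq by (simp only:)
next
  case False
  define n where "n = nat (- k)"
  have k: "k = - int n" "n > 0" using False by (auto simp: n_def)
  then obtain m where m: "n = Suc m" by (cases n) auto
  have 1: "f powi (k - 1) = inverse (f ^ (n + 1))"
    using assms k(1) by (simp add: power_int_def nat_add_distrib power_inverse)
  have 2: "f powi k = inverse (f ^ n)"
    using k by (simp add: power_int_minus)
  show ?thesis
    unfolding 1 2 mero_deriv_inverse mero_deriv_power using assms
    by (simp add: k(1) m divide_simps power2_eq_square) (simp add: algebra_simps)
qed

lemma mero_const_of_int: "mero_const (of_int k) = of_int k"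
proof -
  have "mero_const (of_nat n) = of_nat n" for n
    by (induction n) (simp_all add: mero_const_add)
  then show ?thesis by (cases k rule: int_cases2) (simp_all add: mero_const_uminus)
qed

lemma mero_scale_of_int: "mero_scale (of_int k) f = of_int k * f"
  by (simp add: mero_scale_def mero_const_of_int)

lemma reg_mult: "reg f q \<Longrightarrow> reg g q \<Longrightarrow> reg (f * g) q"
  using has_val_mult by blast

lemma reg_mult_unit:
  assumes "has_val g q c" "c \<noteq> 0"
  shows "reg (f * g) q \<longleftrightarrow> reg f q"
proof
  assume "reg (f * g) q"
  then obtain x where "has_val (f * g / g) q (x / c)" using assms has_val_divide by blast
  moreover have "g \<noteq> 0" using assms has_val_0 has_val_unique by blast
  ultimately show "reg f q" by auto
next
  assume "reg f q"
  then show "reg (f * g) q" using assms has_val_mult by blast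
qed

lemma reg_lincomb:
  assumes "\<And>f. f \<in> S \<Longrightarrow> reg f q" "f \<in> mero.span S"
  shows "reg f q"
  using assms(2)
proof (induction rule: mero.span_induct_alt)
  case base
  show ?case using has_val_0 by blast
next
  case (step c x y)
  then obtain a b where "has_val x q a" "has_val y q b" using assms(1) by blast
  from has_val_add[OF has_val_scale[OF this(1)] this(2)] show ?case by (rule exI)
qed

lemma span_image_mult:
  "f \<in> mero.span (range g) \<longleftrightarrow> f * h \<in> mero.span (range (\<lambda>k. g k * h))" if "h \<noteq> 0"
proof -
  have *: "f * h \<in> mero.span (range (\<lambda>k. g k * h))" if "f \<in> mero.span (range g)" for f g h
    using that
  proof (induction rule: mero.span_induct_alt)
    case base
    then show ?case by (simp add: mero.span_zero)
  next
    case (step c x y)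
    have "x * h \<in> range (\<lambda>k. g k * h)" using step(1) by blast
    then have "mero_scale c (x * h) + y * h \<in> mero.span (range (\<lambda>k. g k * h))"
      by (intro mero.span_add mero.span_scale step(2) mero.span_base)
    moreover have "mero_scale c (x * h) + y * h = (mero_scale c x + y) * h"
      by (simp add: mero_scale_def algebra_simps)
    ultimately show ?case by (simp only:)
  qed
  show ?thesis using *[of f g h] *[of "f * h" "\<lambda>k. g k * h" "inverse h"] that
    by (auto simp: mult.assoc)
qed

section \<open>Standard local parameters\<close>

text \<open>The standard coordinate \<open>z\<close> as a meromorphic function.\<close>

definition zvar :: mero where "zvar = mk_mero (\<lambda>z. z)"

text \<open>The inverse of the local parameter at a point, as a function with a simple pole there.\<close>

fun stdpole :: "cpline \<Rightarrow> mero" where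
  "stdpole Infty = zvar"
| "stdpole (Pt a) = inverse (zvar - mero_const a)"

lemma pre_mero_id: "pre_mero (\<lambda>z. z)"
  by (auto simp: pre_mero_def intro!: meromorphic_intros)

lemma local_zvar: "eventually (\<lambda>w. local_fun zvar r w = chart r w) (at 0)"
  unfolding local_fun_chart zvar_def by (intro eventually_ev_mk_mero_chart pre_mero_id)

lemma ev_zvar: "ev zvar = (\<lambda>z. z)"
proof -
  have "remove_sings (\<lambda>z. z) z = z" for z :: complex
    by (rule remove_sings_eqI) (auto intro: tendsto_intros)
  then show ?thesis unfolding zvar_def by (subst ev_mk_mero[OF pre_mero_id]) auto
qed

lemma mero_deriv_zvar [simp]: "mero_deriv zvar = 1"
  by (simp add: mero_deriv_def ev_zvar one_mero_def)

lemma has_val_zvar: "has_val zvar (Pt a) a"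
  by (auto simp: has_val_Pt_iff ev_zvar intro: tendsto_intros)

lemma local_stdpole: "eventually (\<lambda>w. local_fun (stdpole r) r w = inverse w) (at 0)"
proof (cases r)
  case (Pt a)
  show ?thesis unfolding Pt stdpole.simps
    using local_inverse[of "zvar - mero_const a" r] local_diff[of zvar "mero_const a" r]
      local_zvar[of r] local_const[of a r]
    unfolding Pt by eventually_elim (simp del: local_fun.simps)
next
  case Infty
  then show ?thesis using local_zvar[of r] by simp
qed

lemma stdpole_nz [simp]: "stdpole r \<noteq> 0"
proof
  assume "stdpole r = 0"
  then have "\<forall>\<^sub>F w in at 0. inverse w = (0::complex)"
    using local_stdpole[of r] local_const[of 0 r] by (auto elim: eventually_elim2)
  moreover have "\<forall>\<^sub>F w in at 0. w \<noteq> (0::complex)" by (simp add: eventually_at_filter)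
  ultimately have "\<forall>\<^sub>F w in at (0::complex). False" by eventually_elim simp
  then show False by simp
qed

lemma zvar_nz [simp]: "zvar \<noteq> 0" and zvar_minus_const_nz [simp]: "zvar - mero_const a \<noteq> 0"
  using stdpole_nz[of Infty] stdpole_nz[of "Pt a"] by auto

lemma has_val_inverse_stdpole: "has_val (inverse (stdpole r)) r 0"
proof -
  have "eventually (\<lambda>w. local_fun (inverse (stdpole r)) r w = w) (at 0)"
    using local_inverse[of "stdpole r" r] local_stdpole[of r] by eventually_elim simp
  then show ?thesis unfolding has_val_def
    by (subst tendsto_cong) (auto intro: tendsto_intros)
qed

lemma not_reg_stdpole: "\<not> reg (stdpole r) r"
proof
  assume "reg (stdpole r) r"
  then obtain c where "has_val (stdpole r) r c" by blast
  from has_val_mult[OF this has_val_inverse_stdpole] have "has_val 1 r 0" by simp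
  then show False using has_val_1 has_val_unique by fastforce
qed

lemma has_val_stdpole_Infty: "has_val (stdpole (Pt a)) Infty 0"
proof -
  have "has_val (inverse zvar * inverse (1 - mero_const a * inverse zvar)) Infty
      (0 * inverse (1 - a * 0))"
    using has_val_inverse_stdpole[of Infty]
    by (intro has_val_intros has_val_inverse) (auto)
  then show ?thesis by (simp add: field_simps)
qed

lemma has_val_stdpole_Pt:
  assumes "a \<noteq> b"
  shows "has_val (stdpole (Pt a)) (Pt b) (inverse (b - a))"
  unfolding stdpole.simps
  by (rule has_val_inverse[OF has_val_diff[OF has_val_zvar has_val_const]]) (use assms in simp)

lemma reg_stdpole:
  assumes "r \<noteq> q"
  shows "reg (stdpole q) r"
proof (cases q)
  case q: (Pt a)
  show ?thesis
  proof (cases r)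
    case (Pt b)
    then have "a \<noteq> b" using assms q by simp
    from has_val_stdpole_Pt[OF this] show ?thesis unfolding q Pt by (rule exI)
  next
    case Infty
    show ?thesis unfolding q Infty by (rule exI, rule has_val_stdpole_Infty)
  qed
next
  case Infty
  then obtain b where "r = Pt b" using assms by (cases r) simp_all
  then show ?thesis unfolding Infty stdpole.simps by (simp only:) (rule exI, rule has_val_zvar)
qed

text \<open>Local rings are valuation rings: a function vanishing at a point is divisible by the parameter.\<close>

lemma reg_stdpole_mult_diff:
  assumes "has_val f r c"
  shows "reg (stdpole r * (f - mero_const c)) r"
proof -
  have iso: "isolated_singularity_at (local_fun f r) 0"
    using local_fun_meromorphic[of f r] by (simp add: meromorphic_at_iff)
  define h where "h = (\<lambda>w. if w = 0 then c else local_fun f r w)"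
  have h0: "h 0 = c" by (simp add: h_def)
  have "h analytic_on {0}"
    using removable_singularity'[OF iso] assms by (simp add: h_def has_val_def)
  then have "h field_differentiable (at 0)"
    by (rule analytic_on_imp_differentiable_at) simp
  then obtain d where "(h has_field_derivative d) (at 0)"
    by (auto simp: field_differentiable_def)
  then have lim: "((\<lambda>w. (h w - c) / w) \<longlongrightarrow> d) (at 0)"
    unfolding has_field_derivative_iff by (simp add: h0)
  have "eventually (\<lambda>w::complex. w \<noteq> 0) (at 0)" by (simp add: eventually_at_filter)
  then have eq: "eventually (\<lambda>w. local_fun (stdpole r * (f - mero_const c)) r w = (h w - c) / w) (at 0)"
    using local_mult[of "stdpole r" "f - mero_const c" r] local_stdpole[of r]
      local_diff[of f "mero_const c" r] local_const[of c r]
    by eventually_elim (simp add: h_def divide_inverse mult.commute)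
  have "has_val (stdpole r * (f - mero_const c)) r d"
    unfolding has_val_def tendsto_cong[OF eq] by (rule lim)
  then show ?thesis by blast
qed

text \<open>Every meromorphic function has a pole of finite order at most.\<close>

lemma finite_pole_order: "\<exists>n. reg (f / stdpole r ^ n) r"
proof -
  obtain F where F: "local_fun f r has_laurent_expansion F"
    using local_fun_meromorphic[of f r] by (auto simp: meromorphic_on_def)
  define n where "n = nat (- fls_subdegree F)"
  define g where "g = f / stdpole r ^ n"
  have g: "g = f * inverse (stdpole r) ^ n"
    unfolding g_def divide_inverse power_inverse ..
  have "eventually (\<lambda>w. local_fun (inverse (stdpole r) ^ n) r w = w ^ n) (at 0)"
  proof (induction n)
    case 0
    then show ?case using local_one by simp
  next
    case (Suc n)
    show ?case
      using local_mult[of "inverse (stdpole r)" "inverse (stdpole r) ^ n" r] Suc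
        local_inverse[of "stdpole r" r] local_stdpole[of r]
      by eventually_elim (simp only: power_Suc inverse_inverse_eq)
  qed
  then have eq: "eventually (\<lambda>w. local_fun g r w = local_fun f r w * w ^ n) (at 0)"
    using local_mult[of f "inverse (stdpole r) ^ n" r]
    by eventually_elim (simp only: g)
  have "(\<lambda>w. local_fun f r w * w ^ n) has_laurent_expansion (F * fls_X ^ n)"
    by (rule has_laurent_expansion_mult[OF F
          has_laurent_expansion_power[OF has_laurent_expansion_fps_X]])
  then have G: "local_fun g r has_laurent_expansion (F * fls_X ^ n)"
    using has_laurent_expansion_cong[OF eq refl] by simp
  have "fls_subdegree (F * fls_X ^ n) \<ge> 0"
    by (cases "F = 0") (simp_all add: fls_subdegree_pow n_def)
  then have "\<not> is_pole (local_fun g r) 0"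
    using has_laurent_expansion_imp_is_pole_iff[of "local_fun g r" 0] G by simp
  then have "reg g r" using has_pole_at_iff[of g r] by (simp add: has_pole_at_def)
  then show ?thesis unfolding g_def by blast
qed

section \<open>Forms, vector fields and residues\<close>

text \<open>At \<open>r\<close> one has \<open>dz = chart_factor r dw\<close>, where \<open>w\<close> is the local parameter.\<close>

definition chart_factor :: "cpline \<Rightarrow> mero" where
  "chart_factor r = (if r = Infty then - (zvar\<^sup>2) else 1)"

lemma chart_factor_nz [simp]: "chart_factor r \<noteq> 0"
  by (simp add: chart_factor_def)

lemma local_form_eq:
  "eventually (\<lambda>w. local_form \<alpha> r w = local_fun (\<alpha> * chart_factor r) r w) (at 0)"
proof (cases r)
  case (Pt a)
  then show ?thesis by (simp add: chart_factor_def)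
next
  case Infty
  show ?thesis
    using local_mult[of \<alpha> "chart_factor r" r] local_uminus[of "zvar * zvar" r]
      local_mult[of zvar zvar r] local_zvar[of r]
    unfolding Infty
    by eventually_elim (simp add: chart_factor_def power2_eq_square field_simps)
qed

lemma local_vfield_eq:
  "eventually (\<lambda>w. local_vfield X r w = local_fun (X / chart_factor r) r w) (at 0)"
proof (cases r)
  case (Pt a)
  then show ?thesis by (simp add: chart_factor_def)
next
  case Infty
  have "eventually (\<lambda>w::complex. w \<noteq> 0) (at 0)" by (simp add: eventually_at_filter)
  then show ?thesis
    using local_mult[of X "inverse (chart_factor r)" r] local_inverse[of "chart_factor r" r]
      local_uminus[of "zvar * zvar" r]
      local_mult[of zvar zvar r] local_zvar[of r]
    unfolding Infty
    by eventually_elim (simp add: chart_factor_def power2_eq_square divide_inverse)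
qed

lemma form_regular_at_iff: "form_regular_at \<alpha> r \<longleftrightarrow> reg (\<alpha> * chart_factor r) r"
  using has_pole_at_iff[of "\<alpha> * chart_factor r" r] is_pole_cong[OF local_form_eq refl]
  by (simp add: form_regular_at_def has_pole_at_def)

lemma vfield_regular_at_iff: "vfield_regular_at X r \<longleftrightarrow> reg (X / chart_factor r) r"
  using has_pole_at_iff[of "X / chart_factor r" r] is_pole_cong[OF local_vfield_eq refl]
  by (simp add: vfield_regular_at_def has_pole_at_def)

lemma local_form_laurent:
  obtains F where "local_form \<alpha> r has_laurent_expansion F" "form_residue r \<alpha> = fls_residue F"
proof -
  obtain F where F: "local_fun (\<alpha> * chart_factor r) r has_laurent_expansion F"
    using local_fun_meromorphic[of "\<alpha> * chart_factor r" r] by (auto simp: meromorphic_on_def)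
  then have F: "local_form \<alpha> r has_laurent_expansion F"
    using has_laurent_expansion_cong[OF local_form_eq refl] by blast
  then have "form_residue r \<alpha> = fls_residue F"
    unfolding form_residue_def by (rule has_laurent_expansion_residue_0)
  with F show ?thesis by (rule that)
qed

lemma form_residue_eqI:
  assumes "local_form \<alpha> r has_laurent_expansion F"
  shows "form_residue r \<alpha> = fls_residue F"
  unfolding form_residue_def using assms by (rule has_laurent_expansion_residue_0)

lemma local_form_mult:
  "eventually (\<lambda>w. local_form (f * \<alpha>) r w = local_fun f r w * local_form \<alpha> r w) (at 0)"
  using local_form_eq[of "f * \<alpha>" r] local_form_eq[of \<alpha> r]
    local_mult[of f "\<alpha> * chart_factor r" r]
  by eventually_elim (simp add: mult.assoc)

lemma form_residue_add: "form_residue r (\<alpha> + \<beta>) = form_residue r \<alpha> + form_residue r \<beta>"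
proof -
  obtain F where F: "local_form \<alpha> r has_laurent_expansion F" "form_residue r \<alpha> = fls_residue F"
    by (rule local_form_laurent)
  obtain G where G: "local_form \<beta> r has_laurent_expansion G" "form_residue r \<beta> = fls_residue G"
    by (rule local_form_laurent)
  have eq: "eventually (\<lambda>w. local_form (\<alpha> + \<beta>) r w = local_form \<alpha> r w + local_form \<beta> r w) (at 0)"
    using local_form_eq[of "\<alpha> + \<beta>" r] local_form_eq[of \<alpha> r] local_form_eq[of \<beta> r]
      local_add[of "\<alpha> * chart_factor r" "\<beta> * chart_factor r" r]
    by eventually_elim (simp add: distrib_right)
  have "local_form (\<alpha> + \<beta>) r has_laurent_expansion (F + G)"
    unfolding has_laurent_expansion_cong[OF eq refl]
    by (rule has_laurent_expansion_add[OF F(1) G(1)])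
  from form_residue_eqI[OF this] show ?thesis by (simp add: F G)
qed

lemma form_residue_scale: "form_residue r (mero_scale c \<alpha>) = c * form_residue r \<alpha>"
proof -
  obtain F where F: "local_form \<alpha> r has_laurent_expansion F" "form_residue r \<alpha> = fls_residue F"
    by (rule local_form_laurent)
  have eq: "eventually (\<lambda>w. local_form (mero_scale c \<alpha>) r w = c * local_form \<alpha> r w) (at 0)"
    using local_form_mult[of "mero_const c" \<alpha> r] local_const[of c r]
    by eventually_elim (simp add: mero_scale_def)
  have "local_form (mero_scale c \<alpha>) r has_laurent_expansion (fls_const c * F)"
    unfolding has_laurent_expansion_cong[OF eq refl]
    by (rule has_laurent_expansion_cmult_left[OF F(1)])
  from form_residue_eqI[OF this] show ?thesis by (simp add: F)
qed

lemma form_residue_0 [simp]: "form_residue r 0 = 0"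
  using form_residue_scale[of r 0 0] by simp

lemma form_residue_uminus: "form_residue r (- \<alpha>) = - form_residue r \<alpha>"
  using form_residue_add[of r \<alpha> "- \<alpha>"] by (simp add: eq_neg_iff_add_eq_0 add.commute)

lemma form_residue_diff: "form_residue r (\<alpha> - \<beta>) = form_residue r \<alpha> - form_residue r \<beta>"
  by (simp only: diff_conv_add_uminus form_residue_add form_residue_uminus)

text \<open>Exact forms have no residues.\<close>

lemma form_residue_deriv: "form_residue r (mero_deriv f) = 0"
proof -
  obtain F where F: "local_fun f r has_laurent_expansion F"
    using local_fun_meromorphic[of f r] by (auto simp: meromorphic_on_def)
  have eq: "eventually (\<lambda>w. local_form (mero_deriv f) r w = deriv (local_fun f r) w) (at 0)"
    using local_fun_deriv[of f r] by eventually_elim simp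
  have "local_form (mero_deriv f) r has_laurent_expansion fls_deriv F"
    unfolding has_laurent_expansion_cong[OF eq refl] by (rule has_laurent_expansion_deriv[OF F])
  from form_residue_eqI[OF this] show ?thesis by simp
qed

lemma form_residue_regular:
  assumes "reg (\<alpha> * chart_factor r) r"
  shows "form_residue r \<alpha> = 0"
proof -
  obtain F where F: "local_form \<alpha> r has_laurent_expansion F" "form_residue r \<alpha> = fls_residue F"
    by (rule local_form_laurent)
  have "\<not> is_pole (local_form \<alpha> r) 0"
    using assms form_regular_at_iff[of \<alpha> r] by (simp add: form_regular_at_def)
  then have "fls_subdegree F \<ge> 0"
    using has_laurent_expansion_imp_is_pole_iff[of "local_form \<alpha> r" 0 F] F by simp
  then show ?thesis by (simp add: F)
qed

lemma form_residue_regular_at: "form_regular_at \<alpha> p \<Longrightarrow> form_residue p \<alpha> = 0"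
  by (rule form_residue_regular) (simp add: form_regular_at_iff)

lemma mero_deriv_stdpole: "mero_deriv (stdpole r) * chart_factor r = - ((stdpole r)\<^sup>2)"
  by (cases r)
    (simp_all add: chart_factor_def mero_deriv_inverse mero_deriv_diff divide_inverse power_inverse)

lemma form_residue_stdpole: "form_residue r (mero_deriv (stdpole r) / stdpole r) = -1"
proof -
  have *: "mero_deriv (stdpole r) / stdpole r * chart_factor r = - stdpole r"
    using mero_deriv_stdpole[of r] by (simp add: field_simps power2_eq_square)
  have eq: "eventually (\<lambda>w. local_form (mero_deriv (stdpole r) / stdpole r) r w = - inverse w) (at 0)"
    using local_form_eq[of "mero_deriv (stdpole r) / stdpole r" r] local_uminus[of "stdpole r" r]
      local_stdpole[of r]
    by eventually_elim (simp only: *)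
  have "(\<lambda>w. - inverse w) has_laurent_expansion (- inverse fls_X)"
    by (rule has_laurent_expansion_minus[OF has_laurent_expansion_inverse[OF has_laurent_expansion_fps_X]])
  then have "local_form (mero_deriv (stdpole r) / stdpole r) r has_laurent_expansion (- inverse fls_X)"
    unfolding has_laurent_expansion_cong[OF eq refl] .
  from form_residue_eqI[OF this] show ?thesis by (simp add: fls_inverse_X)
qed

text \<open>Away from its pole, \<open>stdpole r\<close> is a local parameter up to an additive constant.\<close>

lemma deriv_stdpole_unit:
  assumes "q \<noteq> r"
  obtains c where "c \<noteq> 0" "has_val (mero_deriv (stdpole r) * chart_factor q) q c"
proof (cases r)
  case Infty
  then obtain a where "q = Pt a" using assms by (cases q) simp_all
  then show ?thesis using that[of 1] Infty by (simp add: chart_factor_def has_val_1)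
next
  case r: (Pt a)
  have d: "mero_deriv (stdpole r) = - ((stdpole r)\<^sup>2)"
    using mero_deriv_stdpole[of r] by (simp add: r chart_factor_def)
  show ?thesis
  proof (cases q)
    case (Pt b)
    have "has_val (- ((stdpole r)\<^sup>2)) q (- ((inverse (b - a))\<^sup>2))"
      unfolding r Pt using assms
      by (intro has_val_uminus has_val_power has_val_stdpole_Pt) (simp add: r Pt)
    moreover have "mero_deriv (stdpole r) * chart_factor q = - ((stdpole r)\<^sup>2)"
      unfolding d by (simp add: Pt chart_factor_def)
    moreover have "- ((inverse (b - a))\<^sup>2) \<noteq> 0" using assms Pt r by simp
    ultimately show ?thesis using that by presburger
  next
    case Infty
    have "has_val (inverse (1 - mero_const a * inverse zvar)) q (inverse (1 - a * 0))"
      using has_val_inverse_stdpole[of Infty] unfolding Infty stdpole.simps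
      by (intro has_val_inverse has_val_diff has_val_mult has_val_1 has_val_const) simp_all
    then have "has_val ((inverse (1 - mero_const a * inverse zvar))\<^sup>2) q 1"
      using has_val_power[of _ q 1 2] by simp
    moreover have "zvar * stdpole r = inverse (1 - mero_const a * inverse zvar)"
      using zvar_minus_const_nz[of a] by (simp add: r field_simps del: zvar_minus_const_nz)
    then have "mero_deriv (stdpole r) * chart_factor q = (inverse (1 - mero_const a * inverse zvar))\<^sup>2"
      unfolding d by (simp add: chart_factor_def Infty power_mult_distrib[symmetric] mult.commute)
    ultimately show ?thesis using that[of 1] by simp
  qed
qed

lemma exact_second_kind: "mero_deriv f \<in> second_kind"
  by (simp add: second_kind_def form_residue_deriv)

lemma second_kind_add: "\<alpha> \<in> second_kind \<Longrightarrow> \<beta> \<in> second_kind \<Longrightarrow> \<alpha> + \<beta> \<in> second_kind"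
  by (simp add: second_kind_def form_residue_add)

lemma second_kind_scale: "\<alpha> \<in> second_kind \<Longrightarrow> mero_scale a \<alpha> \<in> second_kind"
  by (simp add: second_kind_def form_residue_scale)

lemma lie_deriv_second_kind: "lie_deriv X \<alpha> \<in> second_kind"
  by (simp add: lie_deriv_def exact_second_kind)

lemma lie_deriv_add: "lie_deriv X (\<alpha> + \<beta>) = lie_deriv X \<alpha> + lie_deriv X \<beta>"
  by (simp add: lie_deriv_def contract_def distrib_left mero_deriv_add)

lemma lie_deriv_scale: "lie_deriv X (mero_scale a \<alpha>) = mero_scale a (lie_deriv X \<alpha>)"
proof -
  have "X * mero_scale a \<alpha> = mero_scale a (X * \<alpha>)" by (simp add: mero_scale_def)
  then show ?thesis by (simp add: lie_deriv_def contract_def mero_deriv_scale)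
qed

section \<open>Coordinates\<close>

text \<open>Subtracting a multiple of \<open>stdpole r\<close> from a coordinate with pole \<open>r\<close> leaves a function without poles.\<close>

lemma coordinate_imp_affine_stdpole:
  assumes "coordinate v"
  obtains r c d where "c \<noteq> 0" "v = mero_const c * stdpole r + mero_const d"
    "\<And>q. has_pole_at v q \<longleftrightarrow> q = r"
proof -
  obtain r where r: "\<And>q. has_pole_at v q \<longleftrightarrow> q = r" and z: "zorder (local_fun v r) 0 = -1"
    using assms unfolding coordinate_def by metis
  obtain F where F: "local_fun v r has_laurent_expansion F"
    using local_fun_meromorphic[of v r] by (auto simp: meromorphic_on_def)
  have "is_pole (local_fun v r) 0" using r[of r] by (simp add: has_pole_at_def)
  then have "fls_subdegree F < 0"
    using has_laurent_expansion_imp_is_pole_iff[of "local_fun v r" 0 F] F by simp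
  then have "F \<noteq> 0" by auto
  then have sub: "fls_subdegree F = -1"
    using has_laurent_expansion_zorder_0[OF F] z by simp
  define g where "g = v / stdpole r"
  have eq: "eventually (\<lambda>w. local_fun g r w = local_fun v r w * w) (at 0)"
    using local_mult[of v "inverse (stdpole r)" r] local_inverse[of "stdpole r" r] local_stdpole[of r]
    by eventually_elim (simp add: g_def divide_inverse)
  have G: "local_fun g r has_laurent_expansion (F * fls_X)"
    unfolding has_laurent_expansion_cong[OF eq refl]
    by (rule has_laurent_expansion_mult[OF F has_laurent_expansion_fps_X])
  have "fls_subdegree (F * fls_X) = 0" using \<open>F \<noteq> 0\<close> sub by simp
  then have "\<not> is_pole (local_fun g r) 0"
    using has_laurent_expansion_imp_is_pole_iff[of "local_fun g r" 0 "F * fls_X"] G by simp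
  then obtain c where c: "has_val g r c"
    using has_pole_at_iff[of g r] by (auto simp: has_pole_at_def)
  have "reg (v - mero_const c * stdpole r) q" for q
  proof (cases "q = r")
    case True
    have "stdpole r * (g - mero_const c) = v - mero_const c * stdpole r"
      by (simp add: g_def field_simps)
    then show ?thesis using reg_stdpole_mult_diff[OF c] True by simp
  next
    case False
    then obtain a b where "has_val v q a" "has_val (stdpole r) q b"
      using r[of q] has_pole_at_iff[of v q] reg_stdpole[of q r] by blast
    from has_val_diff[OF this(1) has_val_mult[OF has_val_const this(2)]] show ?thesis by (rule exI)
  qed
  then obtain d where d: "v - mero_const c * stdpole r = mero_const d"
    using reg_everywhere_imp_const[of "v - mero_const c * stdpole r"] by metis
  then have v: "v = mero_const c * stdpole r + mero_const d" by (simp add: field_simps)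
  have "c \<noteq> 0"
  proof
    assume "c = 0"
    then have "reg v r" using v has_val_const[of d r] by auto
    then show False using r[of r] has_pole_at_iff[of v r] by simp
  qed
  then show ?thesis using v r by (rule that)
qed

text \<open>A coordinate vanishing at \<open>p\<close> is the inverse of one with its pole at \<open>p\<close>.\<close>

lemma inverse_vanishing_coordinate:
  assumes "coordinate u" "vanishes_at u p"
  obtains c d where "c \<noteq> 0" "inverse u = mero_const c * stdpole p + mero_const d"
proof -
  obtain q c d where c: "c \<noteq> 0" and u: "u = mero_const c * stdpole q + mero_const d"
    and q: "\<And>r. has_pole_at u r \<longleftrightarrow> r = q"
    by (rule coordinate_imp_affine_stdpole[OF assms(1)]) blast
  have u0: "has_val u p 0" using assms(2) by (simp add: vanishes_at_iff)
  then have "p \<noteq> q" using q[of p] has_pole_at_iff[of u p] by blast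
  have unique: "c * x + d = 0" if "has_val (stdpole q) p x" for x
  proof -
    have "has_val u p (c * x + d)"
      unfolding u using that by (intro has_val_add has_val_mult has_val_const)
    then show ?thesis using has_val_unique u0 by blast
  qed
  show ?thesis
  proof (cases q)
    case Infty
    then obtain b where p: "p = Pt b" using \<open>p \<noteq> q\<close> by (cases p) simp_all
    have "c * b + d = 0" using unique has_val_zvar by (simp add: Infty p)
    then have "d = - (c * b)" by (simp add: eq_neg_iff_add_eq_0 add.commute)
    then have "u = mero_const c * (zvar - mero_const b)"
      unfolding u Infty by (simp add: mero_const_uminus mero_const_mult algebra_simps)
    then have "inverse u = mero_const (inverse c) * stdpole p + mero_const 0"
      by (simp add: p mero_const_inverse)
    then show ?thesis using c by (intro that[of "inverse c" 0]) simp_all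
  next
    case q': (Pt a)
    show ?thesis
    proof (cases p)
      case Infty
      have "d = 0" using unique[of 0] has_val_stdpole_Infty[of a] by (simp add: Infty q')
      then have "inverse u = mero_const (inverse c) * stdpole p + mero_const (- (a / c))"
        unfolding u q' Infty using c
        by (simp add: mero_const_inverse mero_const_mult mero_const_uminus divide_inverse algebra_simps)
      then show ?thesis using c by (intro that[of "inverse c" "- (a / c)"]) simp_all
    next
      case (Pt b)
      have ab: "a \<noteq> b" using \<open>p \<noteq> q\<close> Pt q' by simp
      define A B C where "A = mero_const a" "B = mero_const b" "C = mero_const c"
      have nz: "zvar - A \<noteq> 0" "zvar - B \<noteq> 0" "A - B \<noteq> 0" "B - A \<noteq> 0" "C \<noteq> 0"
        using ab c zvar_minus_const_nz[of a] zvar_minus_const_nz[of b]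
        by (simp_all add: A_B_C_def del: zvar_minus_const_nz)
      have "d = - (c * inverse (b - a))"
        using unique has_val_stdpole_Pt[OF ab]
        by (simp add: Pt q' eq_neg_iff_add_eq_0 add.commute)
      then have "mero_const d = - (C * inverse (B - A))"
        using mero_const_add[of b "- a"]
        by (simp add: mero_const_uminus mero_const_mult mero_const_inverse A_B_C_def)
      then have "u = C * inverse (zvar - A) - C * inverse (B - A)"
        unfolding u q' by (simp add: A_B_C_def)
      also have "\<dots> = - (C * (zvar - B) / ((zvar - A) * (B - A)))"
        using nz by (simp add: divide_simps) (simp add: algebra_simps)
      finally have "inverse u = - ((zvar - A) * (B - A) / (C * (zvar - B)))"
        by simp
      also have "\<dots> = - ((B - A)\<^sup>2 / C) * inverse (zvar - B) + - ((B - A) / C)"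
        using nz by (simp add: divide_simps power2_eq_square) (simp add: algebra_simps)
      also have "\<dots> = mero_const (- ((b - a)\<^sup>2 / c)) * stdpole p + mero_const (- ((b - a) / c))"
        using mero_const_add[of b "- a"]
        by (simp add: A_B_C_def mero_const_uminus mero_const_mult mero_const_inverse Pt divide_inverse
            power2_eq_square)
      finally show ?thesis
        using ab c by (intro that[of "- ((b - a)\<^sup>2 / c)" "- ((b - a) / c)"]) simp_all
    qed
  qed
qed

section \<open>Functions, forms and vector fields with poles at one point\<close>

text \<open>
  A coordinate \<open>t\<close> with pole at the base point \<open>p\<close>, written as an affine function of the standard one.
  Its inverse is a local parameter at \<open>p\<close>.
\<close>

locale pole_coordinate =
  fixes p :: cpline and t :: mero and c\<^sub>0 d\<^sub>0 :: complex
  assumes c0_nz: "c\<^sub>0 \<noteq> 0"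
    and t_eq: "t = mero_const c\<^sub>0 * stdpole p + mero_const d\<^sub>0"
begin

abbreviation t' :: mero where "t' \<equiv> mero_deriv t"

lemma t'_eq: "t' = mero_const c\<^sub>0 * mero_deriv (stdpole p)"
  by (simp add: t_eq mero_deriv_add mero_deriv_mult)

lemma not_reg_t: "\<not> reg t p"
proof
  assume "reg t p"
  then obtain x where "has_val t p x" by blast
  then have "has_val (mero_const (inverse c\<^sub>0) * (t - mero_const d\<^sub>0)) p (inverse c\<^sub>0 * (x - d\<^sub>0))"
    by (intro has_val_mult has_val_diff has_val_const)
  moreover have "mero_const (inverse c\<^sub>0) * (t - mero_const d\<^sub>0) = stdpole p"
    using c0_nz by (simp add: t_eq mero_const_inverse)
  ultimately show False using not_reg_stdpole by metis
qed

lemma t_nz [simp]: "t \<noteq> 0"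
  using not_reg_t has_val_0 by metis

lemma t'_nz [simp]: "t' \<noteq> 0"
proof -
  have "mero_deriv (stdpole p) \<noteq> 0"
    using mero_deriv_stdpole[of p] by (metis mult_zero_left neg_equal_0_iff_equal power_not_zero stdpole_nz)
  then show ?thesis using c0_nz by (simp add: t'_eq)
qed

lemma reg_t: "q \<noteq> p \<Longrightarrow> reg t q"
proof -
  assume "q \<noteq> p"
  then obtain x where "has_val (stdpole p) q x" using reg_stdpole by blast
  from has_val_add[OF has_val_mult[OF has_val_const this] has_val_const]
  show "reg t q" unfolding t_eq by (rule exI)
qed

lemma has_val_t_div_stdpole: "has_val (t / stdpole p) p c\<^sub>0"
proof -
  have "t / stdpole p = mero_const c\<^sub>0 + mero_const d\<^sub>0 * inverse (stdpole p)"
    by (simp add: t_eq field_simps)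
  moreover have "has_val (mero_const c\<^sub>0 + mero_const d\<^sub>0 * inverse (stdpole p)) p (c\<^sub>0 + d\<^sub>0 * 0)"
    by (intro has_val_add has_val_mult has_val_const has_val_inverse_stdpole)
  ultimately show ?thesis by simp
qed

text \<open>The principal part at \<open>p\<close> is a polynomial in \<open>t\<close> without constant term.\<close>

lemma principal_part: "\<exists>q \<in> mero.span (range (\<lambda>k. t ^ Suc k)). reg (f - q) p"
proof -
  have "\<exists>q \<in> mero.span (range (\<lambda>k. t ^ Suc k)). reg (f - q) p" if "reg (f / t ^ n) p" for n
    using that
  proof (induction n arbitrary: f)
    case 0
    then show ?case by (intro bexI[of _ 0]) (simp_all add: mero.span_zero)
  next
    case (Suc n)
    define g where "g = f / t ^ Suc n"
    obtain c where c: "has_val g p c" using Suc.prems by (auto simp: g_def)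
    obtain x where "has_val (stdpole p * (g - mero_const c)) p x"
      using reg_stdpole_mult_diff[OF c] by blast
    then have "has_val (t / stdpole p * (stdpole p * (g - mero_const c))) p (c\<^sub>0 * x)"
      by (rule has_val_mult[OF has_val_t_div_stdpole])
    moreover have "t / stdpole p * (stdpole p * (g - mero_const c))
        = (f - mero_scale c (t ^ Suc n)) / t ^ n"
      by (simp add: g_def mero_scale_def field_simps)
    ultimately have "reg ((f - mero_scale c (t ^ Suc n)) / t ^ n) p" by metis
    from Suc.IH[OF this] obtain q where q: "q \<in> mero.span (range (\<lambda>k. t ^ Suc k))"
      "reg (f - mero_scale c (t ^ Suc n) - q) p" by blast
    have "mero_scale c (t ^ Suc n) + q \<in> mero.span (range (\<lambda>k. t ^ Suc k))"
      by (intro mero.span_add mero.span_scale mero.span_base q) blast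
    moreover have "f - mero_scale c (t ^ Suc n) - q = f - (mero_scale c (t ^ Suc n) + q)"
      by (simp add: algebra_simps)
    ultimately show ?case using q(2) by metis
  qed
  moreover obtain n where "reg (f / stdpole p ^ n) p" using finite_pole_order by blast
  moreover have "reg (f / stdpole p ^ n * inverse ((t / stdpole p) ^ n)) p \<longleftrightarrow> reg (f / stdpole p ^ n) p"
    using c0_nz
    by (intro reg_mult_unit[of _ _ "inverse (c\<^sub>0 ^ n)"] has_val_inverse has_val_power has_val_t_div_stdpole)
      simp_all
  moreover have "f / stdpole p ^ n * inverse ((t / stdpole p) ^ n) = f / t ^ n"
    by (simp add: power_divide field_simps)
  ultimately show ?thesis by metis
qed

text \<open>Functions regular away from \<open>p\<close> are the polynomials in \<open>t\<close>.\<close>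

lemma reg_away_iff: "(\<forall>q. q \<noteq> p \<longrightarrow> reg f q) \<longleftrightarrow> f \<in> mero.span (range (\<lambda>k. t ^ k))"
proof
  assume f: "\<forall>q. q \<noteq> p \<longrightarrow> reg f q"
  obtain g where g: "g \<in> mero.span (range (\<lambda>k. t ^ Suc k))" "reg (f - g) p"
    using principal_part by blast
  have sub: "range (\<lambda>k. t ^ Suc k) \<subseteq> range (\<lambda>k. t ^ k)" by (rule image_subsetI) (rule rangeI)
  have g': "g \<in> mero.span (range (\<lambda>k. t ^ k))" using g(1) mero.span_mono[OF sub] by blast
  have "reg (f - g) q" for q
  proof (cases "q = p")
    case False
    have "reg x q" if "x \<in> range (\<lambda>k. t ^ k)" for x
      using that reg_t[OF False] has_val_power by blast
    from reg_lincomb[OF this g'] obtain b where "has_val g q b" by blast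
    moreover obtain a where "has_val f q a" using f False by blast
    ultimately show ?thesis using has_val_diff by blast
  qed (use g in simp)
  then obtain c where "f - g = mero_const c" using reg_everywhere_imp_const by metis
  then have "f = mero_scale c (t ^ 0) + g" by (simp add: mero_scale_def algebra_simps)
  moreover have "mero_scale c (t ^ 0) \<in> mero.span (range (\<lambda>k. t ^ k))"
    by (intro mero.span_scale mero.span_base rangeI)
  ultimately show "f \<in> mero.span (range (\<lambda>k. t ^ k))" using g' by (simp add: mero.span_add)
next
  assume f: "f \<in> mero.span (range (\<lambda>k. t ^ k))"
  show "\<forall>q. q \<noteq> p \<longrightarrow> reg f q"
  proof (intro allI impI)
    fix q assume "q \<noteq> p"
    then have "reg x q" if "x \<in> range (\<lambda>k. t ^ k)" for x
      using that reg_t has_val_power by blast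
    from reg_lincomb[OF this f] show "reg f q" .
  qed
qed

text \<open>Off \<open>p\<close> the differential \<open>dt\<close> has neither zeros nor poles, and at \<open>p\<close> neither has \<open>du = - dt / t\<^sup>2\<close>.\<close>

lemma t'_unit:
  assumes "q \<noteq> p"
  obtains c where "c \<noteq> 0" "has_val (t' * chart_factor q) q c"
proof -
  obtain c where c: "c \<noteq> 0" "has_val (mero_deriv (stdpole p) * chart_factor q) q c"
    using deriv_stdpole_unit[OF assms] by blast
  have "has_val (t' * chart_factor q) q (c\<^sub>0 * c)"
    unfolding t'_eq mult.assoc by (intro has_val_mult has_val_const c)
  then show ?thesis using c c0_nz by (intro that) simp_all
qed

lemma t'_unit_at: "has_val (t' * chart_factor p / t\<^sup>2) p (- inverse c\<^sub>0)"
proof -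
  have "mero_deriv (stdpole p) * chart_factor p = - (stdpole p * stdpole p)"
    using mero_deriv_stdpole[of p] by (simp add: power2_eq_square)
  then have "t' * chart_factor p / t\<^sup>2 = - (mero_const c\<^sub>0 * (stdpole p * stdpole p)) / t\<^sup>2"
    unfolding t'_eq by (simp add: mult.assoc)
  also have "\<dots> = - (mero_const c\<^sub>0 * (inverse (t / stdpole p))\<^sup>2)"
    by (simp add: power2_eq_square field_simps)
  also have "has_val \<dots> p (- (c\<^sub>0 * (inverse c\<^sub>0)\<^sup>2))"
    using c0_nz
    by (intro has_val_uminus has_val_mult has_val_const has_val_power has_val_inverse has_val_t_div_stdpole)
  also have "c\<^sub>0 * (inverse c\<^sub>0)\<^sup>2 = inverse c\<^sub>0" using c0_nz by (simp add: power2_eq_square)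
  finally show ?thesis .
qed

lemma form_regular_at_away:
  assumes "q \<noteq> p"
  shows "form_regular_at \<alpha> q \<longleftrightarrow> reg (\<alpha> / t') q"
proof -
  obtain c where c: "c \<noteq> 0" "has_val (t' * chart_factor q) q c" using t'_unit[OF assms] by blast
  have "\<alpha> / t' * (t' * chart_factor q) = \<alpha> * chart_factor q" by simp
  then show ?thesis using reg_mult_unit[OF c(2,1), of "\<alpha> / t'"] by (simp add: form_regular_at_iff)
qed

lemma vfield_regular_at_away:
  assumes "q \<noteq> p"
  shows "vfield_regular_at X q \<longleftrightarrow> reg (X * t') q"
proof -
  obtain c where c: "c \<noteq> 0" "has_val (t' * chart_factor q) q c" using t'_unit[OF assms] by blast
  have "X / chart_factor q * (t' * chart_factor q) = X * t'" by simp
  then show ?thesis using reg_mult_unit[OF c(2,1), of "X / chart_factor q"] by (simp add: vfield_regular_at_iff)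
qed

lemma form_regular_at_base: "form_regular_at \<alpha> p \<longleftrightarrow> reg (\<alpha> * t\<^sup>2 / t') p"
proof -
  have "\<alpha> * t\<^sup>2 / t' * (t' * chart_factor p / t\<^sup>2) = \<alpha> * chart_factor p" by simp
  then show ?thesis
    using reg_mult_unit[OF t'_unit_at, of "\<alpha> * t\<^sup>2 / t'"] c0_nz by (simp add: form_regular_at_iff)
qed

lemma vfield_regular_at_base: "vfield_regular_at X p \<longleftrightarrow> reg (X * t' / t\<^sup>2) p"
proof -
  have "X / chart_factor p * (t' * chart_factor p / t\<^sup>2) = X * t' / t\<^sup>2" by simp
  then show ?thesis
    using reg_mult_unit[OF t'_unit_at, of "X / chart_factor p"] c0_nz by (simp add: vfield_regular_at_iff)
qed

lemma K_space_eq: "K_space p = mero.span (range (\<lambda>k. t ^ k * t'))"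
proof -
  have "\<alpha> \<in> K_space p \<longleftrightarrow> \<alpha> \<in> mero.span (range (\<lambda>k. t ^ k * t'))" for \<alpha>
    using reg_away_iff[of "\<alpha> / t'"] span_image_mult[of t' "\<alpha> / t'" "\<lambda>k. t ^ k"]
    by (simp add: K_space_def form_regular_at_away cong: conj_cong imp_cong)
  then show ?thesis by blast
qed

lemma vfield_regular_away_iff: "vfield_regular_away p X \<longleftrightarrow> X \<in> mero.span (range (\<lambda>k. t ^ k / t'))"
proof -
  have "vfield_regular_away p X \<longleftrightarrow> X * t' \<in> mero.span (range (\<lambda>k. t ^ k))"
    using reg_away_iff[of "X * t'"]
    by (simp add: vfield_regular_away_def vfield_regular_at_away cong: imp_cong)
  also have "\<dots> \<longleftrightarrow> X * t' * inverse t' \<in> mero.span (range (\<lambda>k. t ^ k * inverse t'))"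
    by (rule span_image_mult) simp
  also have "X * t' * inverse t' = X" by simp
  finally show ?thesis by (simp only: divide_inverse)
qed

text \<open>Among the monomial forms only \<open>t\<^sup>-\<^sup>1 dt\<close> is not exact.\<close>

lemma exact_powi: "k \<noteq> -1 \<Longrightarrow> t powi k * t' = mero_deriv (mero_scale (1 / of_int (k + 1)) (t powi (k + 1)))"
proof -
  assume "k \<noteq> -1"
  then have "(of_int (k + 1) :: complex) \<noteq> 0" by (metis add_eq_0_iff2 minus_equation_iff of_int_eq_0_iff)
  then have *: "mero_scale (1 / of_int (k + 1)) (mero_scale (of_int (k + 1)) f) = f" for f
    by (simp only: mero.scale_scale) simp
  have "mero_deriv (mero_scale (1 / of_int (k + 1)) (t powi (k + 1)))
      = mero_scale (1 / of_int (k + 1)) (mero_scale (of_int (k + 1)) (t powi k * t'))"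
    by (simp only: mero_deriv_scale mero_deriv_powi[OF t_nz] mero_scale_of_int mult.assoc) simp
  then show ?thesis by (simp only: *)
qed

lemma form_residue_powi: "form_residue p (t powi k * t') = (if k = -1 then -1 else 0)"
proof (cases "k = -1")
  case False
  then show ?thesis by (simp add: exact_powi form_residue_deriv)
next
  case True
  define s where "s = stdpole p"
  \<comment> \<open>\<open>t\<close> and \<open>s\<close> have the same pole, so their logarithmic derivatives differ by a form regular at \<open>p\<close>.\<close>
  define \<delta> where "\<delta> = t' / t - mero_deriv s / s"
  have "\<delta> * chart_factor p = mero_deriv s * chart_factor p * (mero_const c\<^sub>0 / t - 1 / s)"
    by (simp add: \<delta>_def t'_eq s_def field_simps)
  also have "\<dots> = - (s\<^sup>2) * (mero_const c\<^sub>0 / t - 1 / s)"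
    by (simp add: s_def mero_deriv_stdpole)
  also have "\<dots> = s * (t - mero_const c\<^sub>0 * s) / t"
    by (simp add: s_def field_simps power2_eq_square)
  also have "\<dots> = mero_const d\<^sub>0 * inverse (t / s)"
    by (simp add: t_eq s_def field_simps)
  also have "has_val \<dots> p (d\<^sub>0 * inverse c\<^sub>0)"
    using c0_nz unfolding s_def
    by (intro has_val_mult has_val_const has_val_inverse has_val_t_div_stdpole)
  finally have "form_residue p \<delta> = 0" using form_residue_regular by blast
  then show ?thesis
    using form_residue_stdpole[of p] True
    by (simp add: \<delta>_def form_residue_diff s_def power_int_minus divide_inverse mult.commute)
qed

end

section \<open>A basis of the forms regular away from one point\<close>

context pole_coordinate
begin

text \<open>
  With \<open>u = 1/t\<close> the form \<open>e k\<close> is \<open>u\<^sup>-\<^sup>k\<^sup>-\<^sup>1 du\<close>, and \<open>coef k \<alpha>\<close> is the residue of \<open>u\<^sup>k \<alpha>\<close> at \<open>p\<close>. Both are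
  set to 0 for \<open>k \<le> 0\<close>, which makes the formulas below uniform in integer indices.
\<close>

definition e :: "int \<Rightarrow> oneform" where
  "e k = (if k \<ge> 1 then - (t powi (k - 1) * t') else 0)"

definition coef :: "int \<Rightarrow> oneform \<Rightarrow> complex" where
  "coef k \<alpha> = (if k \<ge> 1 then form_residue p (t powi (- k) * \<alpha>) else 0)"

lemma coef_add: "coef k (\<alpha> + \<beta>) = coef k \<alpha> + coef k \<beta>"
  by (simp add: coef_def distrib_left form_residue_add)

lemma coef_scale: "coef k (mero_scale a \<alpha>) = a * coef k \<alpha>"
proof -
  have "t powi (- k) * mero_scale a \<alpha> = mero_scale a (t powi (- k) * \<alpha>)"
    by (simp add: mero_scale_def)
  then show ?thesis by (simp add: coef_def form_residue_scale)
qed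

lemma coef_0 [simp]: "coef k 0 = 0"
  by (simp add: coef_def)

lemma powi_mult_powi: "t powi i * (t powi j * \<alpha>) = t powi (i + j) * \<alpha>"
  by (simp add: power_int_add)

lemma coef_powi: "coef k (t powi j * t') = (if k \<ge> 1 \<and> j = k - 1 then -1 else 0)"
  unfolding coef_def powi_mult_powi form_residue_powi by auto

lemma coef_dlog: "coef k (t' / t) = 0"
proof -
  have "t' / t = t powi (-1) * t'" by (simp add: divide_inverse)
  then show ?thesis by (simp only: coef_powi) simp
qed

lemma form_residue_dlog: "form_residue p (t' / t) = -1"
proof -
  have "t' / t = t powi (-1) * t'" by (simp add: divide_inverse)
  then show ?thesis by (simp only: form_residue_powi) simp
qed

lemma coef_uminus: "coef k (- \<alpha>) = - coef k \<alpha>"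
  using coef_add[of k \<alpha> "- \<alpha>"] by (simp add: eq_neg_iff_add_eq_0 add.commute)

lemma coef_e: "coef j (e k) = (if j = k \<and> k \<ge> 1 then 1 else 0)"
  by (auto simp: e_def coef_powi coef_uminus)

lemma K_space_eq_e: "K_space p = mero.span (range e)"
proof
  have "t ^ k * t' = - e (int k + 1)" for k by (simp add: e_def)
  then have "t ^ k * t' \<in> mero.span (range e)" for k
    by (simp add: mero.span_neg mero.span_base)
  then show "K_space p \<subseteq> mero.span (range e)"
    unfolding K_space_eq by (intro mero.span_minimal mero.subspace_span) blast
next
  have "e k \<in> mero.span (range (\<lambda>k. t ^ k * t'))" for k
  proof (cases "k \<ge> 1")
    case True
    then obtain n where "k - 1 = int n" by (metis zero_le_imp_eq_int diff_ge_0_iff_ge)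
    then have "e k = - (t ^ n * t')" using True by (simp add: e_def)
    then show ?thesis by (simp add: mero.span_neg mero.span_base)
  qed (simp add: e_def mero.span_zero)
  then show "mero.span (range e) \<subseteq> K_space p"
    unfolding K_space_eq by (intro mero.span_minimal mero.subspace_span) blast
qed

lemma subspace_K_space: "mero.subspace (K_space p)"
  unfolding K_space_eq_e by (rule mero.subspace_span)

lemma e_in_K_space: "e k \<in> K_space p"
  unfolding K_space_eq_e by (intro mero.span_base rangeI)

lemma K_space_induct [consumes 1, case_names zero step]:
  assumes "\<alpha> \<in> K_space p" "P 0"
    and "\<And>a k \<beta>. k \<ge> 1 \<Longrightarrow> \<beta> \<in> K_space p \<Longrightarrow> P \<beta> \<Longrightarrow> P (mero_scale a (e k) + \<beta>)"
  shows "P \<alpha>"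
proof -
  have "\<alpha> \<in> mero.span (range e)" using assms(1) by (simp add: K_space_eq_e)
  then have "P \<alpha> \<and> \<alpha> \<in> K_space p"
  proof (induction rule: mero.span_induct_alt)
    case base
    then show ?case using assms(2) mero.subspace_0[OF subspace_K_space] by simp
  next
    case (step a x \<beta>)
    then obtain k where k: "x = e k" by blast
    have "P (mero_scale a (e k) + \<beta>)"
      using assms(3)[of k \<beta> a] step(2) by (cases "k \<ge> 1") (simp_all add: e_def)
    then show ?case using step(2) k
      by (simp add: mero.subspace_add mero.subspace_scale subspace_K_space e_in_K_space)
  qed
  then show ?thesis ..
qed

lemma has_val_inverse_t: "has_val (inverse t) p 0"
proof -
  have "inverse t = inverse (t / stdpole p) * inverse (stdpole p)" by (simp add: field_simps)
  moreover have "has_val (inverse (t / stdpole p) * inverse (stdpole p)) p (inverse c\<^sub>0 * 0)"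
    using c0_nz by (intro has_val_mult has_val_inverse has_val_t_div_stdpole has_val_inverse_stdpole)
  ultimately show ?thesis by simp
qed

lemma reg_powi: "k \<le> 0 \<Longrightarrow> reg (t powi k) p"
  using has_val_power[OF has_val_inverse_t, of "nat (- k)"]
  by (auto simp: power_int_def)

lemma coef_regular:
  assumes "form_regular_at \<alpha> p"
  shows "coef k \<alpha> = 0"
proof (cases "k \<ge> 1")
  case True
  have "reg (t powi (- k) * (\<alpha> * t\<^sup>2 / t')) p"
    using True assms by (intro reg_mult reg_powi) (simp_all add: form_regular_at_base)
  then have "form_regular_at (t powi (- k) * \<alpha>) p"
    unfolding form_regular_at_base by (simp only: mult.assoc times_divide_eq_right)
  then show ?thesis by (simp add: coef_def form_residue_regular_at)
qed (simp add: coef_def)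

text \<open>Every form is the sum of one in \<open>K_space p\<close>, a multiple of \<open>dt / t\<close> and one regular at \<open>p\<close>.\<close>

lemma form_decomposition:
  obtains \<gamma> a \<beta> where "\<gamma> \<in> K_space p" "form_regular_at \<beta> p"
    "\<alpha> = \<gamma> + mero_scale a (t' / t) + \<beta>"
proof -
  define h where "h = t' / t\<^sup>2"
  have h: "h \<noteq> 0" by (simp add: h_def)
  obtain q where q: "q \<in> mero.span (range (\<lambda>k. t ^ Suc k))" "reg (\<alpha> / h - q) p"
    using principal_part by blast
  have "q * h \<in> mero.span (range (\<lambda>k. t ^ Suc k * h))"
    using q(1) by (simp only: span_image_mult[OF h, symmetric])
  then have "\<exists>\<gamma> a. \<gamma> \<in> K_space p \<and> q * h = \<gamma> + mero_scale a (t' / t)"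
  proof (induction rule: mero.span_induct_alt)
    case base
    show ?case
      by (rule exI[of _ 0], rule exI[of _ 0]) (simp add: mero.subspace_0[OF subspace_K_space])
  next
    case (step c x y)
    then obtain \<gamma> a where y: "\<gamma> \<in> K_space p" "y = \<gamma> + mero_scale a (t' / t)" by blast
    obtain k where x: "x = t ^ Suc k * h" using step(1) by (elim imageE)
    show ?case
    proof (cases k)
      case 0
      then have "x = t' / t"
        by (simp add: x h_def power2_eq_square)
      then have "mero_scale c x + y = \<gamma> + mero_scale (c + a) (t' / t)"
        by (simp add: y mero.scale_left_distrib)
      with y(1) show ?thesis by (intro exI conjI)
    next
      case (Suc j)
      then have "x = t ^ j * t'" by (simp add: x h_def power2_eq_square)
      then have "x \<in> K_space p" unfolding K_space_eq by (intro mero.span_base image_eqI[of _ _ j]) simp_all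
      then have "mero_scale c x + \<gamma> \<in> K_space p"
        using y(1) by (simp add: mero.subspace_add mero.subspace_scale subspace_K_space)
      moreover have "mero_scale c x + y = (mero_scale c x + \<gamma>) + mero_scale a (t' / t)"
        by (simp add: y)
      ultimately show ?thesis by (intro exI conjI)
    qed
  qed
  then obtain \<gamma> a where *: "\<gamma> \<in> K_space p" "q * h = \<gamma> + mero_scale a (t' / t)" by blast
  define \<beta> where "\<beta> = \<alpha> - q * h"
  have "\<beta> * t\<^sup>2 / t' = \<beta> / h" by (simp add: h_def)
  also have "\<dots> = \<alpha> / h - q" using h by (simp add: \<beta>_def diff_divide_distrib)
  finally have "\<beta> * t\<^sup>2 / t' = \<alpha> / h - q" .
  then have "form_regular_at \<beta> p" using q(2) by (simp add: form_regular_at_base)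
  moreover have "\<alpha> = \<gamma> + mero_scale a (t' / t) + \<beta>"
    by (simp add: \<beta>_def *(2)[symmetric])
  ultimately show ?thesis by (rule that[OF *(1)])
qed

lemma finite_coef: "finite {k. coef k \<alpha> \<noteq> 0}"
proof -
  obtain \<gamma> a \<beta> where d: "\<gamma> \<in> K_space p" "form_regular_at \<beta> p"
    "\<alpha> = \<gamma> + mero_scale a (t' / t) + \<beta>"
    by (rule form_decomposition)
  have "coef k \<alpha> = coef k \<gamma>" for k
    using d(2) by (simp add: d(3) coef_add coef_scale coef_dlog coef_regular)
  moreover from d(1) have "finite {k. coef k \<gamma> \<noteq> 0}"
  proof (induction rule: K_space_induct)
    case (step a k \<beta>)
    have sub: "{j. coef j (mero_scale a (e k) + \<beta>) \<noteq> 0} \<subseteq> insert k {j. coef j \<beta> \<noteq> 0}"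
      by (auto simp: coef_add coef_scale coef_e)
    show ?case by (rule finite_subset[OF sub]) (simp add: step(3))
  qed simp
  ultimately show ?thesis by simp
qed

text \<open>The part of a form that lies in \<open>K_space p\<close>; \<open>Sum_any\<close> sums over the finite support.\<close>

definition proj :: "oneform \<Rightarrow> oneform" where
  "proj \<alpha> = Sum_any (\<lambda>k. mero_scale (coef k \<alpha>) (e k))"

lemma finite_coef_scale: "finite {k. mero_scale (coef k \<alpha>) (e k) \<noteq> 0}"
  by (rule finite_subset[OF _ finite_coef[of \<alpha>]]) auto

lemma proj_in_K_space: "proj \<alpha> \<in> K_space p"
  unfolding proj_def Sum_any.expand_set
  by (intro mero.subspace_sum mero.subspace_scale subspace_K_space e_in_K_space)

lemma proj_add: "proj (\<alpha> + \<beta>) = proj \<alpha> + proj \<beta>"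
  unfolding proj_def coef_add mero.scale_left_distrib
  by (intro Sum_any.distrib finite_coef_scale)

lemma proj_scale: "proj (mero_scale a \<alpha>) = mero_scale a (proj \<alpha>)"
proof -
  have "proj (mero_scale a \<alpha>) = Sum_any (\<lambda>k. mero_const a * mero_scale (coef k \<alpha>) (e k))"
    unfolding proj_def coef_scale by (simp add: mero_scale_def mero_const_mult mult.assoc)
  also have "\<dots> = mero_scale a (proj \<alpha>)"
    unfolding proj_def mero_scale_def[of a]
    by (rule Sum_any_right_distrib[symmetric]) (rule finite_coef_scale)
  finally show ?thesis .
qed

lemma proj_e: "k \<ge> 1 \<Longrightarrow> proj (e k) = e k"
  unfolding proj_def coef_e by (subst Sum_any.expand_superset[of "{k}"]) auto

lemma proj_K_space: "\<alpha> \<in> K_space p \<Longrightarrow> proj \<alpha> = \<alpha>"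
proof (induction rule: K_space_induct)
  case zero
  then show ?case by (simp add: proj_def)
next
  case (step a k \<beta>)
  then show ?case by (simp add: proj_add proj_scale proj_e)
qed

lemma proj_regular: "form_regular_at \<alpha> p \<Longrightarrow> proj \<alpha> = 0"
  by (simp add: proj_def coef_regular)

lemma K_space_second_kind: "\<alpha> \<in> K_space p \<Longrightarrow> \<alpha> \<in> second_kind"
proof (induction rule: K_space_induct)
  case zero
  then show ?case using exact_second_kind[of 0] by simp
next
  case (step a k \<beta>)
  have "t powi (k - 1) * t' \<in> second_kind"
    using exact_powi[of "k - 1"] step(1) exact_second_kind by simp
  then have "mero_scale (-1) (t powi (k - 1) * t') \<in> second_kind" by (rule second_kind_scale)
  moreover have "mero_scale (-1) (t powi (k - 1) * t') = e k"
    using step(1) by (simp add: e_def)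
  ultimately show ?case using step(3) by (simp only: second_kind_add second_kind_scale)
qed

lemma second_kind_decomposition:
  assumes "\<alpha> \<in> second_kind"
  obtains \<gamma> \<beta> where "\<gamma> \<in> K_space p" "\<beta> \<in> second_kind" "form_regular_at \<beta> p" "\<alpha> = \<gamma> + \<beta>"
proof -
  obtain \<gamma> a \<beta> where d: "\<gamma> \<in> K_space p" "form_regular_at \<beta> p"
    "\<alpha> = \<gamma> + mero_scale a (t' / t) + \<beta>"
    by (rule form_decomposition)
  have "form_residue p \<alpha> = 0" "form_residue p \<gamma> = 0"
    using assms K_space_second_kind[OF d(1)] by (simp_all add: second_kind_def)
  then have "a = 0"
    using d(2) by (simp add: d(3) form_residue_add form_residue_scale form_residue_dlog form_residue_regular_at)
  then have \<alpha>: "\<alpha> = \<gamma> + \<beta>" using d(3) by simp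
  have "\<beta> = \<alpha> + mero_scale (-1) \<gamma>" by (simp add: \<alpha>)
  then have "\<beta> \<in> second_kind"
    using assms K_space_second_kind[OF d(1)] second_kind_add second_kind_scale by metis
  then show ?thesis using d \<alpha> that by blast
qed

lemma second_kind_proj_eq: "\<alpha> \<in> second_kind \<Longrightarrow> second_kind_proj p \<alpha> = proj \<alpha>"
proof -
  let ?P = "\<lambda>\<alpha>. if \<alpha> \<in> second_kind then proj \<alpha> else 0"
  have "second_kind_proj p = ?P"
    unfolding second_kind_proj_def
  proof (rule the_equality, intro conjI)
    show "linear_between mero_scale mero_scale second_kind ?P"
      by (simp add: linear_between_def second_kind_add second_kind_scale proj_add proj_scale)
  next
    fix P
    assume P: "linear_between mero_scale mero_scale second_kind P \<and>
     (\<forall>\<eta>\<in>second_kind. \<eta> \<in> K_space p \<longrightarrow> P \<eta> = \<eta>) \<and>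
     (\<forall>\<eta>\<in>second_kind. form_regular_at \<eta> p \<longrightarrow> P \<eta> = 0) \<and>
     (\<forall>\<eta>. \<eta> \<notin> second_kind \<longrightarrow> P \<eta> = 0)"
    show "P = ?P"
    proof
      fix \<eta>
      show "P \<eta> = ?P \<eta>"
      proof (cases "\<eta> \<in> second_kind")
        case True
        then obtain \<gamma> \<beta> where d: "\<gamma> \<in> K_space p" "\<beta> \<in> second_kind" "form_regular_at \<beta> p" "\<eta> = \<gamma> + \<beta>"
          by (rule second_kind_decomposition)
        have "\<gamma> \<in> second_kind" using d(1) by (rule K_space_second_kind)
        then have "P \<eta> = \<gamma>" using P d by (simp add: linear_between_def)
        then show ?thesis using True d by (simp add: proj_add proj_K_space proj_regular)
      qed (use P in simp)
    qed
  qed (auto simp: proj_K_space proj_regular)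
  then show "\<alpha> \<in> second_kind \<Longrightarrow> second_kind_proj p \<alpha> = proj \<alpha>" by simp
qed

section \<open>The fields \<open>X\<^sub>n\<close> and their action on the basis\<close>

lemma X_field_eq: "X_field (inverse t) n = t powi (1 - n) / t'"
proof -
  have "mero_deriv (inverse t) = - (t' / t\<^sup>2)" by (rule mero_deriv_inverse)
  moreover have "inverse t powi (n + 1) = t powi (- n - 1)"
    using power_int_minus[of t "n + 1"] by (simp add: power_int_inverse)
  moreover have "t powi (- n - 1) * t\<^sup>2 = t powi (1 - n)"
    using power_int_add[of t "- n - 1" 2] by simp
  ultimately show ?thesis by (simp add: X_field_def)
qed

lemma proj_lie_deriv_e:
  assumes "k \<ge> 1"
  shows "proj (lie_deriv (X_field (inverse t) n) (e k)) = mero_scale (of_int (k - n)) (e (k - n))"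
proof -
  have "contract (X_field (inverse t) n) (e k) = - (t powi (1 - n) * t powi (k - 1))"
    using assms by (simp add: contract_def X_field_eq e_def)
  also have "t powi (1 - n) * t powi (k - 1) = t powi (k - n)"
    by (simp flip: power_int_add)
  finally have *: "lie_deriv (X_field (inverse t) n) (e k)
      = mero_scale (of_int (k - n)) (- (t powi (k - n - 1) * t'))"
    by (simp add: lie_deriv_def mero_deriv_uminus mero_deriv_powi mero_scale_of_int del: of_int_diff)
  consider "k - n \<ge> 1" | "k - n = 0" | "k - n \<le> -1" by linarith
  then show ?thesis
  proof cases
    case 1
    then have "- (t powi (k - n - 1) * t') = e (k - n)" by (simp add: e_def)
    then show ?thesis using proj_e[OF 1] by (simp only: * proj_scale)
  next
    case 2
    then show ?thesis by (simp only: * proj_scale) simp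
  next
    case 3
    have "- (t powi (k - n - 1) * t') * t\<^sup>2 / t' = - (t powi (k - n - 1) * t\<^sup>2)" by simp
    also have "t powi (k - n - 1) * t\<^sup>2 = t powi (k - n + 1)"
      using power_int_add[of t "k - n - 1" 2] by (simp add: add.commute)
    finally have "form_regular_at (- (t powi (k - n - 1) * t')) p"
      unfolding form_regular_at_base using reg_powi[of "k - n + 1"] 3 has_val_uminus by auto
    then show ?thesis using 3 by (simp only: * proj_scale proj_regular) (simp add: e_def)
  qed
qed

lemma residue_contract_e:
  assumes "j \<ge> 1" "k \<ge> 1"
  shows "form_residue p (contract (X_field (inverse t) n) (e j) * e k) = (if j + k = n then -1 else 0)"
proof -
  have "contract (X_field (inverse t) n) (e j) * e k = (t powi (1 - n) * t powi (j - 1) * t powi (k - 1)) * t'"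
    using assms by (simp add: contract_def X_field_eq e_def)
  also have "t powi (1 - n) * t powi (j - 1) * t powi (k - 1) = t powi (j + k - n - 1)"
    by (simp flip: power_int_add add: algebra_simps)
  finally show ?thesis by (simp add: form_residue_powi)
qed

end

section \<open>Derivations of the symmetric algebra\<close>

text \<open>The monomial given by a multiset of generators.\<close>

definition mono_sym :: "oneform multiset \<Rightarrow> sym" where
  "mono_sym M = prod_mset (image_mset sym_of M)"

lemma mono_sym_empty [simp]: "mono_sym {#} = 1"
  and mono_sym_add_mset [simp]: "mono_sym (add_mset \<alpha> M) = sym_of \<alpha> * mono_sym M"
  and mono_sym_union: "mono_sym (M + N) = mono_sym M * mono_sym N"
  by (simp_all add: mono_sym_def)

lemma sym_scale_mult_left: "sym_scale c x * y = sym_scale c (x * y)"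
  by (simp add: sym_scale_def mult.assoc)

lemma sym_scale_mult_right: "x * sym_scale c y = sym_scale c (x * y)"
  by (simp add: sym_scale_def mult.left_commute)

lemma sym_const_conv: "sym_const c = sym_scale c 1"
  by (simp add: sym_scale_def)

lemma abs_sym_add: "abs_sym (f + g) = abs_sym f + abs_sym g"
  by (simp add: plus_sym.abs_eq)

lemma abs_sym_mult: "abs_sym (f * g) = abs_sym f * abs_sym g"
  by (simp add: times_sym.abs_eq)

lemma abs_sym_single: "abs_sym (Poly_Mapping.single M c) = sym_scale c (mono_sym M)"
proof (induction M arbitrary: c)
  case empty
  then show ?case by (simp add: sym_scale_def sym_const.abs_eq)
next
  case (add \<alpha> M)
  have "Poly_Mapping.single (add_mset \<alpha> M) c = free_gen \<alpha> * Poly_Mapping.single M c"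
    by (simp add: free_gen_def mult_single)
  then show ?case
    using add by (simp add: abs_sym_mult sym_of.abs_eq sym_scale_mult_right)
qed

text \<open>The Leibniz rule on monomials, extended linearly to the polynomial algebra on all forms.\<close>

definition deriv_mono :: "(oneform \<Rightarrow> sym) \<Rightarrow> oneform multiset \<Rightarrow> sym" where
  "deriv_mono \<delta> M = (\<Sum>\<alpha>\<in>#M. mono_sym (M - {#\<alpha>#}) * \<delta> \<alpha>)"

definition deriv_free :: "(oneform \<Rightarrow> sym) \<Rightarrow> free_sym \<Rightarrow> sym" where
  "deriv_free \<delta> f =
     (\<Sum>M\<in>Poly_Mapping.keys f. sym_scale (Poly_Mapping.lookup f M) (deriv_mono \<delta> M))"

lemma deriv_mono_empty [simp]: "deriv_mono \<delta> {#} = 0"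
  by (simp add: deriv_mono_def)

lemma deriv_mono_add_mset:
  "deriv_mono \<delta> (add_mset \<alpha> M) = mono_sym M * \<delta> \<alpha> + sym_of \<alpha> * deriv_mono \<delta> M"
proof -
  have "(\<Sum>\<beta>\<in>#M. mono_sym (add_mset \<alpha> M - {#\<beta>#}) * \<delta> \<beta>)
      = (\<Sum>\<beta>\<in>#M. sym_of \<alpha> * (mono_sym (M - {#\<beta>#}) * \<delta> \<beta>))"
    by (rule arg_cong[of _ _ sum_mset], rule image_mset_cong)
      (simp add: mult.assoc)
  then show ?thesis by (simp add: deriv_mono_def sum_mset_distrib_left)
qed

lemma deriv_mono_union:
  "deriv_mono \<delta> (M + N) = mono_sym M * deriv_mono \<delta> N + mono_sym N * deriv_mono \<delta> M"
  by (induction M) (simp_all add: deriv_mono_add_mset mono_sym_union algebra_simps)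

lemma deriv_free_superset:
  assumes "finite A" "Poly_Mapping.keys f \<subseteq> A"
  shows "deriv_free \<delta> f = (\<Sum>M\<in>A. sym_scale (Poly_Mapping.lookup f M) (deriv_mono \<delta> M))"
  unfolding deriv_free_def using assms
  by (intro sum.mono_neutral_left) (auto simp: in_keys_iff)

lemma deriv_free_add: "deriv_free \<delta> (f + g) = deriv_free \<delta> f + deriv_free \<delta> g"
proof -
  define A where "A = Poly_Mapping.keys f \<union> Poly_Mapping.keys g"
  have A: "finite A" "Poly_Mapping.keys f \<subseteq> A" "Poly_Mapping.keys g \<subseteq> A"
    "Poly_Mapping.keys (f + g) \<subseteq> A"
    using Poly_Mapping.keys_add[of f g] by (auto simp: A_def)
  show ?thesis
    unfolding deriv_free_superset[OF A(1,2)] deriv_free_superset[OF A(1,3)]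
      deriv_free_superset[OF A(1,4)]
    by (simp add: lookup_add sym.scale_left_distrib sum.distrib)
qed

lemma deriv_free_single:
  "deriv_free \<delta> (Poly_Mapping.single M c) = sym_scale c (deriv_mono \<delta> M)"
  by (subst deriv_free_superset[of "{M}"]) (auto simp: keys_single)

lemma deriv_free_0 [simp]: "deriv_free \<delta> 0 = 0"
  by (simp add: deriv_free_def)

lemma deriv_free_uminus: "deriv_free \<delta> (- f) = - deriv_free \<delta> f"
  using deriv_free_add[of \<delta> f "- f"] by (simp add: eq_neg_iff_add_eq_0 add.commute)

lemma deriv_free_diff: "deriv_free \<delta> (f - g) = deriv_free \<delta> f - deriv_free \<delta> g"
  by (simp only: diff_conv_add_uminus deriv_free_add deriv_free_uminus)

lemma free_sym_induct [case_names single add]: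
  fixes f :: free_sym
  assumes "\<And>M c. P (Poly_Mapping.single M c)" "\<And>f g. P f \<Longrightarrow> P g \<Longrightarrow> P (f + g)"
  shows "P f"
proof -
  have "P (\<Sum>M\<in>A. Poly_Mapping.single M (Poly_Mapping.lookup f M))" if "finite A" for A
    using that
  proof (induction A)
    case empty
    then show ?case using assms(1)[of 0 0] by simp
  qed (simp add: assms)
  moreover have "f = (\<Sum>M\<in>Poly_Mapping.keys f. Poly_Mapping.single M (Poly_Mapping.lookup f M))"
    by (rule poly_mapping_eqI)
      (simp add: lookup_sum lookup_single when_def in_keys_iff)
  ultimately show ?thesis using finite_keys by metis
qed

lemma deriv_free_mult:
  "deriv_free \<delta> (f * g) = abs_sym f * deriv_free \<delta> g + abs_sym g * deriv_free \<delta> f"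
proof (induction f rule: free_sym_induct)
  case (single M a)
  show ?case
  proof (induction g rule: free_sym_induct)
    case (single N b)
    show ?case
      by (simp add: mult_single deriv_free_single abs_sym_single deriv_mono_union sym.scale_right_distrib
          sym_scale_mult_left sym_scale_mult_right mult.commute)
  next
    case (add g h)
    then show ?case by (simp add: distrib_left deriv_free_add abs_sym_add algebra_simps)
  qed
next
  case (add f g)
  then show ?case by (simp add: distrib_right deriv_free_add abs_sym_add algebra_simps)
qed

text \<open>Derivations of the algebra \<open>sym\<close> over the complex numbers.\<close>

definition is_derivation :: "(sym \<Rightarrow> sym) \<Rightarrow> bool" where
  "is_derivation D \<longleftrightarrow> (\<forall>x y. D (x + y) = D x + D y) \<and> (\<forall>c x. D (sym_scale c x) = sym_scale c (D x)) \<and>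
     (\<forall>x y. D (x * y) = x * D y + y * D x)"

text \<open>Linear maps from the space of all meromorphic forms to the symmetric algebra.\<close>

definition linear_form :: "(oneform \<Rightarrow> sym) \<Rightarrow> bool" where
  "linear_form \<delta> \<longleftrightarrow> (\<forall>\<alpha> \<beta>. \<delta> (\<alpha> + \<beta>) = \<delta> \<alpha> + \<delta> \<beta>) \<and> (\<forall>c \<alpha>. \<delta> (mero_scale c \<alpha>) = sym_scale c (\<delta> \<alpha>))"

text \<open>A derivation given by a linear map respects the relations, so it descends to the quotient.\<close>

lemma deriv_free_ideal:
  assumes "linear_form \<delta>" "f \<in> sym_ideal"
  shows "deriv_free \<delta> f = 0"
  using assms(2) unfolding sym_ideal_def
proof (induction rule: module.span_induct_alt[OF module_times, consumes 1])
  case 1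
  show ?case by simp
next
  case (2 c x y)
  have gen: "deriv_free \<delta> (free_gen \<alpha>) = \<delta> \<alpha>" for \<alpha>
    by (simp add: free_gen_def deriv_free_single deriv_mono_def)
  have "deriv_free \<delta> (Poly_Mapping.single 0 a * free_gen \<alpha>) = sym_scale a (\<delta> \<alpha>)" for a \<alpha>
    by (simp add: free_gen_def mult_single deriv_free_single deriv_mono_def)
  then have "deriv_free \<delta> x = 0"
    using 2(1) assms(1) by (auto simp: sym_relations_def linear_form_def deriv_free_diff gen)
  moreover have "sym_rel x 0"
    using 2(1) by (auto simp: sym_rel_def sym_ideal_def intro: module.span_base[OF module_times])
  then have "abs_sym x = 0" unfolding zero_sym_def by (simp add: sym.abs_eq_iff)
  ultimately show ?case using 2(2) by (simp add: deriv_free_add deriv_free_mult)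
qed

lemma ex_derivation:
  assumes "linear_form \<delta>"
  shows "\<exists>D. is_derivation D \<and> (\<forall>\<alpha>. D (sym_of \<alpha>) = \<delta> \<alpha>)"
proof -
  define D where "D = (\<lambda>w. deriv_free \<delta> (rep_sym w))"
  have D: "D (abs_sym f) = deriv_free \<delta> f" for f
  proof -
    have "sym_rel (rep_sym (abs_sym f)) f"
      using Quotient_rep_abs[OF Quotient_sym] equivp_reflp[OF equivp_sym_rel] by blast
    then have "deriv_free \<delta> (rep_sym (abs_sym f) - f) = 0"
      using deriv_free_ideal[OF assms] by (simp add: sym_rel_def)
    then show ?thesis by (simp add: D_def deriv_free_diff)
  qed
  have ex: "\<exists>f. w = abs_sym f" for w
    by (metis Quotient_abs_rep[OF Quotient_sym])
  have mult: "D (x * y) = x * D y + y * D x" for x y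
  proof -
    obtain f g where "x = abs_sym f" "y = abs_sym g" using ex by metis
    then show ?thesis by (simp add: D deriv_free_mult flip: abs_sym_mult)
  qed
  have "D (x + y) = D x + D y" for x y
  proof -
    obtain f g where "x = abs_sym f" "y = abs_sym g" using ex by metis
    then show ?thesis by (simp add: D deriv_free_add flip: abs_sym_add)
  qed
  moreover have "D (sym_const c) = 0" for c
    by (simp add: sym_const.abs_eq D deriv_free_single)
  then have "D (sym_scale c x) = sym_scale c (D x)" for c x
    by (simp add: sym_scale_def mult)
  moreover have "D (sym_of \<alpha>) = \<delta> \<alpha>" for \<alpha>
    by (simp add: sym_of.abs_eq D free_gen_def deriv_free_single deriv_mono_def)
  ultimately show ?thesis using mult unfolding is_derivation_def by blast
qed

text \<open>The derivation extending a linear map from forms to the symmetric algebra.\<close>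

definition derivation_of :: "(oneform \<Rightarrow> sym) \<Rightarrow> sym \<Rightarrow> sym" where
  "derivation_of \<delta> = (SOME D. is_derivation D \<and> (\<forall>\<alpha>. D (sym_of \<alpha>) = \<delta> \<alpha>))"

lemma derivation_of:
  assumes "linear_form \<delta>"
  shows "is_derivation (derivation_of \<delta>)" "derivation_of \<delta> (sym_of \<alpha>) = \<delta> \<alpha>"
  using someI_ex[OF ex_derivation[OF assms]] unfolding derivation_of_def by blast+

lemma derivation_add: "is_derivation D \<Longrightarrow> D (x + y) = D x + D y"
  and derivation_scale: "is_derivation D \<Longrightarrow> D (sym_scale c x) = sym_scale c (D x)"
  and derivation_mult: "is_derivation D \<Longrightarrow> D (x * y) = x * D y + y * D x"
  by (simp_all add: is_derivation_def)

lemma derivation_0: "is_derivation D \<Longrightarrow> D 0 = 0"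
  using derivation_add[of D 0 0] by simp

lemma derivation_1: "is_derivation D \<Longrightarrow> D 1 = 0"
  using derivation_mult[of D 1 1] by simp

lemma derivation_sum: "is_derivation D \<Longrightarrow> D (\<Sum>i\<in>I. f i) = (\<Sum>i\<in>I. D (f i))"
  by (induction I rule: infinite_finite_induct) (simp_all add: derivation_0 derivation_add)

lemma derivation_uminus: "is_derivation D \<Longrightarrow> D (- x) = - D x"
  using derivation_add[of D x "- x"] by (simp add: derivation_0 eq_neg_iff_add_eq_0 add.commute)

lemma sym_prod_Nil [simp]: "sym_prod [] = 1"
  and sym_prod_Cons [simp]: "sym_prod (\<alpha> # \<alpha>s) = sym_of \<alpha> * sym_prod \<alpha>s"
  by (simp_all add: sym_prod_def)

lemma derivation_sym_prod_update:
  assumes "is_derivation D" "\<And>\<alpha>. D (sym_of \<alpha>) = sym_of (\<phi> \<alpha>)"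
  shows "D (sym_prod \<alpha>s) = (\<Sum>i<length \<alpha>s. sym_prod (\<alpha>s[i := \<phi> (\<alpha>s ! i)]))"
proof (induction \<alpha>s)
  case Nil
  then show ?case by (simp add: derivation_1 assms(1))
next
  case (Cons \<alpha> \<alpha>s)
  show ?case
    by (simp add: derivation_mult[OF assms(1)] assms(2) Cons sum.lessThan_Suc_shift sum_distrib_left
        mult.commute add.commute del: sum.lessThan_Suc)
qed

lemma derivation_sym_prod_nths:
  assumes "is_derivation D" "\<And>\<alpha>. \<alpha> \<in> set \<alpha>s \<Longrightarrow> D (sym_of \<alpha>) = sym_const (b \<alpha>)"
  shows "D (sym_prod \<alpha>s) = (\<Sum>i<length \<alpha>s. sym_scale (b (\<alpha>s ! i)) (sym_prod (nths \<alpha>s (- {i}))))"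
  using assms(2)
proof (induction \<alpha>s)
  case Nil
  then show ?case by (simp add: derivation_1 assms(1))
next
  case (Cons \<alpha> \<alpha>s)
  have 0: "nths (\<alpha> # \<alpha>s) (- {0}) = \<alpha>s"
  proof -
    have "{j. Suc j \<in> - {0}} = UNIV" by auto
    then show ?thesis by (simp add: nths_Cons nths_all)
  qed
  have Suc: "nths (\<alpha> # \<alpha>s) (- {Suc i}) = \<alpha> # nths \<alpha>s (- {i})" for i
  proof -
    have "{j. Suc j \<in> - {Suc i}} = - {i}" by auto
    then show ?thesis by (simp add: nths_Cons)
  qed
  have "D (sym_prod (\<alpha> # \<alpha>s)) = sym_scale (b \<alpha>) (sym_prod \<alpha>s) + sym_of \<alpha> * D (sym_prod \<alpha>s)"
    using Cons.prems by (simp add: derivation_mult[OF assms(1)] sym_scale_def mult.commute add.commute)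
  also have "D (sym_prod \<alpha>s) = (\<Sum>i<length \<alpha>s. sym_scale (b (\<alpha>s ! i)) (sym_prod (nths \<alpha>s (- {i}))))"
    using Cons by simp
  finally show ?case
    by (simp add: sum.lessThan_Suc_shift 0 Suc sum_distrib_left sym_scale_mult_right
        del: sum.lessThan_Suc)
qed

text \<open>
  A sum over pairs of factors is a second order operator: its commutator with the multiplication by
  a form is the derivation given by the pairing with that form.
\<close>

lemma sym_prod_pairs:
  assumes T1: "T 1 = 0"
    and T: "\<And>\<alpha> w. \<alpha> \<in> K \<Longrightarrow> T (sym_of \<alpha> * w) = sym_of \<alpha> * T w + D \<alpha> w"
    and D: "\<And>\<alpha>. \<alpha> \<in> K \<Longrightarrow> is_derivation (D \<alpha>)"
      "\<And>\<alpha> \<beta>. \<alpha> \<in> K \<Longrightarrow> \<beta> \<in> K \<Longrightarrow> D \<alpha> (sym_of \<beta>) = sym_const (b \<alpha> \<beta>)"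
    and "set \<alpha>s \<subseteq> K"
  shows "T (sym_prod \<alpha>s) = (\<Sum>(i, j) \<in> {(i, j). i < j \<and> j < length \<alpha>s}.
     sym_scale (b (\<alpha>s ! i) (\<alpha>s ! j)) (sym_prod (nths \<alpha>s (- {i, j}))))"
  using assms(5)
proof (induction \<alpha>s)
  case Nil
  then show ?case by (simp add: T1)
next
  case (Cons \<alpha> \<alpha>s)
  let ?n = "length \<alpha>s"
  let ?P = "{(i, j). i < j \<and> j < ?n}"
  let ?f = "\<lambda>(i, j). sym_scale (b ((\<alpha> # \<alpha>s) ! i) ((\<alpha> # \<alpha>s) ! j)) (sym_prod (nths (\<alpha> # \<alpha>s) (- {i, j})))"
  have fin: "finite ?P" by (rule finite_subset[of _ "{..<?n} \<times> {..<?n}"]) auto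
  \<comment> \<open>The pairs that involve the new first factor are those with \<open>i = 0\<close>.\<close>
  have split: "{(i, j). i < j \<and> j < length (\<alpha> # \<alpha>s)}
      = (\<lambda>j. (0, Suc j)) ` {..<?n} \<union> (\<lambda>(i, j). (Suc i, Suc j)) ` ?P" (is "?L = ?A \<union> ?B")
  proof
    show "?L \<subseteq> ?A \<union> ?B"
    proof
      fix x assume "x \<in> ?L"
      then obtain i j where ij: "x = (i, j)" "i < j" "j < Suc ?n" by auto
      then obtain j' where "j = Suc j'" by (cases j) auto
      then show "x \<in> ?A \<union> ?B" using ij by (cases i) auto
    qed
  qed auto
  have shift: "sym_scale (b ((\<alpha> # \<alpha>s) ! Suc i) ((\<alpha> # \<alpha>s) ! Suc j))
      (sym_prod (nths (\<alpha> # \<alpha>s) (- {Suc i, Suc j}))) =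
      sym_of \<alpha> * sym_scale (b (\<alpha>s ! i) (\<alpha>s ! j)) (sym_prod (nths \<alpha>s (- {i, j})))" for i j
  proof -
    have "{k. Suc k \<in> - {Suc i, Suc j}} = - {i, j}" by auto
    then show ?thesis by (simp add: nths_Cons sym_scale_mult_right)
  qed
  have "sum ?f ?L = sum ?f ?A + sum ?f ?B"
    unfolding split by (rule sum.union_disjoint) (use fin in auto)
  also have "sum ?f ?A = (\<Sum>j<?n. ?f (0, Suc j))"
    by (subst sum.reindex) (auto simp: inj_on_def)
  also have "\<dots> = (\<Sum>j<?n. sym_scale (b \<alpha> (\<alpha>s ! j)) (sym_prod (nths \<alpha>s (- {j}))))"
  proof (rule sum.cong)
    fix j
    have "{i. Suc i \<in> - {0, Suc j}} = - {j}" by auto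
    then show "?f (0, Suc j) = sym_scale (b \<alpha> (\<alpha>s ! j)) (sym_prod (nths \<alpha>s (- {j})))"
      by (simp add: nths_Cons)
  qed simp
  also have "\<dots> = D \<alpha> (sym_prod \<alpha>s)"
    using Cons.prems by (subst derivation_sym_prod_nths[of "D \<alpha>" _ "b \<alpha>"]) (auto intro: D)
  also have "sum ?f ?B = (\<Sum>(i, j)\<in>?P. ?f (Suc i, Suc j))"
    by (subst sum.reindex) (auto simp: inj_on_def case_prod_unfold)
  also have "\<dots> = (\<Sum>(i, j)\<in>?P. sym_of \<alpha> *
      sym_scale (b (\<alpha>s ! i) (\<alpha>s ! j)) (sym_prod (nths \<alpha>s (- {i, j}))))"
    by (rule sum.cong[OF refl]) (simp only: case_prod_unfold fst_conv snd_conv shift)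
  also have "\<dots> = sym_of \<alpha> * T (sym_prod \<alpha>s)"
    using Cons by (simp add: sum_distrib_left case_prod_unfold)
  finally show ?case using Cons.prems by (simp add: T add.commute)
qed

section \<open>The subalgebra generated by the forms regular away from a point\<close>

lemma sym_prod_in_W: "set \<alpha>s \<subseteq> K_space p \<Longrightarrow> sym_prod \<alpha>s \<in> W_space p"
  unfolding W_space_def by (rule sym.span_base) blast

lemma W_space_0: "0 \<in> W_space p"
  and W_space_add: "x \<in> W_space p \<Longrightarrow> y \<in> W_space p \<Longrightarrow> x + y \<in> W_space p"
  and W_space_uminus: "x \<in> W_space p \<Longrightarrow> - x \<in> W_space p"
  and W_space_scale: "x \<in> W_space p \<Longrightarrow> sym_scale c x \<in> W_space p"
  and W_space_sum: "(\<And>i. i \<in> I \<Longrightarrow> f i \<in> W_space p) \<Longrightarrow> (\<Sum>i\<in>I. f i) \<in> W_space p"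
  unfolding W_space_def
  by (auto intro: sym.span_zero sym.span_add sym.span_neg sym.span_scale sym.span_sum)

lemma W_space_1: "1 \<in> W_space p"
  using sym_prod_in_W[of "[]"] by simp

lemma sym_of_in_W: "\<alpha> \<in> K_space p \<Longrightarrow> sym_of \<alpha> \<in> W_space p"
  using sym_prod_in_W[of "[\<alpha>]"] by simp

lemma W_space_induct [consumes 1, case_names zero step]:
  assumes "w \<in> W_space p" "P 0"
    and "\<And>c \<alpha>s w. set \<alpha>s \<subseteq> K_space p \<Longrightarrow> w \<in> W_space p \<Longrightarrow> P w \<Longrightarrow> P (sym_scale c (sym_prod \<alpha>s) + w)"
  shows "P w"
proof -
  have "w \<in> sym.span {sym_prod \<alpha>s | \<alpha>s. set \<alpha>s \<subseteq> K_space p}"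
    using assms(1) by (simp add: W_space_def)
  then have "P w \<and> w \<in> W_space p"
  proof (induction rule: sym.span_induct_alt)
    case base
    show ?case using assms(2) W_space_0 by simp
  next
    case (step c x y)
    then show ?case using assms(3) by (auto intro: W_space_add W_space_scale sym_prod_in_W)
  qed
  then show ?thesis ..
qed

lemma W_space_sym_of_mult:
  assumes "\<alpha> \<in> K_space p" "w \<in> W_space p"
  shows "sym_of \<alpha> * w \<in> W_space p"
  using assms(2)
proof (induction rule: W_space_induct)
  case (step c \<alpha>s w)
  have "sym_prod (\<alpha> # \<alpha>s) \<in> W_space p"
    using assms(1) step(1) by (intro sym_prod_in_W) simp
  then show ?case using step(3)
    by (simp add: distrib_left sym_scale_mult_right W_space_add W_space_scale)
qed (simp add: W_space_0)

lemma W_space_mult: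
  assumes "v \<in> W_space p" "w \<in> W_space p"
  shows "v * w \<in> W_space p"
  using assms(1)
proof (induction rule: W_space_induct)
  case (step c \<alpha>s v)
  have "sym_prod \<alpha>s * w \<in> W_space p"
    using step(1)
    by (induction \<alpha>s) (auto simp: assms(2) mult.assoc intro: W_space_sym_of_mult)
  then show ?case using step(3)
    by (simp add: distrib_right sym_scale_mult_left W_space_add W_space_scale)
qed (simp add: W_space_0)

lemma derivation_in_W:
  assumes "is_derivation D" "\<And>\<alpha>. \<alpha> \<in> K_space p \<Longrightarrow> D (sym_of \<alpha>) \<in> W_space p" "w \<in> W_space p"
  shows "D w \<in> W_space p"
  using assms(3)
proof (induction rule: W_space_induct)
  case (step c \<alpha>s w)
  have "D (sym_prod \<alpha>s) \<in> W_space p"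
    using step(1)
    by (induction \<alpha>s)
      (auto simp: derivation_1 derivation_mult assms(1)
        intro!: W_space_0 W_space_add W_space_mult assms(2) sym_of_in_W sym_prod_in_W)
  then show ?case using step(3)
    by (simp add: derivation_add derivation_scale assms(1) W_space_add W_space_scale)
qed (simp add: derivation_0 assms(1) W_space_0)

text \<open>A linear operator with the right values on products is the linear extension of these values.\<close>

lemma lin_ext_eq:
  assumes add: "\<And>x y. T (x + y) = T x + T y" and scale: "\<And>c x. T (sym_scale c x) = sym_scale c (T x)"
    and val: "\<And>\<alpha>s. set \<alpha>s \<subseteq> K_space p \<Longrightarrow> T (sym_prod \<alpha>s) = F \<alpha>s"
    and "w \<in> W_space p"
  shows "lin_ext p F w = T w"
proof -
  let ?T = "\<lambda>w. if w \<in> W_space p then T w else 0"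
  have "lin_ext p F = ?T"
    unfolding lin_ext_def
  proof (rule the_equality)
    show "linear_between sym_scale sym_scale (W_space p) ?T \<and>
      (\<forall>\<alpha>s. set \<alpha>s \<subseteq> K_space p \<longrightarrow> ?T (sym_prod \<alpha>s) = F \<alpha>s) \<and> (\<forall>w. w \<notin> W_space p \<longrightarrow> ?T w = 0)"
      by (auto simp: linear_between_def add scale val intro: W_space_add W_space_scale sym_prod_in_W)
  next
    fix S
    assume S: "linear_between sym_scale sym_scale (W_space p) S \<and>
      (\<forall>\<alpha>s. set \<alpha>s \<subseteq> K_space p \<longrightarrow> S (sym_prod \<alpha>s) = F \<alpha>s) \<and> (\<forall>w. w \<notin> W_space p \<longrightarrow> S w = 0)"
    have S_add: "S (x + y) = S x + S y" if "x \<in> W_space p" "y \<in> W_space p" for x y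
      using S that by (simp add: linear_between_def)
    have S_scale: "S (sym_scale c x) = sym_scale c (S x)" if "x \<in> W_space p" for c x
      using S that by (simp add: linear_between_def)
    have "S w = T w" if "w \<in> W_space p" for w
      using that
    proof (induction rule: W_space_induct)
      case zero
      show ?case using S_scale[OF W_space_0, of 0] scale[of 0 0] by simp
    next
      case (step c \<alpha>s w)
      then show ?case
        using S by (simp add: S_add S_scale W_space_scale sym_prod_in_W add scale val)
    qed
    then show "S = ?T" using S by auto
  qed
  then show ?thesis using assms(4) by simp
qed

section \<open>The operators as differential operators\<close>

lemma sym_scale_of_int: "sym_scale (of_int k) x = of_int k * x"
proof -
  have "sym_scale (of_nat n) x = of_nat n * x" for n x
    by (induction n) (simp_all add: sym.scale_left_distrib distrib_right)
  then show ?thesis by (cases k rule: int_cases2) simp_all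
qed

lemma derivation_of_int_mult: "is_derivation D \<Longrightarrow> D (of_int k * x) = of_int k * D x"
  using derivation_scale[of D "of_int k" x] by (simp add: sym_scale_of_int)

lemma sym_const_0 [simp]: "sym_const 0 = 0" and sym_const_1 [simp]: "sym_const 1 = 1"
  by (simp_all add: sym_const_conv)

lemma derivation_const: "is_derivation D \<Longrightarrow> D (sym_const c) = 0"
  by (simp add: sym_const_conv derivation_scale derivation_1)

lemma derivation_const_mult: "is_derivation D \<Longrightarrow> D (sym_const c * x) = sym_const c * D x"
  by (simp add: derivation_mult derivation_const)

lemma derivation_lincomb:
  assumes "\<And>i. i \<in> I \<Longrightarrow> is_derivation (D i)"
  shows "is_derivation (\<lambda>w. \<Sum>i\<in>I. c i * D i w)"
proof -
  have "(\<Sum>i\<in>I. c i * D i (x + y)) = (\<Sum>i\<in>I. c i * D i x + c i * D i y)" for x y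
    by (intro sum.cong) (simp_all add: assms derivation_add distrib_left)
  moreover have "(\<Sum>i\<in>I. c i * D i (sym_scale a x)) = (\<Sum>i\<in>I. sym_const a * (c i * D i x))" for a x
    by (intro sum.cong refl, simp only: derivation_scale[OF assms])
      (simp add: sym_scale_def mult.left_commute)
  moreover have "(\<Sum>i\<in>I. c i * D i (x * y)) = (\<Sum>i\<in>I. x * (c i * D i y) + y * (c i * D i x))" for x y
    by (intro sum.cong) (simp_all add: assms derivation_mult algebra_simps)
  ultimately show ?thesis
    unfolding is_derivation_def by (simp add: sum.distrib sum_distrib_left sym_scale_def)
qed

lemma derivation_commutator:
  assumes "is_derivation D" "is_derivation D'"
  shows "is_derivation (\<lambda>w. D (D' w) - D' (D w))"
  using assms unfolding is_derivation_def
  by (simp add: algebra_simps sym.scale_right_diff_distrib)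

lemma derivation_diff_op:
  "is_derivation D \<Longrightarrow> is_derivation D' \<Longrightarrow> is_derivation (\<lambda>w. D w - D' w)"
  unfolding is_derivation_def by (simp add: algebra_simps sym.scale_right_diff_distrib)

lemma derivation_mult_op: "is_derivation D \<Longrightarrow> is_derivation (\<lambda>w. a * D w)"
  unfolding is_derivation_def by (simp add: sym_scale_mult_right algebra_simps)

lemma sym_of_0 [simp]: "sym_of 0 = 0"
  using sym_of_scale[of 0 0] by simp

lemma sym_of_sum: "sym_of (\<Sum>i\<in>I. f i) = (\<Sum>i\<in>I. sym_of (f i))"
  by (induction I rule: infinite_finite_induct) (simp_all add: sym_of_add)

text \<open>The scalar \<open>1/2\<close> in the symmetric algebra; all other scalars needed in the computations are integers.\<close>

definition half :: sym where "half = sym_const (1/2)"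

lemma two_half: "half * 2 = 1" "half + half = 1"
proof -
  have "half + half = sym_scale (1/2 + 1/2) 1"
    unfolding half_def sym_const_conv sym.scale_left_distrib ..
  then show "half + half = 1" by simp
  then show "half * 2 = 1" by (simp add: mult_2_right)
qed

text \<open>Reversal of the summation over \<open>a + b = n\<close> with \<open>a, b \<ge> 1\<close>.\<close>

lemma sum_reflect: "(\<Sum>a\<in>{1..n - 1}. f (n - a)) = (\<Sum>a\<in>{1..n - 1}. f (a::int) :: 'b::comm_monoid_add)"
  by (rule sum.reindex_bij_witness[of _ "\<lambda>a. n - a" "\<lambda>a. n - a"]) auto

lemma sum_int_quadratic:
  "(\<Sum>i\<in>{1..int n - 1}. of_int i * (c - of_int i)) =
    c * (of_nat n * (of_nat n - 1)) / 2 - of_nat n * (of_nat n - 1) * (2 * of_nat n - 1) / (6::complex)"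
proof (induction n)
  case (Suc n)
  show ?case
  proof (cases n)
    case (Suc k)
    have "{1..int (Suc n) - 1} = insert (int n) {1..int n - 1}" using Suc by auto
    then have "(\<Sum>i\<in>{1..int (Suc n) - 1}. of_int i * (c - of_int i))
        = of_nat n * (c - of_nat n) + (\<Sum>i\<in>{1..int n - 1}. of_int i * (c - of_int i))"
      by simp
    then show ?thesis unfolding Suc.IH by (simp add: field_simps)
  qed simp
qed simp

lemma central_sum:
  "half * (\<Sum>i\<in>{1..l - 1}. of_int (i * (l - i))) =
    sym_const (if l \<ge> 0 then (of_int l ^ 3 - of_int l) / 12 else 0)"
proof (cases "l \<ge> 0")
  case False
  then show ?thesis by simp
next
  case True
  then obtain n where l: "l = int n" by (metis zero_le_imp_eq_int)
  have "half * (\<Sum>i\<in>{1..l - 1}. of_int (i * (l - i)))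
      = sym_const (1 / 2 * (\<Sum>i\<in>{1..l - 1}. of_int (i * (l - i))))"
    unfolding half_def sym_const_conv sym_scale_mult_left
    by (simp only: mult_1 sym_scale_of_int[of _ 1, symmetric, simplified] flip: sym.scale_scale sym.scale_sum_left)
  also have "(\<Sum>i\<in>{1..l - 1}. of_int (i * (l - i)) :: complex)
      = (\<Sum>i\<in>{1..int n - 1}. of_int i * (of_nat n - of_int i))"
    by (simp add: l)
  also have "1 / 2 * \<dots> = (of_int l ^ 3 - of_int l) / 12"
    unfolding sum_int_quadratic by (simp add: l field_simps power3_eq_cube)
  finally show ?thesis using True by simp
qed

lemma X_plus_eq:
  assumes "w \<in> W_space p"
  shows "X_plus p Y w = X_plus_vac p Y * w"
  unfolding X_plus_def
  by (rule lin_ext_eq[OF _ _ _ assms]) (simp_all add: distrib_left sym_scale_mult_right)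

context pole_coordinate
begin

abbreviation X :: "int \<Rightarrow> vfield" where "X n \<equiv> X_field (inverse t) n"

text \<open>The generators of the symmetric algebra of \<open>K_space p\<close>; \<open>E k = 0\<close> for \<open>k \<le> 0\<close>.\<close>

definition E :: "int \<Rightarrow> sym" where "E k = sym_of (e k)"

text \<open>
  On the subalgebra generated by the \<open>E k\<close>, the derivation \<open>pd k\<close> is the partial derivative with respect
  to \<open>E k\<close>; it is zero there for \<open>k \<le> 0\<close>.
\<close>

definition pd :: "int \<Rightarrow> sym \<Rightarrow> sym" where
  "pd k = derivation_of (\<lambda>\<alpha>. sym_const (coef k \<alpha>))"

text \<open>The derivation extending the Lie derivative along \<open>X\<^sub>n\<close> followed by projection.\<close>

definition D0 :: "int \<Rightarrow> sym \<Rightarrow> sym" where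
  "D0 n = derivation_of (\<lambda>\<alpha>. sym_of (proj (lie_deriv (X n) \<alpha>)))"

lemma E_nonpos: "k \<le> 0 \<Longrightarrow> E k = 0"
  by (simp add: E_def e_def)

lemma E_in_W: "E k \<in> W_space p"
  unfolding E_def by (intro sym_of_in_W e_in_K_space)

lemma W_induct [consumes 1, case_names one add scale mult]:
  assumes "w \<in> W_space p" and one: "P 1"
    and add: "\<And>x y. x \<in> W_space p \<Longrightarrow> y \<in> W_space p \<Longrightarrow> P x \<Longrightarrow> P y \<Longrightarrow> P (x + y)"
    and scale: "\<And>c x. x \<in> W_space p \<Longrightarrow> P x \<Longrightarrow> P (sym_scale c x)"
    and mult: "\<And>k x. k \<ge> 1 \<Longrightarrow> x \<in> W_space p \<Longrightarrow> P x \<Longrightarrow> P (E k * x)"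
  shows "P w"
proof -
  have zero: "P 0" using scale[OF W_space_1 one, of 0] by simp
  have sym_of: "P (sym_of \<alpha> * x)" if "\<alpha> \<in> K_space p" "x \<in> W_space p" "P x" for \<alpha> x
    using that(1)
  proof (induction rule: K_space_induct)
    case (step a k \<beta>)
    have "P (sym_scale a (E k * x))" "P (sym_of \<beta> * x)"
      using step that by (auto intro: scale mult W_space_mult E_in_W)
    moreover have "sym_of (mero_scale a (e k) + \<beta>) * x = sym_scale a (E k * x) + sym_of \<beta> * x"
      by (simp add: sym_of_add sym_of_scale E_def distrib_right sym_scale_mult_left)
    ultimately show ?case
      using step that by (auto intro!: add W_space_scale W_space_mult E_in_W sym_of_in_W)
  qed (simp add: zero)
  have prod: "P (sym_prod \<alpha>s)" if "set \<alpha>s \<subseteq> K_space p" for \<alpha>s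
    using that by (induction \<alpha>s) (auto simp: one intro!: sym_of sym_prod_in_W)
  show ?thesis
    using assms(1)
    by (induction rule: W_space_induct)
      (auto simp: zero intro!: add scale prod W_space_scale sym_prod_in_W)
qed

lemma derivation_eq_0_on_W:
  assumes "is_derivation D" "\<And>k. k \<ge> 1 \<Longrightarrow> D (E k) = 0" "w \<in> W_space p"
  shows "D w = 0"
  using assms(3)
  by (induction rule: W_induct)
    (simp_all add: assms derivation_1 derivation_add derivation_scale derivation_mult)

lemma pd: "is_derivation (pd k)" "pd k (sym_of \<alpha>) = sym_const (coef k \<alpha>)"
proof -
  have "linear_form (\<lambda>\<alpha>. sym_const (coef k \<alpha>))"
    by (simp add: linear_form_def coef_add coef_scale sym_const_conv sym.scale_left_distrib)
  then show "is_derivation (pd k)" "pd k (sym_of \<alpha>) = sym_const (coef k \<alpha>)"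
    unfolding pd_def by (rule derivation_of)+
qed

lemma pd_E: "pd k (E j) = (if k = j \<and> j \<ge> 1 then 1 else 0)"
  by (simp add: E_def pd(2) coef_e)

lemma pd_nonpos: "k \<le> 0 \<Longrightarrow> w \<in> W_space p \<Longrightarrow> pd k w = 0"
  by (rule derivation_eq_0_on_W[OF pd(1)]) (simp_all add: pd_E)

lemma pd_in_W: "w \<in> W_space p \<Longrightarrow> pd k w \<in> W_space p"
  by (rule derivation_in_W[OF pd(1)])
    (simp_all add: pd(2) sym_const_conv W_space_scale W_space_1)

lemma D0: "is_derivation (D0 n)" "D0 n (sym_of \<alpha>) = sym_of (proj (lie_deriv (X n) \<alpha>))"
proof -
  have "linear_form (\<lambda>\<alpha>. sym_of (proj (lie_deriv (X n) \<alpha>)))"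
    by (simp add: linear_form_def lie_deriv_add lie_deriv_scale proj_add proj_scale sym_of_add sym_of_scale)
  then show "is_derivation (D0 n)" "D0 n (sym_of \<alpha>) = sym_of (proj (lie_deriv (X n) \<alpha>))"
    unfolding D0_def by (rule derivation_of)+
qed

lemma D0_E: "k \<ge> 1 \<Longrightarrow> D0 n (E k) = of_int (k - n) * E (k - n)"
  unfolding E_def by (simp only: D0(2) proj_lie_deriv_e sym_of_scale sym_scale_of_int)

lemma D0_in_W: "w \<in> W_space p \<Longrightarrow> D0 n w \<in> W_space p"
  by (rule derivation_in_W[OF D0(1)]) (simp_all add: D0(2) sym_of_in_W proj_in_K_space)

text \<open>The contraction part of \<open>L\<^sub>n\<close>, as a differential operator of second order.\<close>

definition lowering :: "int \<Rightarrow> sym \<Rightarrow> sym" where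
  "lowering n w = - (half * (\<Sum>a\<in>{1..n - 1}. pd a (pd (n - a) w)))"

text \<open>The vacuum value of the multiplication part of \<open>L\<^sub>n\<close>; it is 0 unless \<open>n \<le> - 2\<close>.\<close>

definition raising :: "int \<Rightarrow> sym" where
  "raising n = - (half * (\<Sum>i\<in>{1..- n - 1}. of_int (i * (- n - i)) * (E i * E (- n - i))))"

text \<open>The operator \<open>L\<^sub>n\<close> in terms of the generators, defined on the whole of \<open>sym\<close>.\<close>

definition T :: "int \<Rightarrow> sym \<Rightarrow> sym" where
  "T n w = lowering n w + D0 n w + raising n * w"

lemma lowering_add: "lowering n (x + y) = lowering n x + lowering n y"
  by (simp add: lowering_def derivation_add[OF pd(1)] sum.distrib algebra_simps)

lemma lowering_scale: "lowering n (sym_scale c x) = sym_scale c (lowering n x)"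
  by (simp add: lowering_def derivation_scale[OF pd(1)] sym_scale_mult_right flip: sym.scale_sum_right)

lemma T_add: "T n (x + y) = T n x + T n y"
  by (simp add: T_def lowering_add derivation_add[OF D0(1)] algebra_simps)

lemma T_scale: "T n (sym_scale c x) = sym_scale c (T n x)"
  by (simp add: T_def lowering_scale derivation_scale[OF D0(1)] sym.scale_right_distrib sym_scale_mult_right)

lemma T_of_int_mult: "T n (of_int k * x) = of_int k * T n x"
  using T_scale[of n "of_int k" x] by (simp add: sym_scale_of_int)

lemma T_uminus: "T n (- x) = - T n x"
  using T_of_int_mult[of n "-1" x] by simp

lemma T_sum: "T n (\<Sum>i\<in>I. f i) = (\<Sum>i\<in>I. T n (f i))"
proof -
  have "T n 0 = 0" using T_of_int_mult[of n 0 0] by simp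
  then show ?thesis by (induction I rule: infinite_finite_induct) (simp_all add: T_add)
qed

text \<open>The commutator of \<open>lowering n\<close> with the multiplication by \<open>\<alpha>\<close>.\<close>

definition Dpair :: "int \<Rightarrow> oneform \<Rightarrow> sym \<Rightarrow> sym" where
  "Dpair n \<alpha> w = - (\<Sum>a\<in>{1..n - 1}. sym_const (coef a \<alpha>) * pd (n - a) w)"

lemma Dpair_derivation: "is_derivation (Dpair n \<alpha>)"
proof -
  have "Dpair n \<alpha> = (\<lambda>w. - 1 * (\<Sum>a\<in>{1..n - 1}. sym_const (coef a \<alpha>) * pd (n - a) w))"
    by (simp add: Dpair_def fun_eq_iff)
  then show ?thesis
    by (simp only:) (intro derivation_mult_op derivation_lincomb pd(1))
qed

lemma lowering_sym_of_mult: "lowering n (sym_of \<alpha> * w) = sym_of \<alpha> * lowering n w + Dpair n \<alpha> w"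
proof -
  have "pd a (pd (n - a) (sym_of \<alpha> * w)) = sym_of \<alpha> * pd a (pd (n - a) w) +
      sym_const (coef a \<alpha>) * pd (n - a) w + sym_const (coef (n - a) \<alpha>) * pd a w" for a
    by (simp add: derivation_mult[OF pd(1)] derivation_add[OF pd(1)] pd(2) derivation_const[OF pd(1)]
        mult.commute algebra_simps)
  then have "(\<Sum>a\<in>{1..n - 1}. pd a (pd (n - a) (sym_of \<alpha> * w)))
      = sym_of \<alpha> * (\<Sum>a\<in>{1..n - 1}. pd a (pd (n - a) w))
        + (\<Sum>a\<in>{1..n - 1}. sym_const (coef a \<alpha>) * pd (n - a) w)
        + (\<Sum>a\<in>{1..n - 1}. sym_const (coef (n - a) \<alpha>) * pd a w)"
    by (simp add: sum.distrib sum_distrib_left)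
  also have "(\<Sum>a\<in>{1..n - 1}. sym_const (coef (n - a) \<alpha>) * pd a w)
      = (\<Sum>a\<in>{1..n - 1}. sym_const (coef a \<alpha>) * pd (n - a) w)"
    using sum_reflect[of "\<lambda>a. sym_const (coef a \<alpha>) * pd (n - a) w" n] by simp
  also have "sym_of \<alpha> * (\<Sum>a\<in>{1..n - 1}. pd a (pd (n - a) w))
        + (\<Sum>a\<in>{1..n - 1}. sym_const (coef a \<alpha>) * pd (n - a) w)
        + (\<Sum>a\<in>{1..n - 1}. sym_const (coef a \<alpha>) * pd (n - a) w)
      = sym_of \<alpha> * (\<Sum>a\<in>{1..n - 1}. pd a (pd (n - a) w)) - 2 * Dpair n \<alpha> w"
    by (simp add: Dpair_def)
  finally show ?thesis
    using two_half by (simp add: lowering_def right_diff_distrib mult.left_commute flip: mult.assoc)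
qed

lemma residue_pairing_e:
  assumes "j \<ge> 1" "\<beta> \<in> K_space p"
  shows "form_residue p (contract (X n) (e j) * \<beta>) = - coef (n - j) \<beta>"
  using assms(2)
proof (induction rule: K_space_induct)
  case (step a k \<beta>)
  have "contract (X n) (e j) * (mero_scale a (e k) + \<beta>)
      = mero_scale a (contract (X n) (e j) * e k) + contract (X n) (e j) * \<beta>"
    by (simp add: mero_scale_def algebra_simps)
  then show ?case
    using step assms(1)
    by (auto simp: form_residue_add form_residue_scale residue_contract_e coef_add coef_scale coef_e)
qed simp

text \<open>The pairing \<open>Res\<^sub>p ((i\<^sub>X \<alpha>) \<beta>)\<close> along \<open>X\<^sub>n\<close>, in coordinates.\<close>

lemma residue_pairing:
  assumes "\<alpha> \<in> K_space p" "\<beta> \<in> K_space p"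
  shows "form_residue p (contract (X n) \<alpha> * \<beta>) = - (\<Sum>a\<in>{1..n - 1}. coef a \<alpha> * coef (n - a) \<beta>)"
  using assms(1)
proof (induction rule: K_space_induct)
  case zero
  then show ?case by (simp add: contract_def)
next
  case (step c j \<alpha>)
  have "contract (X n) (mero_scale c (e j) + \<alpha>) * \<beta>
      = mero_scale c (contract (X n) (e j) * \<beta>) + contract (X n) \<alpha> * \<beta>"
    by (simp add: mero_scale_def contract_def algebra_simps)
  moreover have "(\<Sum>a\<in>{1..n - 1}. coef a (mero_scale c (e j) + \<alpha>) * coef (n - a) \<beta>)
      = (\<Sum>a\<in>{1..n - 1}. if a = j then c * coef (n - j) \<beta> else 0)
        + (\<Sum>a\<in>{1..n - 1}. coef a \<alpha> * coef (n - a) \<beta>)"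
    unfolding sum.distrib[symmetric] using step(1)
    by (intro sum.cong) (auto simp: coef_add coef_scale coef_e algebra_simps)
  moreover have "(\<Sum>a\<in>{1..n - 1}. if a = j then c * coef (n - j) \<beta> else 0) = c * coef (n - j) \<beta>"
    using step(1) by (auto simp: sum.delta coef_def)
  ultimately show ?case
    using step by (simp add: form_residue_add form_residue_scale residue_pairing_e assms(2))
qed

lemma Dpair_sym_of:
  assumes "\<alpha> \<in> K_space p" "\<beta> \<in> K_space p"
  shows "Dpair n \<alpha> (sym_of \<beta>) = sym_const (form_residue p (contract (X n) \<alpha> * \<beta>))"
proof -
  have "sym_const (- (\<Sum>a\<in>A. f a * g a)) = - (\<Sum>a\<in>A. sym_const (f a) * sym_const (g a))"
    for A :: "int set" and f g
    by (simp add: sym_const_conv sym.scale_sum_left sym_scale_mult_left)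
  then show ?thesis unfolding residue_pairing[OF assms] by (simp add: Dpair_def pd(2))
qed

lemma X_minus_eq:
  assumes "w \<in> W_space p"
  shows "X_minus p (X n) w = lowering n w"
  unfolding X_minus_def
proof (rule lin_ext_eq[OF lowering_add lowering_scale _ assms])
  fix \<alpha>s assume "set \<alpha>s \<subseteq> K_space p"
  then show "lowering n (sym_prod \<alpha>s) = (\<Sum>(i, j)\<in>{(i, j). i < j \<and> j < length \<alpha>s}.
      sym_scale (form_residue p (contract (X n) (\<alpha>s ! i) * \<alpha>s ! j)) (sym_prod (nths \<alpha>s (- {i, j}))))"
    by (intro sym_prod_pairs[where D = "Dpair n" and K = "K_space p"
          and b = "\<lambda>\<alpha> \<beta>. form_residue p (contract (X n) \<alpha> * \<beta>)"])
      (simp_all add: lowering_sym_of_mult Dpair_derivation Dpair_sym_of, simp add: lowering_def derivation_1[OF pd(1)] derivation_0[OF pd(1)])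
qed

lemma X_zero_eq:
  assumes "w \<in> W_space p"
  shows "X_zero p (X n) w = D0 n w"
  unfolding X_zero_def second_kind_proj_eq[OF lie_deriv_second_kind]
  by (rule lin_ext_eq[OF derivation_add[OF D0(1)] derivation_scale[OF D0(1)] _ assms],
      rule derivation_sym_prod_update[OF D0(1) D0(2)])

section \<open>Commutators with generators\<close>

text \<open>
  The Heisenberg operators: on \<open>W_space p\<close>, \<open>A j\<close> is the multiplication by \<open>j E j\<close> for \<open>j > 0\<close> and
  \<open>- pd (- j)\<close> for \<open>j < 0\<close>, because the other term vanishes.
\<close>

definition A :: "int \<Rightarrow> sym \<Rightarrow> sym" where
  "A j w = of_int j * (E j * w) - pd (- j) w"

lemma raising_in_W: "raising n \<in> W_space p"
  unfolding raising_def half_def sym_scale_of_int[symmetric] sym_scale_def[symmetric]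
  by (intro W_space_uminus W_space_scale W_space_sum W_space_mult E_in_W)

lemma lowering_in_W: "w \<in> W_space p \<Longrightarrow> lowering n w \<in> W_space p"
  unfolding lowering_def half_def sym_scale_def[symmetric]
  by (intro W_space_uminus W_space_scale W_space_sum pd_in_W)

lemma T_in_W: "w \<in> W_space p \<Longrightarrow> T n w \<in> W_space p"
  unfolding T_def by (intro W_space_add lowering_in_W D0_in_W W_space_mult raising_in_W)

lemma T_E_mult:
  assumes "k \<ge> 1" "w \<in> W_space p"
  shows "T n (E k * w) = E k * T n w + A (k - n) w"
proof -
  have "Dpair n (e k) w = - (\<Sum>a\<in>{1..n - 1}. if a = k then pd (n - k) w else 0)"
    unfolding Dpair_def using assms(1)
    by (intro arg_cong[of _ _ uminus] sum.cong) (auto simp: coef_e)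
  also have "\<dots> = - pd (n - k) w"
    using assms pd_nonpos[of "n - k" w] by (auto simp: sum.delta)
  finally have 1: "lowering n (E k * w) = E k * lowering n w - pd (n - k) w"
    by (simp add: E_def lowering_sym_of_mult)
  have 2: "D0 n (E k * w) = E k * D0 n w + of_int (k - n) * (E (k - n) * w)"
    using assms(1) by (simp add: derivation_mult[OF D0(1)] D0_E mult_ac)
  show ?thesis unfolding T_def A_def 1 2 by (simp add: algebra_simps)
qed

lemma pd_commute: "w \<in> W_space p \<Longrightarrow> pd j (pd k w) = pd k (pd j w)"
  using derivation_eq_0_on_W[OF derivation_commutator[OF pd(1)[of j] pd(1)[of k]], of w]
  by (simp add: pd_E derivation_0[OF pd(1)] derivation_1[OF pd(1)] if_distrib[of "pd _"] cong: if_cong)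

lemma D0_pd:
  assumes "k \<ge> 1" "w \<in> W_space p"
  shows "D0 n (pd k w) = pd k (D0 n w) - of_int k * pd (k + n) w"
proof -
  let ?D = "\<lambda>w. (D0 n (pd k w) - pd k (D0 n w)) - (- of_int k) * pd (k + n) w"
  have "is_derivation ?D"
    by (intro derivation_diff_op derivation_commutator derivation_mult_op D0 pd)
  moreover have "?D (E j) = 0" if "j \<ge> 1" for j
    using that assms(1)
    by (auto simp: D0_E pd_E derivation_of_int_mult[OF pd(1)] derivation_0[OF D0(1)] derivation_1[OF D0(1)]
        simp del: of_int_diff)
  \<comment> \<open>Both sides are derivations, so it is enough to compare them on the generators.\<close>
  ultimately have "?D w = 0" using assms(2) by (rule derivation_eq_0_on_W)
  then show ?thesis by (simp add: algebra_simps)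
qed

lemma lowering_pd: "w \<in> W_space p \<Longrightarrow> lowering n (pd k w) = pd k (lowering n w)"
proof -
  assume w: "w \<in> W_space p"
  have "pd a (pd (n - a) (pd k w)) = pd k (pd a (pd (n - a) w))" for a
    using w by (simp add: pd_commute[of _ _ k] pd_in_W)
  then show "lowering n (pd k w) = pd k (lowering n w)"
    by (simp add: lowering_def half_def derivation_uminus[OF pd(1)] derivation_const_mult[OF pd(1)]
        derivation_sum[OF pd(1)])
qed

lemma pd_raising:
  assumes "k \<ge> 1"
  shows "pd k (raising n) = - (of_int (k * (- n - k)) * E (- n - k))"
proof -
  let ?I = "{1..- n - 1}"
  have "pd k (\<Sum>i\<in>?I. of_int (i * (- n - i)) * (E i * E (- n - i)))
      = (\<Sum>i\<in>?I. (if i = k then of_int (k * (- n - k)) * E (- n - k) else 0)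
          + (if i = - n - k then of_int (k * (- n - k)) * E (- n - k) else 0))"
    unfolding derivation_sum[OF pd(1)]
  proof (rule sum.cong[OF refl])
    fix i assume i: "i \<in> ?I"
    have mid: "k * 2 = - n \<Longrightarrow> E (- n - k) = E k" by (rule arg_cong[of _ _ E]) simp
    have "pd k (of_int (i * (- n - i)) * (E i * E (- n - i)))
      = of_int (i * (- n - i)) * (E i * pd k (E (- n - i)) + E (- n - i) * pd k (E i))"
      unfolding derivation_of_int_mult[OF pd(1)] by (simp only: derivation_mult[OF pd(1)])
    then show "pd k (of_int (i * (- n - i)) * (E i * E (- n - i)))
      = (if i = k then of_int (k * (- n - k)) * E (- n - k) else 0)
          + (if i = - n - k then of_int (k * (- n - k)) * E (- n - k) else 0)"
      using i mid by (auto simp: pd_E distrib_left mult.commute simp del: of_int_mult of_int_diff)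
  qed
  also have "\<dots> = of_int (k * (- n - k)) * E (- n - k) + of_int (k * (- n - k)) * E (- n - k)"
    using assms E_nonpos[of "- n - k"] by (auto simp: sum.distrib sum.delta simp del: of_int_mult)
  also have "\<dots> = 2 * (of_int (k * (- n - k)) * E (- n - k))" by simp
  finally show ?thesis
    using two_half(1) unfolding raising_def half_def
    by (simp only: derivation_uminus[OF pd(1)] derivation_const_mult[OF pd(1)] mult.assoc[symmetric]) simp
qed

lemma T_pd:
  assumes "k \<ge> 1" "w \<in> W_space p"
  shows "T n (pd k w) = pd k (T n w) + of_int k * A (- k - n) w"
proof -
  have raising: "pd k (raising n * w) = raising n * pd k w - of_int (k * (- n - k)) * (E (- n - k) * w)"
    by (simp only: derivation_mult[OF pd(1)] pd_raising[OF assms(1)]) (simp add: algebra_simps)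
  have eq: "- k - n = - n - k" by simp
  show ?thesis
    unfolding T_def A_def eq derivation_add[OF pd(1)] raising lowering_pd[OF assms(2)] D0_pd[OF assms]
    by (simp add: algebra_simps)
qed

text \<open>For positive and for negative \<open>j\<close> this is, up to a scalar, the commutator with \<open>E j\<close> and with \<open>pd (- j)\<close>.\<close>

lemma T_A:
  assumes "w \<in> W_space p"
  shows "T n (A j w) = A j (T n w) + of_int j * A (j - n) w"
proof -
  consider "j \<ge> 1" | "j = 0" | "- j \<ge> 1" by linarith
  then show ?thesis
  proof cases
    case 1
    then have "A j x = of_int j * (E j * x)" if "x \<in> W_space p" for x
      using that by (simp add: A_def pd_nonpos)
    then show ?thesis
      using 1 assms by (simp add: T_of_int_mult T_E_mult T_in_W distrib_left)
  next
    case 2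
    then have "A j x = 0" if "x \<in> W_space p" for x
      using that by (simp add: A_def pd_nonpos)
    then show ?thesis
      using 2 assms T_of_int_mult[of n 0 0] by (simp add: T_in_W)
  next
    case 3
    then have "A j x = - pd (- j) x" for x by (simp add: A_def E_nonpos)
    then show ?thesis
      using T_pd[OF 3 assms, of n] by (simp add: T_uminus)
  qed
qed

section \<open>The Virasoro relations\<close>

text \<open>The amount by which the Virasoro relation with central term \<open>c\<close> fails on \<open>w\<close>.\<close>

definition defect :: "int \<Rightarrow> int \<Rightarrow> complex \<Rightarrow> sym \<Rightarrow> sym" where
  "defect l m c w = T l (T m w) - T m (T l w) - (of_int (l - m) * T (l + m) w + sym_scale c w)"

text \<open>Jacobi identity: the products of \<open>A\<close> and \<open>T\<close> are symmetric in \<open>l\<close> and \<open>m\<close> and cancel.\<close>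

lemma defect_E_mult:
  assumes "k \<ge> 1" "w \<in> W_space p"
  shows "defect l m c (E k * w) = E k * defect l m c w"
proof -
  have *: "T l (T m (E k * w)) = E k * T l (T m w) + A (k - l) (T m w) + A (k - m) (T l w)
      + of_int (k - m) * A (k - l - m) w" for l m
  proof -
    have "k - m - l = k - l - m" by simp
    then show ?thesis using assms by (simp only: T_E_mult T_add T_A T_in_W) (simp only: add.assoc)
  qed
  have "T (l + m) (E k * w) = E k * T (l + m) w + A (k - l - m) w"
    using T_E_mult[OF assms, of "l + m"] by (simp add: diff_diff_eq)
  moreover have "k - m - l = k - l - m" by simp
  ultimately show ?thesis
    unfolding defect_def *[of l m] *[of m l] by (simp add: sym_scale_def algebra_simps)
qed

lemma defect_eq_0:
  assumes "defect l m c 1 = 0" "w \<in> W_space p"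
  shows "defect l m c w = 0"
  using assms(2)
proof (induction rule: W_induct)
  case (add x y)
  have "defect l m c (x + y) = defect l m c x + defect l m c y"
    by (simp add: defect_def T_add sym.scale_right_distrib algebra_simps)
  then show ?case using add by simp
next
  case (scale a x)
  have "defect l m c (sym_scale a x) = sym_scale a (defect l m c x)"
    unfolding defect_def T_scale by (simp add: sym_scale_def algebra_simps)
  then show ?case using scale by simp
qed (simp_all add: assms defect_E_mult)

lemma T_1: "T n 1 = raising n"
  by (simp add: T_def lowering_def derivation_1[OF pd(1)] derivation_0[OF pd(1)] derivation_1[OF D0(1)])

lemma A_1: "A j 1 = of_int j * E j"
  by (simp add: A_def derivation_1[OF pd(1)])

lemma A_E: "j \<ge> 1 \<Longrightarrow> A i (E j) = of_int i * (E i * E j) - (if i + j = 0 then 1 else 0)"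
  by (auto simp: A_def pd_E)

lemma T_E_E:
  assumes "i \<ge> 1" "j \<ge> 1"
  shows "T l (E i * E j) = E i * E j * raising l + of_int (j - l) * (E i * E (j - l))
    + of_int (i - l) * (E (i - l) * E j) - (if i + j = l then 1 else 0)"
proof -
  have "T l (E j) = E j * raising l + of_int (j - l) * E (j - l)"
    using T_E_mult[OF assms(2) W_space_1, of l] by (simp add: T_1 A_1)
  moreover have "T l (E i * E j) = E i * T l (E j) + A (i - l) (E j)"
    by (rule T_E_mult[OF assms(1) E_in_W])
  moreover have "i - l + j = 0 \<longleftrightarrow> i + j = l" by auto
  ultimately show ?thesis
    by (simp only: A_E[OF assms(2)]) (simp add: distrib_left mult.assoc mult.left_commute)
qed

text \<open>Up to sign, the part of \<open>T l (raising m)\<close> in which the index of one factor is shifted by \<open>l\<close>.\<close>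

definition G :: "int \<Rightarrow> int \<Rightarrow> sym" where
  "G l m = (\<Sum>i\<in>{1..- m - 1}. of_int (i * (- m - i) * (i - l)) * (E (i - l) * E (- m - i)))"

lemma T_raising:
  "T l (raising m) = raising l * raising m - G l m
    + (if l = - m then half * (\<Sum>i\<in>{1..l - 1}. of_int (i * (l - i))) else 0)"
proof -
  let ?I = "{1..- m - 1}"
  define c :: "int \<Rightarrow> sym" where "c = (\<lambda>i. of_int (i * (- m - i)))"
  define S where "S = (\<Sum>i\<in>?I. c i * (E i * E (- m - i)))"
  have "T l (raising m) = - (half * (\<Sum>i\<in>?I. c i * T l (E i * E (- m - i))))"
    unfolding raising_def c_def T_uminus half_def sym_scale_def[symmetric] T_scale T_sum T_of_int_mult ..
  also have "(\<Sum>i\<in>?I. c i * T l (E i * E (- m - i)))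
      = (\<Sum>i\<in>?I. c i * (E i * E (- m - i)) * raising l
          + of_int (i * (- m - i) * (- m - i - l)) * (E i * E (- m - i - l))
          + of_int (i * (- m - i) * (i - l)) * (E (i - l) * E (- m - i))
          - (if l = - m then of_int (i * (- m - i)) else 0))"
    by (rule sum.cong[OF refl]) (auto simp: T_E_E c_def algebra_simps)
  also have "\<dots> = S * raising l
      + (\<Sum>i\<in>?I. of_int (i * (- m - i) * (- m - i - l)) * (E i * E (- m - i - l))) + G l m
      - (if l = - m then (\<Sum>i\<in>?I. of_int (i * (- m - i))) else 0)"
    by (simp only: sum_subtractf sum.distrib S_def G_def sum_distrib_right) simp
  also have "(\<Sum>i\<in>?I. of_int (i * (- m - i) * (- m - i - l)) * (E i * E (- m - i - l))) = G l m"
    unfolding G_def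
    by (subst sum_reflect[symmetric]) (simp add: mult.commute mult.left_commute)
  also have "- (half * (S * raising l + G l m + G l m - (if l = - m then (\<Sum>i\<in>?I. of_int (i * (- m - i))) else 0)))
      = raising l * - (half * S) - half * 2 * G l m
        + half * (if l = - m then (\<Sum>i\<in>?I. of_int (i * (- m - i))) else 0)"
    by (simp add: algebra_simps)
  also have "- (half * S) = raising m" by (simp add: raising_def S_def c_def)
  finally show ?thesis by (auto simp: two_half)
qed

text \<open>
  In terms of the resulting indices. The weight \<open>max (j + l) 0\<close> makes the range of summation symmetric in
  \<open>l\<close> and \<open>m\<close>, whatever the signs are.
\<close>

lemma G_eq:
  "G l m = (\<Sum>j\<in>{1..- l - m - 1}. of_int (max (j + l) 0 * (j * (- l - m - j))) * (E j * E (- l - m - j)))"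
proof -
  have "G l m = (\<Sum>j\<in>{1 - l..- l - m - 1}. of_int ((j + l) * (j * (- l - m - j))) * (E j * E (- l - m - j)))"
    unfolding G_def
    by (rule sum.reindex_bij_witness[of _ "\<lambda>j. j + l" "\<lambda>i. i - l"]) (auto simp: algebra_simps)
  also have "\<dots> = (\<Sum>j\<in>{1..- l - m - 1}.
      of_int (max (j + l) 0 * (j * (- l - m - j))) * (E j * E (- l - m - j)))"
    by (rule sum.mono_neutral_cong) (auto simp: E_nonpos max_def split: if_splits)
  finally show ?thesis .
qed

lemma G_diff: "G l m - G m l = - (of_int (l - m) * raising (l + m))"
proof -
  define s where "s = - l - m"
  \<comment> \<open>Symmetrising under \<open>j \<mapsto> s - j\<close> turns the weight \<open>h\<close> into the constant \<open>(l - m) / 2\<close>.\<close>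
  define h where "h = (\<lambda>j. max (j + l) 0 - max (j + m) 0)"
  define B where "B = (\<lambda>j. of_int (j * (s - j)) * (E j * E (s - j)))"
  have s: "- m - l = s" "- (l + m) = s" by (simp_all add: s_def)
  have 1: "G l m - G m l = (\<Sum>j\<in>{1..s - 1}. of_int (h j) * B j)"
    unfolding G_eq s s_def[symmetric] sum_subtractf[symmetric]
    by (rule sum.cong) (simp_all add: h_def B_def algebra_simps)
  also have "\<dots> = (\<Sum>j\<in>{1..s - 1}. of_int (h (s - j)) * B (s - j))"
    by (rule sum_reflect[symmetric])
  also have "\<dots> = (\<Sum>j\<in>{1..s - 1}. of_int (h (s - j)) * B j)"
    by (simp add: B_def mult.commute)
  finally have "2 * (G l m - G m l) = (\<Sum>j\<in>{1..s - 1}. of_int (h j + h (s - j)) * B j)"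
    using 1 by (simp add: distrib_right sum.distrib)
  also have "\<dots> = (\<Sum>j\<in>{1..s - 1}. of_int (l - m) * B j)"
  proof (rule sum.cong[OF refl])
    fix j
    have "h j + h (s - j) = l - m" by (simp add: h_def s_def max_def)
    then show "of_int (h j + h (s - j)) * B j = of_int (l - m) * B j" by simp
  qed
  finally have "half * 2 * (G l m - G m l) = of_int (l - m) * (half * (\<Sum>j\<in>{1..s - 1}. B j))"
    by (simp only: mult.assoc sum_distrib_left[symmetric]) (simp add: mult.left_commute)
  moreover have "half * (\<Sum>j\<in>{1..s - 1}. B j) = - raising (l + m)"
    unfolding raising_def s by (simp add: B_def)
  ultimately show ?thesis by (simp add: two_half)
qed

lemma virasoro_relation:
  assumes "w \<in> W_space p"
  shows "T l (T m w) - T m (T l w) = of_int (l - m) * T (l + m) w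
    + sym_scale ((of_int l ^ 3 - of_int l) / 12 * (if l + m = 0 then 1 else 0)) w"
proof -
  let ?c = "(of_int l ^ 3 - of_int l) / 12 * (if l + m = 0 then 1 else 0) :: complex"
  let ?z = "\<lambda>l. half * (\<Sum>i\<in>{1..l - 1}. of_int (i * (l - i)))"
  have "(if l = - m then ?z l else 0) - (if m = - l then ?z m else 0) = sym_scale ?c 1"
  proof (cases "l + m = 0")
    case True
    then have "m = - l" by simp
    then show ?thesis unfolding central_sum
      by (auto simp: sym_const_conv diff_divide_distrib sym.scale_left_diff_distrib)
  next
    case False
    then have "l \<noteq> - m" "m \<noteq> - l" by auto
    then show ?thesis using False by simp
  qed
  moreover have "raising l * raising m - G l m + x - (raising m * raising l - G m l + y) = - (G l m - G m l) + (x - y)" for x y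
    by (simp add: algebra_simps)
  ultimately have "T l (raising m) - T m (raising l) = of_int (l - m) * raising (l + m) + sym_scale ?c 1"
    unfolding T_raising by (simp only: G_diff minus_minus)
  then have "defect l m ?c 1 = 0" by (simp add: defect_def T_1)
  then have "defect l m ?c w = 0" using assms by (rule defect_eq_0)
  then show ?thesis by (simp add: defect_def)
qed

end

section \<open>The bidifferential attached to a vector field\<close>

lemma reg_imp_has_val: "reg f (Pt z) \<Longrightarrow> has_val f (Pt z) (ev f z)"
  using ev_eq by blast

lemma reg_mero_deriv:
  assumes "reg f (Pt z)"
  shows "reg (mero_deriv f) (Pt z)"
proof -
  have "ev f analytic_on {z}" using assms by (simp add: reg_Pt_iff_analytic)
  then have "deriv (ev f) analytic_on {z}" by (rule analytic_deriv)
  then have "isCont (deriv (ev f)) z" by (rule analytic_at_imp_isCont)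
  then have lim: "(deriv (ev f) \<longlongrightarrow> deriv (ev f) z) (at z)" by (simp add: isCont_def)
  have eq: "eventually (\<lambda>w. ev (mero_deriv f) w = deriv (ev f) w) (at z)"
    using eventually_cosparse_imp_eventually_at[OF ev_deriv UNIV_I] .
  have "has_val (mero_deriv f) (Pt z) (deriv (ev f) z)"
    unfolding has_val_Pt_iff tendsto_cong[OF eq] by (rule lim)
  then show ?thesis by blast
qed

lemma ev_add_reg: "reg f (Pt z) \<Longrightarrow> reg g (Pt z) \<Longrightarrow> ev (f + g) z = ev f z + ev g z"
  by (rule ev_eq[OF has_val_add]) (simp_all add: reg_imp_has_val)

lemma ev_scale_reg: "reg f (Pt z) \<Longrightarrow> ev (mero_scale c f) z = c * ev f z"
  by (rule ev_eq[OF has_val_scale]) (simp add: reg_imp_has_val)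

text \<open>The expression of \<open>\<omega>\<^sub>X\<close> in the standard coordinate \<open>z\<close>, as coefficient of \<open>dz\<^sub>1 dz\<^sub>2\<close>.\<close>

definition omega_std :: "vfield \<Rightarrow> complex \<Rightarrow> complex \<Rightarrow> complex" where
  "omega_std X z1 z2 =
    (2 * (ev X z1 - ev X z2) - (ev (mero_deriv X) z1 + ev (mero_deriv X) z2) * (z1 - z2)) /
    (2 * (z1 - z2) ^ 3)"

lemma omega_std_add:
  assumes "reg X (Pt z1)" "reg X (Pt z2)" "reg Y (Pt z1)" "reg Y (Pt z2)"
  shows "omega_std (X + Y) z1 z2 = omega_std X z1 z2 + omega_std Y z1 z2"
  using assms
  by (simp add: omega_std_def mero_deriv_add ev_add_reg reg_mero_deriv add_divide_distrib[symmetric])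
    (simp add: algebra_simps)

lemma omega_std_scale:
  assumes "reg X (Pt z1)" "reg X (Pt z2)"
  shows "omega_std (mero_scale c X) z1 z2 = c * omega_std X z1 z2"
  using assms
  by (simp add: omega_std_def mero_deriv_scale ev_scale_reg reg_mero_deriv)
    (simp add: algebra_simps)

text \<open>Invariance of \<open>\<omega>\<^sub>X\<close> under a change of coordinate, as an identity of rational functions.\<close>

lemma moebius_identity:
  fixes c a1 a2 X1 X2 Y1 Y2 :: complex
  assumes "c \<noteq> 0" "a1 \<noteq> 0" "a2 \<noteq> 0" "a1 \<noteq> a2"
  shows "(2 * (- (c * X1 * (inverse a1)\<^sup>2) - - (c * X2 * (inverse a2)\<^sup>2))
        - ((Y1 - 2 * X1 * inverse a1) + (Y2 - 2 * X2 * inverse a2)) * (c * inverse a1 - c * inverse a2))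
      / (2 * (c * inverse a1 - c * inverse a2))
      * (- (c * (inverse a1)\<^sup>2) * - (c * (inverse a2)\<^sup>2) / (c * inverse a1 - c * inverse a2)\<^sup>2)
    = (2 * (X1 - X2) - (Y1 + Y2) * (a1 - a2)) / (2 * (a1 - a2) ^ 3)"
proof -
  define D where "D = a1 - a2"
  have D: "D \<noteq> 0" using assms by (simp add: D_def)
  have d: "c * inverse a1 - c * inverse a2 = - (c * D / (a1 * a2))"
    using assms by (simp add: D_def field_simps)
  have n: "2 * (- (c * X1 * (inverse a1)\<^sup>2) - - (c * X2 * (inverse a2)\<^sup>2))
        - ((Y1 - 2 * X1 * inverse a1) + (Y2 - 2 * X2 * inverse a2)) * (c * inverse a1 - c * inverse a2)
      = - (c * (2 * (X1 - X2) - (Y1 + Y2) * D) / (a1 * a2))"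
    using assms by (simp add: D_def divide_simps power2_eq_square) (simp add: algebra_simps)
  have "- (c * N / (a1 * a2)) / (2 * - (c * D / (a1 * a2)))
      * (- (c * (inverse a1)\<^sup>2) * - (c * (inverse a2)\<^sup>2) / (- (c * D / (a1 * a2)))\<^sup>2)
    = N / (2 * D ^ 3)" for N
    using assms D by (simp add: divide_simps power2_eq_square power3_eq_cube)
  then show ?thesis unfolding n unfolding d by (simp only: D_def)
qed

lemma omega_coeff_eq_std:
  assumes v: "v = mero_const c * stdpole r + mero_const d" "c \<noteq> 0"
    and z: "Pt z1 \<noteq> r" "Pt z2 \<noteq> r" "z1 \<noteq> z2"
    and X: "reg X (Pt z1)" "reg X (Pt z2)"
  shows "omega_coeff v X z1 z2 = omega_std X z1 z2"
proof (cases r)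
  case Infty
  have v': "mero_deriv v = mero_const c"
    by (simp add: v Infty mero_deriv_add mero_deriv_mult)
  have ev_v: "ev v z = c * z + d" for z
    unfolding v Infty stdpole.simps
    by (intro ev_eq has_val_add has_val_mult has_val_const has_val_zvar)
  have \<xi>: "ev (X * mero_deriv v) z = ev X z * c" if "reg X (Pt z)" for z
    unfolding v' by (intro ev_eq has_val_mult has_val_const reg_imp_has_val that)
  have "mero_deriv (X * mero_deriv v) / mero_deriv v = mero_deriv X"
    using v(2) by (simp add: v' mero_deriv_mult)
  then have "omega_coeff v X z1 z2 =
      (2 * (ev X z1 * c - ev X z2 * c)
        - (ev (mero_deriv X) z1 + ev (mero_deriv X) z2) * (c * z1 + d - (c * z2 + d)))
      / (2 * (c * z1 + d - (c * z2 + d))) * (c * c / (c * z1 + d - (c * z2 + d))\<^sup>2)"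
    unfolding omega_coeff_def Let_def by (simp only: \<xi>[OF X(1)] \<xi>[OF X(2)] ev_v) (simp only: v' ev_const)
  also have "c * z1 + d - (c * z2 + d) = c * (z1 - z2)" by (simp add: algebra_simps)
  also have "(2 * (ev X z1 * c - ev X z2 * c)
        - (ev (mero_deriv X) z1 + ev (mero_deriv X) z2) * (c * (z1 - z2)))
      = c * (2 * (ev X z1 - ev X z2) - (ev (mero_deriv X) z1 + ev (mero_deriv X) z2) * (z1 - z2))"
    by (simp add: algebra_simps)
  also have "\<And>N. c * N / (2 * (c * (z1 - z2))) * (c * c / (c * (z1 - z2))\<^sup>2) = N / (2 * (z1 - z2) ^ 3)"
    using v(2) z(3) by (simp add: divide_simps power2_eq_square power3_eq_cube)
  finally show ?thesis by (simp only: omega_std_def)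
next
  case (Pt a)
  define s where "s = stdpole r"
  have ds: "mero_deriv s = - (s\<^sup>2)"
    using mero_deriv_stdpole[of r] by (simp add: s_def Pt chart_factor_def del: stdpole.simps)
  have s_nz: "s \<noteq> 0" by (simp add: s_def)
  have v_s: "v = mero_const c * s + mero_const d" by (simp add: v s_def)
  have v': "mero_deriv v = - (mero_const c * s\<^sup>2)"
    by (simp add: v_s mero_deriv_add mero_deriv_mult ds)
  have s_val: "has_val s (Pt z) (inverse (z - a))" if "Pt z \<noteq> r" for z
    unfolding s_def Pt using that Pt by (intro has_val_stdpole_Pt) auto
  have ev_v: "ev v z = c * inverse (z - a) + d" if "Pt z \<noteq> r" for z
    unfolding v_s by (intro ev_eq has_val_add has_val_mult has_val_const s_val that)
  have ev_v': "ev (mero_deriv v) z = - (c * (inverse (z - a))\<^sup>2)" if "Pt z \<noteq> r" for z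
    unfolding v' by (intro ev_eq has_val_uminus has_val_power has_val_mult has_val_const s_val that)
  have \<xi>_eq: "X * mero_deriv v = - (mero_const c * X * s\<^sup>2)" by (simp add: v')
  have \<xi>: "ev (X * mero_deriv v) z = - (c * ev X z * (inverse (z - a))\<^sup>2)"
    if "reg X (Pt z)" "Pt z \<noteq> r" for z
    unfolding \<xi>_eq
    by (intro ev_eq has_val_uminus has_val_power has_val_mult has_val_const reg_imp_has_val s_val that)
  have "mero_deriv (X * mero_deriv v) = - (mero_const c * s\<^sup>2) * (mero_deriv X - 2 * X * s)"
    unfolding \<xi>_eq
    by (simp add: mero_deriv_uminus mero_deriv_mult power2_eq_square ds algebra_simps)
  then have \<xi>'_eq: "mero_deriv (X * mero_deriv v) / mero_deriv v = mero_deriv X - (1 + 1) * X * s"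
    using v(2) s_nz by (simp add: v')
  have \<xi>': "ev (mero_deriv (X * mero_deriv v) / mero_deriv v) z
      = ev (mero_deriv X) z - (1 + 1) * ev X z * inverse (z - a)"
    if "reg X (Pt z)" "Pt z \<noteq> r" for z
    unfolding \<xi>'_eq
    by (intro ev_eq has_val_diff has_val_mult has_val_add has_val_1 reg_imp_has_val reg_mero_deriv s_val that)
  have "c * inverse (z1 - a) + d - (c * inverse (z2 - a) + d) = c * inverse (z1 - a) - c * inverse (z2 - a)"
    by simp
  moreover have "z1 - a \<noteq> 0" "z2 - a \<noteq> 0" "z1 - a \<noteq> z2 - a" using z Pt by auto
  note moebius_identity[OF v(2) this]
  ultimately show ?thesis
    unfolding omega_coeff_def Let_def omega_std_def
    by (simp only: \<xi>[OF X(1) z(1)] \<xi>[OF X(2) z(2)] \<xi>'[OF X(1) z(1)] \<xi>'[OF X(2) z(2)]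
        ev_v[OF z(1)] ev_v[OF z(2)] ev_v'[OF z(1)] ev_v'[OF z(2)] one_add_one diff_diff_eq2 diff_add_cancel)
qed

lemma sum_list_upt_atMost: "(\<Sum>k\<leftarrow>[0..<n + 1]. f k) = (\<Sum>k\<le>n. f k)"
proof (induction n)
  case (Suc n)
  have "[0..<Suc n + 1] = [0..<n + 1] @ [Suc n]" by simp
  then show ?case by (simp only: map_append sum_list_append Suc.IH) simp
qed simp

lemma weighted_power_sum:
  fixes x y :: complex
  shows "(x - y)\<^sup>2 * (\<Sum>k\<le>n. of_nat (k + 1) * x ^ k * y ^ (n - k))
    = of_nat (n + 1) * x ^ (n + 2) - of_nat (n + 2) * x ^ (n + 1) * y + y ^ (n + 2)"
proof (induction n)
  case 0
  show ?case by (simp add: power2_eq_square algebra_simps)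
next
  case (Suc n)
  have "(\<Sum>k\<le>Suc n. of_nat (k + 1) * x ^ k * y ^ (Suc n - k))
      = y * (\<Sum>k\<le>n. of_nat (k + 1) * x ^ k * y ^ (n - k)) + of_nat (n + 2) * x ^ (n + 1)"
    by (simp add: sum_distrib_left Suc_diff_le mult_ac)
  then have "(x - y)\<^sup>2 * (\<Sum>k\<le>Suc n. of_nat (k + 1) * x ^ k * y ^ (Suc n - k))
      = y * ((x - y)\<^sup>2 * (\<Sum>k\<le>n. of_nat (k + 1) * x ^ k * y ^ (n - k)))
        + (x - y)\<^sup>2 * (of_nat (n + 2) * x ^ (n + 1))"
    by (simp add: algebra_simps)
  then show ?case unfolding Suc.IH by (simp add: power2_eq_square algebra_simps)
qed

text \<open>
  The right hand side is minus the numerator of \<open>\<omega>\<^sub>X\<close> in the coordinate \<open>t\<close>, for the vector field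
  \<open>t\<^sup>n\<^sup>+\<^sup>3 d/dt\<close> and with \<open>x\<close>, \<open>y\<close> for the two values of \<open>t\<close>. The sum is therefore its quotient by \<open>(x - y)\<^sup>3\<close>.
\<close>

lemma doubly_weighted_power_sum:
  fixes x y :: complex
  shows "(x - y) ^ 3 * (\<Sum>k\<le>n. of_nat ((k + 1) * (n + 1 - k)) * x ^ k * y ^ (n - k))
    = of_nat (n + 3) * (x ^ (n + 2) + y ^ (n + 2)) * (x - y) - 2 * (x ^ (n + 3) - y ^ (n + 3))"
proof (induction n)
  case 0
  show ?case by (simp add: power2_eq_square power3_eq_cube algebra_simps)
next
  case (Suc n)
  let ?S = "\<lambda>n. \<Sum>k\<le>n. of_nat ((k + 1) * (n + 1 - k)) * x ^ k * y ^ (n - k)"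
  let ?T = "\<lambda>n. \<Sum>k\<le>n. of_nat (k + 1) * x ^ k * y ^ (n - k)"
  have "?S (Suc n) = (\<Sum>k\<le>Suc n. of_nat ((k + 1) * (n + 1 - k)) * x ^ k * y ^ (Suc n - k)) + ?T (Suc n)"
    unfolding sum.distrib[symmetric]
    by (rule sum.cong) (auto simp: Suc_diff_le algebra_simps)
  also have "(\<Sum>k\<le>Suc n. of_nat ((k + 1) * (n + 1 - k)) * x ^ k * y ^ (Suc n - k))
      = (\<Sum>k\<le>n. of_nat ((k + 1) * (n + 1 - k)) * x ^ k * y ^ (Suc n - k))" by simp
  also have "\<dots> = y * ?S n"
    unfolding sum_distrib_left by (rule sum.cong[OF refl]) (simp add: Suc_diff_le)
  finally have step: "(x - y) ^ 3 * ?S (Suc n) = y * ((x - y) ^ 3 * ?S n) + (x - y) * ((x - y)\<^sup>2 * ?T (Suc n))"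
    by (simp only:) (simp add: power2_eq_square power3_eq_cube algebra_simps)
  show ?case unfolding step Suc.IH weighted_power_sum by (simp add: numeral_eq_Suc algebra_simps)
qed

lemma bidiff_append: "bidiff (ps @ qs) z1 z2 = bidiff ps z1 z2 + bidiff qs z1 z2"
  by (simp add: bidiff_def)

text \<open>The element of the symmetric algebra given by a sum of products of pairs.\<close>

definition sym_list :: "(oneform \<times> oneform) list \<Rightarrow> sym" where
  "sym_list ps = (\<Sum>(\<alpha>, \<beta>)\<leftarrow>ps. sym_of \<alpha> * sym_of \<beta>)"

lemma sym_list_append: "sym_list (ps @ qs) = sym_list ps + sym_list qs"
  by (simp add: sym_list_def)

lemma sym_list_scale:
  "sym_list (map (\<lambda>(\<alpha>, \<beta>). (mero_scale c \<alpha>, \<beta>)) ps) = sym_scale c (sym_list ps)"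
  by (induction ps) (auto simp: sym_list_def sym_of_scale sym_scale_mult_left sym.scale_right_distrib)

text \<open>
  The contraction of one factor of the symmetrised sum \<open>ps\<close> with a functional \<open>a\<close>. It serves to recover a
  symmetric tensor from its bidifferential.
\<close>

definition contract_list :: "(oneform \<Rightarrow> complex) \<Rightarrow> (oneform \<times> oneform) list \<Rightarrow> oneform" where
  "contract_list a ps = (\<Sum>(\<alpha>, \<beta>)\<leftarrow>ps. mero_scale (a \<beta> / 2) \<alpha> + mero_scale (a \<alpha> / 2) \<beta>)"

context pole_coordinate
begin

lemma K_space_reg: "\<alpha> \<in> K_space p \<Longrightarrow> Pt z \<noteq> p \<Longrightarrow> reg \<alpha> (Pt z)"
  using form_regular_at_iff[of \<alpha> "Pt z"] by (simp add: K_space_def chart_factor_def)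

lemma vfield_away_reg: "vfield_regular_away p Y \<Longrightarrow> Pt z \<noteq> p \<Longrightarrow> reg Y (Pt z)"
  using vfield_regular_at_iff[of Y "Pt z"] by (simp add: vfield_regular_away_def chart_factor_def)

lemma coordinate_t: "coordinate t" "has_pole_at t q \<longleftrightarrow> q = p"
proof -
  show pole: "has_pole_at t q \<longleftrightarrow> q = p" for q
    using reg_t[of q] not_reg_t by (auto simp: has_pole_at_iff)
  have "eventually (\<lambda>w. local_fun t p w = c\<^sub>0 * inverse w + d\<^sub>0) (at 0)"
    unfolding t_eq
    using local_add[of "mero_const c\<^sub>0 * stdpole p" "mero_const d\<^sub>0" p]
      local_mult[of "mero_const c\<^sub>0" "stdpole p" p] local_const[of c\<^sub>0 p] local_const[of d\<^sub>0 p]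
      local_stdpole[of p]
    by eventually_elim simp
  then obtain r where r: "r > 0"
    "\<And>w. w \<noteq> 0 \<Longrightarrow> dist w 0 < r \<Longrightarrow> local_fun t p w = c\<^sub>0 * inverse w + d\<^sub>0"
    unfolding eventually_at by blast
  have "zorder (local_fun t p) 0 = -1"
  proof (rule zorder_eqI[of "ball 0 r" 0 "\<lambda>w. c\<^sub>0 + d\<^sub>0 * w"])
    fix w :: complex assume "w \<in> ball 0 r" "w \<noteq> 0"
    then show "local_fun t p w = (c\<^sub>0 + d\<^sub>0 * w) * (w - 0) powi - 1"
      using r(2)[of w] by (simp add: dist_commute field_simps)
  qed (use r c0_nz in \<open>auto intro!: holomorphic_intros\<close>)
  then show "coordinate t" by (auto simp: coordinate_def pole)
qed

text \<open>
  \<open>represents Y ps\<close> says that the sum of products \<open>ps\<close> has the bidifferential \<open>\<omega>\<^sub>Y\<close> off the diagonal at the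
  finite points other than \<open>p\<close>. Only the standard coordinate is mentioned; \<open>represents_iff\<close> shows that this
  covers all coordinates.
\<close>

definition represents :: "vfield \<Rightarrow> (oneform \<times> oneform) list \<Rightarrow> bool" where
  "represents Y ps \<longleftrightarrow> set ps \<subseteq> K_space p \<times> K_space p \<and>
    (\<forall>z1 z2. z1 \<noteq> z2 \<longrightarrow> Pt z1 \<noteq> p \<longrightarrow> Pt z2 \<noteq> p \<longrightarrow> bidiff ps z1 z2 = omega_std Y z1 z2)"

lemma represents_iff:
  assumes "vfield_regular_away p Y"
  shows "represents Y ps \<longleftrightarrow> set ps \<subseteq> K_space p \<times> K_space p \<and>
     (\<forall>u. coordinate u \<longrightarrow>
       (\<forall>z1 z2. z1 \<noteq> z2 \<longrightarrow> Pt z1 \<noteq> p \<longrightarrow> Pt z2 \<noteq> p \<longrightarrow>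
          \<not> has_pole_at u (Pt z1) \<longrightarrow> \<not> has_pole_at u (Pt z2) \<longrightarrow>
          bidiff ps z1 z2 = omega_coeff u Y z1 z2))"
proof -
  have std: "omega_coeff u Y z1 z2 = omega_std Y z1 z2"
    if u: "coordinate u" and z: "z1 \<noteq> z2" "Pt z1 \<noteq> p" "Pt z2 \<noteq> p"
      "\<not> has_pole_at u (Pt z1)" "\<not> has_pole_at u (Pt z2)" for u z1 z2
  proof -
    obtain r c d where c: "c \<noteq> 0" and u': "u = mero_const c * stdpole r + mero_const d"
      and r: "\<And>q. has_pole_at u q \<longleftrightarrow> q = r"
      by (rule coordinate_imp_affine_stdpole[OF u]) blast
    show ?thesis
      using z r by (intro omega_coeff_eq_std[OF u' c] vfield_away_reg[OF assms]) auto
  qed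
  show ?thesis
  proof
    assume "represents Y ps"
    then show "set ps \<subseteq> K_space p \<times> K_space p \<and> (\<forall>u. coordinate u \<longrightarrow>
       (\<forall>z1 z2. z1 \<noteq> z2 \<longrightarrow> Pt z1 \<noteq> p \<longrightarrow> Pt z2 \<noteq> p \<longrightarrow>
          \<not> has_pole_at u (Pt z1) \<longrightarrow> \<not> has_pole_at u (Pt z2) \<longrightarrow>
          bidiff ps z1 z2 = omega_coeff u Y z1 z2))"
      unfolding represents_def by (simp add: std)
  next
    assume R: "set ps \<subseteq> K_space p \<times> K_space p \<and> (\<forall>u. coordinate u \<longrightarrow>
       (\<forall>z1 z2. z1 \<noteq> z2 \<longrightarrow> Pt z1 \<noteq> p \<longrightarrow> Pt z2 \<noteq> p \<longrightarrow>
          \<not> has_pole_at u (Pt z1) \<longrightarrow> \<not> has_pole_at u (Pt z2) \<longrightarrow>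
          bidiff ps z1 z2 = omega_coeff u Y z1 z2))"
    have "bidiff ps z1 z2 = omega_std Y z1 z2" if "z1 \<noteq> z2" "Pt z1 \<noteq> p" "Pt z2 \<noteq> p" for z1 z2
      using R that coordinate_t std[of t z1 z2] by simp
    then show "represents Y ps" using R unfolding represents_def by blast
  qed
qed

lemma sym_of_expand:
  assumes "\<alpha> \<in> K_space p" "finite F" "{k. coef k \<alpha> \<noteq> 0} \<subseteq> F"
  shows "sym_of \<alpha> = (\<Sum>k\<in>F. sym_scale (coef k \<alpha>) (E k))"
proof -
  have "\<alpha> = (\<Sum>k\<in>F. mero_scale (coef k \<alpha>) (e k))"
    using proj_K_space[OF assms(1)] assms(3) unfolding proj_def
    by (subst (asm) Sum_any.expand_superset[OF assms(2)]) auto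
  then have "sym_of \<alpha> = sym_of (\<Sum>k\<in>F. mero_scale (coef k \<alpha>) (e k))" by (rule arg_cong)
  then show ?thesis by (simp add: sym_of_sum sym_of_scale E_def)
qed

lemma contract_list_K_space:
  "set ps \<subseteq> K_space p \<times> K_space p \<Longrightarrow> contract_list a ps \<in> K_space p"
proof (induction ps)
  case Nil
  then show ?case by (simp add: contract_list_def mero.subspace_0 subspace_K_space)
next
  case (Cons q ps)
  then show ?case
    by (cases q) (simp add: contract_list_def mero.subspace_add mero.subspace_scale subspace_K_space)
qed

lemma ev_contract_list:
  assumes "set ps \<subseteq> K_space p \<times> K_space p" "Pt z \<noteq> p"
  shows "ev (contract_list a ps) z = (\<Sum>(\<alpha>, \<beta>)\<leftarrow>ps. (a \<beta> * ev \<alpha> z + a \<alpha> * ev \<beta> z) / 2)"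
  using assms(1)
proof (induction ps)
  case Nil
  then show ?case using ev_const[of 0 z] by (simp add: contract_list_def)
next
  case (Cons q ps)
  obtain \<alpha> \<beta> where q: "q = (\<alpha>, \<beta>)" by (cases q)
  have K: "\<alpha> \<in> K_space p" "\<beta> \<in> K_space p" "set ps \<subseteq> K_space p \<times> K_space p"
    using Cons.prems q by auto
  define \<gamma> where "\<gamma> = mero_scale (a \<beta> / 2) \<alpha> + mero_scale (a \<alpha> / 2) \<beta>"
  have "ev (\<gamma> + contract_list a ps) z = ev \<gamma> z + ev (contract_list a ps) z"
    using K assms(2) unfolding \<gamma>_def
    by (intro ev_add_reg K_space_reg contract_list_K_space mero.subspace_add mero.subspace_scale
        subspace_K_space)
  also have "ev \<gamma> z = a \<beta> / 2 * ev \<alpha> z + a \<alpha> / 2 * ev \<beta> z"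
    using K assms(2) unfolding \<gamma>_def
    by (subst ev_add_reg) (simp_all add: ev_scale_reg K_space_reg mero.subspace_scale subspace_K_space)
  also have "\<gamma> + contract_list a ps = contract_list a (q # ps)"
    by (simp add: contract_list_def q \<gamma>_def)
  finally show ?case using Cons.IH[OF K(3)] by (simp add: q add_divide_distrib)
qed

lemma coef_contract_list:
  "coef k (contract_list a ps) = (\<Sum>(\<alpha>, \<beta>)\<leftarrow>ps. (a \<beta> * coef k \<alpha> + a \<alpha> * coef k \<beta>) / 2)"
  by (induction ps) (auto simp: contract_list_def coef_add coef_scale add_divide_distrib)

lemma sym_list_eq:
  assumes "set ps \<subseteq> K_space p \<times> K_space p" "finite F"
    "\<And>\<alpha> \<beta>. (\<alpha>, \<beta>) \<in> set ps \<Longrightarrow> {k. coef k \<alpha> \<noteq> 0} \<union> {k. coef k \<beta> \<noteq> 0} \<subseteq> F"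
  shows "sym_list ps = (\<Sum>k\<in>F. E k * sym_of (contract_list (coef k) ps))"
  using assms(1,3)
proof (induction ps)
  case Nil
  then show ?case by (simp add: sym_list_def contract_list_def)
next
  case (Cons q ps)
  obtain \<alpha> \<beta> where q: "q = (\<alpha>, \<beta>)" by (cases q)
  have K: "\<alpha> \<in> K_space p" "\<beta> \<in> K_space p" using Cons.prems q by auto
  have F: "{k. coef k \<alpha> \<noteq> 0} \<subseteq> F" "{k. coef k \<beta> \<noteq> 0} \<subseteq> F" using Cons.prems(2)[of \<alpha> \<beta>] q by auto
  have h: "(\<Sum>k\<in>F. E k * sym_scale (coef k \<gamma> / 2) x) = half * (sym_of \<gamma> * x)"
    if "\<gamma> \<in> K_space p" "{k. coef k \<gamma> \<noteq> 0} \<subseteq> F" for \<gamma> x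
  proof -
    have "sym_scale (c / 2) x = half * sym_scale c x" for c x
      using sym.scale_scale[of "1/2" c x] by (simp add: half_def sym_scale_def)
    then show ?thesis
      unfolding sym_of_expand[OF that(1) assms(2) that(2)] sum_distrib_left sum_distrib_right
      by (intro sum.cong refl) (simp add: sym_scale_def mult_ac)
  qed
  have "sym_of (contract_list (coef k) (q # ps)) = sym_scale (coef k \<beta> / 2) (sym_of \<alpha>)
      + sym_scale (coef k \<alpha> / 2) (sym_of \<beta>) + sym_of (contract_list (coef k) ps)" for k
    by (simp add: contract_list_def q sym_of_add sym_of_scale)
  then have "(\<Sum>k\<in>F. E k * sym_of (contract_list (coef k) (q # ps)))
      = half * (sym_of \<beta> * sym_of \<alpha>) + half * (sym_of \<alpha> * sym_of \<beta>)
        + (\<Sum>k\<in>F. E k * sym_of (contract_list (coef k) ps))"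
    by (simp add: distrib_left sum.distrib h K F)
  also have "half * (sym_of \<beta> * sym_of \<alpha>) + half * (sym_of \<alpha> * sym_of \<beta>) = sym_of \<alpha> * sym_of \<beta>"
    using two_half(2) by (simp add: mult.commute flip: distrib_right)
  also have "(\<Sum>k\<in>F. E k * sym_of (contract_list (coef k) ps)) = sym_list ps"
    using Cons.prems by (intro Cons.IH[symmetric]) auto
  finally show ?case by (simp add: sym_list_def q)
qed

lemma sym_list_unique:
  assumes ps: "set ps \<subseteq> K_space p \<times> K_space p" "set qs \<subseteq> K_space p \<times> K_space p"
    and eq: "\<And>z1 z2. z1 \<noteq> z2 \<Longrightarrow> Pt z1 \<noteq> p \<Longrightarrow> Pt z2 \<noteq> p \<Longrightarrow> bidiff ps z1 z2 = bidiff qs z1 z2"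
  shows "sym_list ps = sym_list qs"
proof -
  have bidiff: "bidiff rs z1 z2 = ev (contract_list (\<lambda>\<alpha>. ev \<alpha> z2) rs) z1"
    if "set rs \<subseteq> K_space p \<times> K_space p" "Pt z1 \<noteq> p" for rs z1 z2
    unfolding ev_contract_list[OF that] bidiff_def by (simp add: mult.commute add.commute)
  \<comment> \<open>The first variable is removed by the identity principle, then the second one by applying \<open>coef k\<close>.\<close>
  have 1: "contract_list (\<lambda>\<alpha>. ev \<alpha> z2) ps = contract_list (\<lambda>\<alpha>. ev \<alpha> z2) qs" if "Pt z2 \<noteq> p" for z2
    by (rule mero_eqI_off[of p z2]) (use eq that bidiff ps in metis)
  have coef: "coef k (contract_list (\<lambda>\<alpha>. ev \<alpha> z) rs) = ev (contract_list (coef k) rs) z"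
    if "set rs \<subseteq> K_space p \<times> K_space p" "Pt z \<noteq> p" for rs z k
    unfolding ev_contract_list[OF that] coef_contract_list by (simp add: mult.commute add.commute)
  have 2: "contract_list (coef k) ps = contract_list (coef k) qs" for k
    by (rule mero_eqI_off[of p 0]) (use 1 coef ps in metis)
  define F where "F = (\<Union>(\<alpha>, \<beta>)\<in>set ps \<union> set qs. {k. coef k \<alpha> \<noteq> 0} \<union> {k. coef k \<beta> \<noteq> 0})"
  have "finite F" unfolding F_def by (auto simp: finite_coef)
  have "sym_list rs = (\<Sum>k\<in>F. E k * sym_of (contract_list (coef k) rs))" if "rs = ps \<or> rs = qs" for rs
    using that ps by (intro sym_list_eq \<open>finite F\<close>) (auto simp: F_def)
  then show ?thesis using 2 by simp
qed

lemma omega_form_eq: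
  assumes "vfield_regular_away p Y" "represents Y ps"
  shows "omega_form p Y = sym_list ps"
  unfolding omega_form_def
proof (rule the_equality)
  show "\<exists>qs. set qs \<subseteq> K_space p \<times> K_space p \<and>
     sym_list ps = (\<Sum>(\<alpha>, \<beta>)\<leftarrow>qs. sym_of \<alpha> * sym_of \<beta>) \<and>
     (\<forall>u. coordinate u \<longrightarrow>
       (\<forall>z1 z2. z1 \<noteq> z2 \<longrightarrow> Pt z1 \<noteq> p \<longrightarrow> Pt z2 \<noteq> p \<longrightarrow>
          \<not> has_pole_at u (Pt z1) \<longrightarrow> \<not> has_pole_at u (Pt z2) \<longrightarrow>
          bidiff qs z1 z2 = omega_coeff u Y z1 z2))"
    using assms(2)[unfolded represents_iff[OF assms(1)]]
    by (intro exI[of _ ps]) (simp add: sym_list_def)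
next
  fix s
  assume "\<exists>qs. set qs \<subseteq> K_space p \<times> K_space p \<and>
     s = (\<Sum>(\<alpha>, \<beta>)\<leftarrow>qs. sym_of \<alpha> * sym_of \<beta>) \<and>
     (\<forall>u. coordinate u \<longrightarrow>
       (\<forall>z1 z2. z1 \<noteq> z2 \<longrightarrow> Pt z1 \<noteq> p \<longrightarrow> Pt z2 \<noteq> p \<longrightarrow>
          \<not> has_pole_at u (Pt z1) \<longrightarrow> \<not> has_pole_at u (Pt z2) \<longrightarrow>
          bidiff qs z1 z2 = omega_coeff u Y z1 z2))"
  then obtain qs where qs: "represents Y qs" "s = sym_list qs"
    unfolding represents_iff[OF assms(1)] sym_list_def by blast
  show "s = sym_list ps"
    unfolding qs(2) by (rule sym_list_unique) (use qs(1) assms(2) in \<open>auto simp: represents_def\<close>)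
qed

lemma represents_add:
  assumes "vfield_regular_away p Y" "vfield_regular_away p Z" "represents Y ps" "represents Z qs"
  shows "represents (Y + Z) (ps @ qs)"
  using assms by (simp add: represents_def bidiff_append omega_std_add vfield_away_reg)

lemma represents_scale:
  assumes "vfield_regular_away p Y" "represents Y ps"
  shows "represents (mero_scale c Y) (map (\<lambda>(\<alpha>, \<beta>). (mero_scale c \<alpha>, \<beta>)) ps)"
proof -
  let ?c = "\<lambda>(\<alpha>, \<beta>). (mero_scale c \<alpha>, \<beta>)"
  have "bidiff (map ?c qs) z1 z2 = c * bidiff qs z1 z2"
    if "set qs \<subseteq> K_space p \<times> K_space p" "Pt z1 \<noteq> p" "Pt z2 \<noteq> p" for qs z1 z2
    using that
    by (induction qs) (auto simp: bidiff_def ev_scale_reg K_space_reg algebra_simps add_divide_distrib)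
  moreover have "set (map ?c ps) \<subseteq> K_space p \<times> K_space p"
    using assms(2) by (auto simp: represents_def mero.subspace_scale subspace_K_space)
  ultimately show ?thesis
    using assms by (simp add: represents_def omega_std_scale vfield_away_reg)
qed

lemma has_val_t: "Pt z \<noteq> p \<Longrightarrow> has_val t (Pt z) (ev t z)"
  using reg_t reg_imp_has_val by blast

lemma has_val_t': "Pt z \<noteq> p \<Longrightarrow> has_val t' (Pt z) (ev t' z)"
  using reg_t reg_imp_has_val reg_mero_deriv by blast

lemma monomial_field_away: "vfield_regular_away p (t ^ k / t')"
  unfolding vfield_regular_away_iff by (intro mero.span_base rangeI)

lemma omega_std_monomial:
  assumes z: "z1 \<noteq> z2" "Pt z1 \<noteq> p" "Pt z2 \<noteq> p"
  shows "omega_std (t ^ m / t') z1 z2 =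
    (2 * (ev t z1 ^ m - ev t z2 ^ m) -
      of_nat m * (ev t z1 ^ (m - 1) + ev t z2 ^ (m - 1)) * (ev t z1 - ev t z2)) /
    (2 * (ev t z1 - ev t z2) ^ 3) * (ev t' z1 * ev t' z2)"
proof -
  have "t ^ m / t' * t' = t ^ m" by simp
  moreover have "mero_deriv (t ^ m) / t' = mero_scale (of_nat m) (t ^ (m - 1))"
    using mero_scale_of_int[of "int m" "t ^ (m - 1)"] by (simp add: mero_deriv_power)
  moreover have "ev (t ^ m) z = ev t z ^ m" if "Pt z \<noteq> p" for z
    using that by (intro ev_eq has_val_power has_val_t)
  moreover have "ev (mero_scale (of_nat m) (t ^ (m - 1))) z = of_nat m * ev t z ^ (m - 1)" if "Pt z \<noteq> p" for z
    using that by (intro ev_eq has_val_scale has_val_power has_val_t)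
  moreover have "omega_std (t ^ m / t') z1 z2 = omega_coeff t (t ^ m / t') z1 z2"
    using z monomial_field_away
    by (intro omega_coeff_eq_std[OF t_eq c0_nz, symmetric]) (auto intro: vfield_away_reg)
  ultimately show ?thesis
    using z unfolding omega_coeff_def Let_def
    by (simp add: distrib_left power2_eq_square power3_eq_cube)
qed

lemma ev_t_inj:
  assumes "z1 \<noteq> z2" "Pt z1 \<noteq> p" "Pt z2 \<noteq> p"
  shows "ev t z1 \<noteq> ev t z2"
proof -
  have ev: "ev t z = c\<^sub>0 * x + d\<^sub>0" if "has_val (stdpole p) (Pt z) x" for x z
    unfolding t_eq using that by (intro ev_eq has_val_add has_val_mult has_val_const)
  show ?thesis
  proof (cases p)
    case Infty
    then show ?thesis using assms c0_nz ev[of _ z1] ev[of _ z2] has_val_zvar by simp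
  next
    case (Pt a)
    then have "ev t z1 = c\<^sub>0 * inverse (z1 - a) + d\<^sub>0" "ev t z2 = c\<^sub>0 * inverse (z2 - a) + d\<^sub>0"
      using assms by (auto simp del: stdpole.simps intro!: ev has_val_stdpole_Pt)
    then show ?thesis using assms Pt c0_nz by simp
  qed
qed

text \<open>
  The field \<open>t\<^sup>m d/dt\<close> is \<open>X\<^sub>1\<^sub>-\<^sub>m\<close>. For \<open>m \<le> 2\<close> it is regular on the whole line and the bidifferential vanishes.
\<close>

lemma represents_monomial: "\<exists>ps. represents (t ^ m / t') ps \<and> sym_list ps = raising (1 - int m)"
proof (cases "m \<ge> 3")
  case False
  then have "m = 0 \<or> m = 1 \<or> m = 2" by auto
  then have "omega_std (t ^ m / t') z1 z2 = 0" if "z1 \<noteq> z2" "Pt z1 \<noteq> p" "Pt z2 \<noteq> p" for z1 z2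
    unfolding omega_std_monomial[OF that] by (auto simp: power2_eq_square algebra_simps)
  then have "represents (t ^ m / t') []" by (simp add: represents_def bidiff_def)
  moreover have "raising (1 - int m) = 0" using False by (simp add: raising_def)
  ultimately show ?thesis by (intro exI[of _ "[]"]) (simp add: sym_list_def)
next
  case True
  then obtain n where m: "m = n + 3" by (metis le_add_diff_inverse2)
  define w where "w = (\<lambda>k. - of_nat ((k + 1) * (n + 1 - k)) / 2 :: complex)"
  have w_sym: "w (n - k) = w k" if "k \<le> n" for k
  proof -
    have "n + 1 - (n - k) = k + 1" "n - k + 1 = n + 1 - k" using that by simp_all
    then show ?thesis by (simp only: w_def mult.commute)
  qed
  define ps where "ps = map (\<lambda>k. (mero_scale (w k) (e (int k + 1)), e (int (n - k) + 1))) [0..<n + 1]"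
  have ev_e: "ev (e (int k + 1)) z = - (ev t z ^ k * ev t' z)" if "Pt z \<noteq> p" for k z
  proof -
    have "e (int k + 1) = - (t ^ k * t')" by (simp add: e_def)
    then show ?thesis
      using that by (simp only:) (intro ev_eq has_val_uminus has_val_mult has_val_power has_val_t has_val_t')
  qed
  have K: "set ps \<subseteq> K_space p \<times> K_space p"
    by (auto simp: ps_def intro: e_in_K_space mero.subspace_scale subspace_K_space)
  have "represents (t ^ m / t') ps"
    unfolding represents_def
  proof (intro conjI K allI impI)
    fix z1 z2 assume z: "z1 \<noteq> z2" "Pt z1 \<noteq> p" "Pt z2 \<noteq> p"
    define x y c where "x = ev t z1" "y = ev t z2" "c = ev t' z1 * ev t' z2"
    have xy: "x - y \<noteq> 0" using ev_t_inj[OF z] by (simp add: x_y_c_def)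
    define S where "S = (\<Sum>k\<le>n. of_nat ((k + 1) * (n + 1 - k)) * x ^ k * y ^ (n - k))"
    have "bidiff ps z1 z2 = (\<Sum>k\<leftarrow>[0..<n + 1]. w k * (x ^ k * y ^ (n - k) + x ^ (n - k) * y ^ k) / 2 * c)"
      unfolding bidiff_def ps_def map_map
      by (rule arg_cong[of _ _ sum_list], rule map_cong[OF refl])
        (simp add: ev_scale_reg K_space_reg e_in_K_space ev_e z x_y_c_def, simp add: algebra_simps)
    also have "\<dots> = (\<Sum>k\<le>n. w k * (x ^ k * y ^ (n - k) + x ^ (n - k) * y ^ k) / 2 * c)"
      by (rule sum_list_upt_atMost)
    also have "\<dots> = (\<Sum>k\<le>n. w k * x ^ k * y ^ (n - k)) * c / 2 + (\<Sum>k\<le>n. w k * x ^ (n - k) * y ^ k) * c / 2"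
      unfolding sum_distrib_right sum_divide_distrib sum.distrib[symmetric]
      by (rule sum.cong) (simp_all add: field_simps)
    also have "(\<Sum>k\<le>n. w k * x ^ (n - k) * y ^ k) = (\<Sum>k\<le>n. w k * x ^ k * y ^ (n - k))"
      by (rule sum.reindex_bij_witness[of _ "\<lambda>k. n - k" "\<lambda>k. n - k"])
        (simp_all add: w_sym mult.commute mult.left_commute)
    also have "(\<Sum>k\<le>n. w k * x ^ k * y ^ (n - k)) = - S / 2"
      unfolding S_def sum_negf[symmetric] sum_divide_distrib
      by (rule sum.cong) (simp_all add: w_def del: of_nat_mult of_nat_add of_nat_diff)
    also have "- S / 2 * c / 2 + - S / 2 * c / 2 = - ((x - y) ^ 3 * S) / (2 * (x - y) ^ 3) * c"
      using xy by (simp add: field_simps)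
    also have "\<dots> = omega_std (t ^ m / t') z1 z2"
      unfolding S_def doubly_weighted_power_sum omega_std_monomial[OF z]
      by (simp add: m x_y_c_def)
    finally show "bidiff ps z1 z2 = omega_std (t ^ m / t') z1 z2" .
  qed
  moreover have "sym_list ps = raising (1 - int m)"
  proof -
    define g where "g = (\<lambda>i. sym_scale (- of_int (i * (int m - 1 - i)) / 2) (E i * E (int m - 1 - i)))"
    have "sym_list ps = (\<Sum>k\<leftarrow>[0..<n + 1]. sym_scale (w k) (E (int k + 1) * E (int (n - k) + 1)))"
      unfolding sym_list_def ps_def map_map
      by (rule arg_cong[of _ _ sum_list], rule map_cong[OF refl])
        (simp add: sym_of_scale sym_scale_mult_left E_def)
    also have "\<dots> = (\<Sum>k\<le>n. sym_scale (w k) (E (int k + 1) * E (int (n - k) + 1)))"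
      by (rule sum_list_upt_atMost)
    also have "\<dots> = (\<Sum>k\<le>n. g (int k + 1))"
    proof (rule sum.cong[OF refl])
      fix k assume "k \<in> {..n}"
      then have k: "n + 1 - k = n - k + 1" "int m - 1 - (int k + 1) = int (n - k) + 1"
        by (auto simp: m of_nat_diff)
      define b where "b = n - k"
      have "w k = - of_int ((int k + 1) * (int (n - k) + 1)) / 2"
        unfolding w_def k(1) b_def[symmetric] by (simp add: algebra_simps)
      then show "sym_scale (w k) (E (int k + 1) * E (int (n - k) + 1)) = g (int k + 1)"
        by (simp only: g_def k(2))
    qed
    also have "\<dots> = (\<Sum>i\<in>{1..int m - 2}. g i)"
      by (rule sum.reindex_bij_witness[of _ "\<lambda>i. nat (i - 1)" "\<lambda>k. int k + 1"]) (auto simp: m)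
    also have "\<dots> = raising (1 - int m)"
    proof -
      have half: "sym_scale (- of_int c / 2) x = - (half * (of_int c * x))" for c x
        using sym.scale_scale[of "- 1 / 2" "of_int c" x]
        by (simp add: half_def sym_scale_of_int flip: sym_scale_def)
      have "- (1 - int m) = int m - 1" "int m - 2 = int m - 1 - 1" by simp_all
      then show ?thesis by (simp only: g_def half raising_def sum_distrib_left sum_negf)
    qed
    finally show ?thesis .
  qed
  ultimately show ?thesis by blast
qed

section \<open>The vacuum value of the raising part\<close>

lemma vfield_decomposition:
  obtains Y R where "Y \<in> mero.span (range (\<lambda>k. t ^ (k + 3) / t'))" "vfield_regular_at R p" "Z = Y + R"
proof -
  define h where "h = t\<^sup>2 / t'"
  have h: "h \<noteq> 0" by (simp add: h_def)
  obtain q where q: "q \<in> mero.span (range (\<lambda>k. t ^ Suc k))" "reg (Z / h - q) p"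
    using principal_part by blast
  have "q * h \<in> mero.span (range (\<lambda>k. t ^ Suc k * h))"
    using q(1) by (simp only: span_image_mult[OF h, symmetric])
  also have "(\<lambda>k. t ^ Suc k * h) = (\<lambda>k. t ^ (k + 3) / t')"
    by (simp add: h_def fun_eq_iff numeral_eq_Suc mult_ac)
  finally have "q * h \<in> mero.span (range (\<lambda>k. t ^ (k + 3) / t'))" .
  moreover have "(Z - q * h) / h = Z / h - q" using h by (simp add: diff_divide_distrib)
  then have "(Z - q * h) * t' / t\<^sup>2 = Z / h - q" by (simp add: h_def)
  then have "vfield_regular_at (Z - q * h) p" using q(2) by (simp add: vfield_regular_at_base)
  ultimately show ?thesis using that[of "q * h" "Z - q * h"] by simp
qed

text \<open>The coefficient of \<open>t\<^sup>k d/dt\<close> in a vector field, for the \<open>k\<close> for which this field is singular at \<open>p\<close>.\<close>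

definition vcoef :: "nat \<Rightarrow> vfield \<Rightarrow> complex" where
  "vcoef k Y = (if k \<ge> 3 then - form_residue p (t powi (- int k - 1) * Y * t'\<^sup>2) else 0)"

lemma vcoef_add: "vcoef k (Y + Z) = vcoef k Y + vcoef k Z"
  by (simp add: vcoef_def distrib_left distrib_right form_residue_add)

lemma vcoef_scale: "vcoef k (mero_scale c Y) = c * vcoef k Y"
proof -
  have "t powi (- int k - 1) * mero_scale c Y * t'\<^sup>2 = mero_scale c (t powi (- int k - 1) * Y * t'\<^sup>2)"
    by (simp add: mero_scale_def)
  then show ?thesis by (simp add: vcoef_def form_residue_scale)
qed

lemma vcoef_monomial: "vcoef k (t ^ j / t') = (if k = j \<and> k \<ge> 3 then 1 else 0)"
proof -
  have "t powi (- int k - 1) * (t ^ j / t') * t'\<^sup>2 = t powi (- int k - 1) * t powi (int j) * t'"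
    by (simp add: power2_eq_square)
  also have "t powi (- int k - 1) * t powi (int j) = t powi (- int k - 1 + int j)"
    by (rule power_int_add[symmetric]) simp
  also have "- int k - 1 + int j = int j - int k - 1" by simp
  finally show ?thesis unfolding vcoef_def by (simp only: form_residue_powi) auto
qed

lemma vcoef_regular:
  assumes "vfield_regular_at R p"
  shows "vcoef k R = 0"
proof (cases "k \<ge> 3")
  case True
  have "t powi (- int k - 1) * t ^ 4 = t powi (3 - int k)"
    using power_int_add[of t "- int k - 1" 4] by simp
  moreover have "t powi (- int k - 1) * R * t'\<^sup>2 * t\<^sup>2 / t'
      = (t powi (- int k - 1) * t ^ 4) * (R * t' / t\<^sup>2)"
    by (simp add: numeral_eq_Suc)
  moreover have "reg (t powi (3 - int k) * (R * t' / t\<^sup>2)) p"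
    using assms True by (intro reg_mult reg_powi) (simp_all add: vfield_regular_at_base)
  ultimately have "form_regular_at (t powi (- int k - 1) * R * t'\<^sup>2) p"
    unfolding form_regular_at_base by (simp only:)
  then show ?thesis by (simp add: vcoef_def form_residue_regular_at)
qed (simp add: vcoef_def)

lemma finite_vcoef: "finite {k. vcoef k Z \<noteq> 0}"
proof -
  obtain Y R where d: "Y \<in> mero.span (range (\<lambda>k. t ^ (k + 3) / t'))" "vfield_regular_at R p" "Z = Y + R"
    by (rule vfield_decomposition)
  have "vcoef k Z = vcoef k Y" for k using d(2) by (simp add: d(3) vcoef_add vcoef_regular)
  moreover from d(1) have "finite {k. vcoef k Y \<noteq> 0}"
  proof (induction rule: mero.span_induct_alt)
    case base
    have "vcoef k 0 = 0" for k using vcoef_scale[of k 0 0] by simp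
    then show ?case by simp
  next
    case (step c x y)
    then obtain j where x: "x = t ^ (j + 3) / t'" by (elim imageE)
    have sub: "{k. vcoef k (mero_scale c x + y) \<noteq> 0} \<subseteq> insert (j + 3) {k. vcoef k y \<noteq> 0}"
      by (auto simp: x vcoef_add vcoef_scale vcoef_monomial)
    show ?case by (rule finite_subset[OF sub]) (simp add: step(2))
  qed
  ultimately show ?thesis by simp
qed

text \<open>The vacuum value of the raising part for an arbitrary vector field; the sum has finite support.\<close>

definition vac :: "vfield \<Rightarrow> sym" where
  "vac Y = Sum_any (\<lambda>k. sym_scale (vcoef k Y) (raising (1 - int k)))"

lemma finite_vac: "finite {k. sym_scale (vcoef k Y) (raising (1 - int k)) \<noteq> 0}"
  by (rule finite_subset[OF _ finite_vcoef[of Y]]) auto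

lemma vac_add: "vac (Y + Z) = vac Y + vac Z"
  unfolding vac_def vcoef_add sym.scale_left_distrib by (intro Sum_any.distrib finite_vac)

lemma vac_scale: "vac (mero_scale c Y) = sym_scale c (vac Y)"
  unfolding vac_def vcoef_scale sym_scale_def[of c] sym.scale_scale[symmetric]
  by (rule Sum_any_right_distrib[symmetric]) (rule finite_vac)

lemma vac_monomial: "vac (t ^ k / t') = raising (1 - int k)"
proof (cases "k \<ge> 3")
  case True
  then show ?thesis
    unfolding vac_def vcoef_monomial by (subst Sum_any.expand_superset[of "{k}"]) auto
next
  case False
  then have "raising (1 - int k) = 0" by (simp add: raising_def)
  moreover have "vcoef j (t ^ k / t') = 0" for j using False by (simp add: vcoef_monomial)
  ultimately show ?thesis by (simp add: vac_def)
qed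

lemma vac_regular: "vfield_regular_at R p \<Longrightarrow> vac R = 0"
  by (simp add: vac_def vcoef_regular)

lemma vac_represents:
  assumes "vfield_regular_away p Y"
  shows "\<exists>ps. represents Y ps \<and> sym_list ps = vac Y"
proof -
  have "Y \<in> mero.span (range (\<lambda>k. t ^ k / t'))" using assms by (simp only: vfield_regular_away_iff)
  then have "vfield_regular_away p Y \<and> (\<exists>ps. represents Y ps \<and> sym_list ps = vac Y)"
  proof (induction rule: mero.span_induct_alt)
    case base
    have "represents 0 []"
      using ev_const[of 0] by (simp add: represents_def bidiff_def omega_std_def)
    moreover have "vac 0 = 0" using vac_scale[of 0 0] by simp
    ultimately show ?case
      by (intro conjI exI[of _ "[]"]) (simp_all add: vfield_regular_away_iff mero.span_zero sym_list_def)
  next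
    case (step c x y)
    then obtain k where x: "x = t ^ k / t'" by (elim imageE)
    obtain ps where ps: "represents y ps" "sym_list ps = vac y" and y: "vfield_regular_away p y"
      using step(2) by (elim conjE exE)
    obtain qs where qs: "represents x qs" "sym_list qs = vac x"
      using represents_monomial[of k] by (auto simp: x vac_monomial)
    have x_away: "vfield_regular_away p x" unfolding x by (rule monomial_field_away)
    then have cx: "vfield_regular_away p (mero_scale c x)"
      by (simp add: vfield_regular_away_iff mero.span_scale)
    have "represents (mero_scale c x + y) (map (\<lambda>(\<alpha>, \<beta>). (mero_scale c \<alpha>, \<beta>)) qs @ ps)"
      by (intro represents_add cx y represents_scale x_away qs ps)
    moreover have "sym_list (map (\<lambda>(\<alpha>, \<beta>). (mero_scale c \<alpha>, \<beta>)) qs @ ps) = vac (mero_scale c x + y)"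
      by (simp only: sym_list_append sym_list_scale qs(2) ps(2) vac_add vac_scale)
    moreover have "vfield_regular_away p (mero_scale c x + y)"
      using cx y by (simp add: vfield_regular_away_iff mero.span_add)
    ultimately show ?case by (intro conjI exI)
  qed
  then show ?thesis ..
qed

lemma omega_form_eq_vac: "vfield_regular_away p Y \<Longrightarrow> omega_form p Y = vac Y"
  using vac_represents omega_form_eq by metis

lemma X_plus_vac_eq: "X_plus_vac p = vac"
  unfolding X_plus_vac_def
proof (rule the_equality)
  show "linear_between mero_scale sym_scale UNIV vac \<and> (\<forall>Z. vfield_regular_at Z p \<longrightarrow> vac Z = 0) \<and>
     (\<forall>Z. vfield_regular_away p Z \<longrightarrow> vac Z = omega_form p Z)"
    by (simp add: linear_between_def vac_add vac_scale vac_regular omega_form_eq_vac)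
next
  fix S
  assume S: "linear_between mero_scale sym_scale UNIV S \<and> (\<forall>Z. vfield_regular_at Z p \<longrightarrow> S Z = 0) \<and>
     (\<forall>Z. vfield_regular_away p Z \<longrightarrow> S Z = omega_form p Z)"
  show "S = vac"
  proof
    fix Z
    obtain Y R where d: "Y \<in> mero.span (range (\<lambda>k. t ^ (k + 3) / t'))" "vfield_regular_at R p" "Z = Y + R"
      by (rule vfield_decomposition)
    have "range (\<lambda>k. t ^ (k + 3) / t') \<subseteq> range (\<lambda>k. t ^ k / t')" by (rule image_subsetI) (rule rangeI)
    then have "vfield_regular_away p Y"
      unfolding vfield_regular_away_iff using d(1) mero.span_mono by blast
    then show "S Z = vac Z"
      using S d(2) by (simp add: d(3) linear_between_def vac_add vac_regular omega_form_eq_vac)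
  qed
qed

lemma X_plus_vac_X: "X_plus_vac p (X n) = raising n"
proof (cases "n \<le> 1")
  case True
  then obtain k where k: "1 - n = int k" by (metis diff_ge_0_iff_ge zero_le_imp_eq_int)
  then have "X n = t ^ k / t'" by (simp add: X_field_eq)
  moreover have "1 - int k = n" using k by simp
  ultimately show ?thesis using vac_monomial[of k] by (simp add: X_plus_vac_eq)
next
  case False
  have "X n * t' / t\<^sup>2 = t powi (1 - n) / t\<^sup>2" by (simp add: X_field_eq)
  also have "\<dots> = t powi (- 1 - n)" using power_int_diff[of t "1 - n" 2] by simp
  finally have "vfield_regular_at (X n) p"
    unfolding vfield_regular_at_base using reg_powi[of "- 1 - n"] False by simp
  then show ?thesis using False by (simp add: X_plus_vac_eq vac_regular raising_def)
qed

lemma L_op_eq: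
  assumes "w \<in> W_space p"
  shows "L_op p (X n) w = T n w"
  unfolding L_op_def X_minus_eq[OF assms] X_zero_eq[OF assms] X_plus_eq[OF assms] X_plus_vac_X T_def ..

end

theorem proposition5p16:
  fixes p :: cpline and u :: mero and L :: "int \<Rightarrow> sym \<Rightarrow> sym" and l m :: int
  assumes "coordinate u"
    and "vanishes_at u p"
    and "\<And>n. L n = L_op p (X_field u n)"
  shows "\<forall>w \<in> W_space p.
    L l (L m w) - L m (L l w) =
      sym_scale (of_int (l - m)) (L (l + m) w)
      + sym_scale ((of_int l ^ 3 - of_int l) / 12 * (if l + m = 0 then 1 else 0)) w"
proof
  fix w assume w: "w \<in> W_space p"
  obtain c d where "c \<noteq> 0" "inverse u = mero_const c * stdpole p + mero_const d"
    by (rule inverse_vanishing_coordinate[OF assms(1,2)])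
  then interpret pole_coordinate p "inverse u" c d by unfold_locales
  have L: "L n x = T n x" if "x \<in> W_space p" for n x
    using L_op_eq[OF that] by (simp add: assms(3))
  show "L l (L m w) - L m (L l w) =
      sym_scale (of_int (l - m)) (L (l + m) w)
      + sym_scale ((of_int l ^ 3 - of_int l) / 12 * (if l + m = 0 then 1 else 0)) w"
    using virasoro_relation[OF w, of l m] w by (simp only: L T_in_W sym_scale_of_int)
qed

end
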